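(* Let $f\colon M\to N$ be a smooth map between Banach manifolds and let $m\in M$. If $T_m f\colon T_mM\to T_{f(m)}N$ is a regular operator, then $f$ can be brought into a normal form at $m$. In particular, every smooth map between finite-dimensional manifolds can be brought into a normal form at every point.
   Context: Manifolds are smooth manifolds without boundary, possibly infinite-dimensional; a Banach manifold is one modeled on Banach spaces. A chart at a point sends that point to $0$. Regular operator: a continuous linear map $T\colon X\to Y$ between locally convex spaces is regular if it is relatively open (open as a map onto $\operatorname{Im}T$ with the relative topology) and $\operatorname{Ker}T\subseteq X$, $\operatorname{Im}T\subseteq Y$ are closed, topologically complemented subspaces. Abstract normal form: a tuple $(X,Y,\hat f,f_{\mathrm{sing}})$ where (i) $X,Y$ are locally convex spaces with topological direct sum decompositions $X=\mathrm{Ker}\oplus\mathrm{Coim}$, $Y=\mathrm{Coker}\oplus\mathrm{Im}$ (the names denote abstract closed subspaces); (ii) $\hat f\colon\mathrm{Coim}\to\mathrm{Im}$ is a linear topological isomorphism; (iii) $f_{\mathrm{sing}}\colon U\to\mathrm{Coker}$ is a smooth map on an open neighborhood $U$ of $0$ in $X$ with $f_{\mathrm{sing}}(0,x_2)=0$ for all $x_2\in U\cap\mathrm{Coim}$ and derivative $T_{(0,0)}f_{\mathrm{sing}}=0$. Put $f_{\mathrm{NF}}(x_1,x_2)=\hat f(x_2)+f_{\mathrm{sing}}(x_1,x_2)$ for $(x_1,x_2)\in U$, with $x_1\in\mathrm{Ker}$, $x_2\in\mathrm{Coim}$. A smooth map $f\colon M\to N$ can be brought into a normal form at $m\in M$ if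 there are an abstract normal form $(X,Y,\hat f,f_{\mathrm{sing}})$ and charts $\kappa\colon M\supseteq U'\to U\subseteq X$ at $m$ and $\rho\colon N\supseteq V'\to V\subseteq Y$ at $f(m)$ with $f(U')\subseteq V'$ and $\rho\circ f|_{U'}=f_{\mathrm{NF}}\circ\kappa$. *)

theory Defs
  imports "HOL-Analysis.Analysis" "HOL-Library.Function_Algebras"
begin

section \<open>Locally convex spaces and Banach spaces\<close>

text \<open>
  A topological vector space is a topology whose carrier (\<open>topspace\<close>) is a linear subspace of an
  ambient real vector space type that itself carries no topology.  Hence different charts of one
  manifold may take values in different spaces, and zero-dimensional spaces are included.
\<close>

definition locally_convex_space :: "'a::real_vector topology \<Rightarrow> bool" where
  "locally_convex_space X \<longleftrightarrow>
     subspace (topspace X) \<and> Hausdorff_space X \<and>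
     continuous_map (prod_topology X X) X (\<lambda>(x, y). x + y) \<and>
     continuous_map (prod_topology euclideanreal X) X (\<lambda>(t, x). t *\<^sub>R x) \<and>
     (\<forall>W. openin X W \<and> 0 \<in> W \<longrightarrow> (\<exists>C. openin X C \<and> convex C \<and> 0 \<in> C \<and> C \<subseteq> W))"

text \<open>
  The library's \<open>Metric_space\<close> requires nonnegativity and symmetry of the distance also outside the
  carrier; this is no restriction here, since \<open>n\<close> may be taken to vanish there.
\<close>

definition banach_space :: "'a::real_vector topology \<Rightarrow> bool" where
  "banach_space X \<longleftrightarrow>
     subspace (topspace X) \<and>
     (\<exists>n::'a \<Rightarrow> real.
        (\<forall>x\<in>topspace X. 0 \<le> n x \<and> (n x = 0 \<longleftrightarrow> x = 0)) \<and>
        (\<forall>x\<in>topspace X. \<forall>t. n (t *\<^sub>R x) = \<bar>t\<bar> * n x) \<and>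
        (\<forall>x\<in>topspace X. \<forall>y\<in>topspace X. n (x + y) \<le> n x + n y) \<and>
        Metric_space (topspace X) (\<lambda>x y. n (x - y)) \<and>
        Metric_space.mcomplete (topspace X) (\<lambda>x y. n (x - y)) \<and>
        Metric_space.mtopology (topspace X) (\<lambda>x y. n (x - y)) = X)"

definition finite_dimensional :: "'a::real_vector topology \<Rightarrow> bool" where
  "finite_dimensional X \<longleftrightarrow> (\<exists>B. finite B \<and> topspace X \<subseteq> span B)"

definition linear_map_on :: "'a::real_vector set \<Rightarrow> ('a \<Rightarrow> 'b::real_vector) \<Rightarrow> bool" where
  "linear_map_on S T \<longleftrightarrow>
     (\<forall>x\<in>S. \<forall>y\<in>S. T (x + y) = T x + T y) \<and> (\<forall>x\<in>S. \<forall>t. T (t *\<^sub>R x) = t *\<^sub>R T x)"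

definition topological_direct_sum :: "'a::real_vector topology \<Rightarrow> 'a set \<Rightarrow> 'a set \<Rightarrow> bool" where
  "topological_direct_sum X K L \<longleftrightarrow>
     subspace K \<and> subspace L \<and> closedin X K \<and> closedin X L \<and>
     homeomorphic_map (prod_topology (subtopology X K) (subtopology X L)) X (\<lambda>(k, l). k + l)"

definition regular_operator ::
  "'a::real_vector topology \<Rightarrow> 'b::real_vector topology \<Rightarrow> ('a \<Rightarrow> 'b) \<Rightarrow> bool" where
  "regular_operator X Y T \<longleftrightarrow>
     linear_map_on (topspace X) T \<and> continuous_map X Y T \<and>
     open_map X (subtopology Y (T ` topspace X)) T \<and>
     (\<exists>L. topological_direct_sum X {x \<in> topspace X. T x = 0} L) \<and>
     (\<exists>L. topological_direct_sum Y (T ` topspace X) L)"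

section \<open>Smooth maps between locally convex spaces\<close>

text \<open>
  Differential calculus in the sense of Michal--Bastiani (also Milnor, Hamilton): a map is smooth if
  all its iterated directional derivatives exist and are jointly continuous in the base point and the
  directions.  On Banach spaces this agrees with Frechet smoothness.
\<close>

definition has_dir_deriv ::
  "'b::real_vector topology \<Rightarrow> ('a::real_vector \<Rightarrow> 'b) \<Rightarrow> 'a \<Rightarrow> 'a \<Rightarrow> 'b \<Rightarrow> bool" where
  "has_dir_deriv Y f x v l \<longleftrightarrow>
     limitin Y (\<lambda>t::real. (f (x + t *\<^sub>R v) - f x) /\<^sub>R t) l (at 0)"

definition dir_deriv ::
  "'b::real_vector topology \<Rightarrow> ('a::real_vector \<Rightarrow> 'b) \<Rightarrow> 'a \<Rightarrow> 'a \<Rightarrow> 'b" where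
  "dir_deriv Y f x v = (THE l. has_dir_deriv Y f x v l)"

text \<open>\<open>iter_deriv Y f k v x\<close> is the derivative of order \<open>k\<close> at \<open>x\<close> in directions \<open>v 0, \<dots>, v (k - 1)\<close>.\<close>

primrec iter_deriv ::
  "'b::real_vector topology \<Rightarrow> ('a::real_vector \<Rightarrow> 'b) \<Rightarrow> nat \<Rightarrow> (nat \<Rightarrow> 'a) \<Rightarrow> 'a \<Rightarrow> 'b" where
  "iter_deriv Y f 0 v = f"
| "iter_deriv Y f (Suc k) v = (\<lambda>x. dir_deriv Y (iter_deriv Y f k v) x (v k))"

text \<open>The value of \<open>f\<close> outside the open set \<open>U\<close> is irrelevant.\<close>

definition smooth_map_on ::
  "'a::real_vector topology \<Rightarrow> 'a set \<Rightarrow> 'b::real_vector topology \<Rightarrow> ('a \<Rightarrow> 'b) \<Rightarrow> bool" where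
  "smooth_map_on X U Y f \<longleftrightarrow>
     openin X U \<and>
     (\<forall>k. \<forall>x\<in>U. \<forall>v\<in>{..k} \<rightarrow> topspace X. \<exists>l. has_dir_deriv Y (iter_deriv Y f k v) x (v k) l) \<and>
     (\<forall>k. continuous_map (prod_topology (subtopology X U) (product_topology (\<lambda>_. X) {..<k})) Y
            (\<lambda>(x, v). iter_deriv Y f k v x))"

section \<open>Manifolds\<close>

record ('m, 'a) chart =
  cdom :: "'m set"
  cmap :: "'m \<Rightarrow> 'a"
  cmodel :: "'a topology"

definition is_chart :: "'m topology \<Rightarrow> ('m, 'a::real_vector) chart \<Rightarrow> bool" where
  "is_chart M c \<longleftrightarrow>
     openin M (cdom c) \<and> locally_convex_space (cmodel c) \<and> openin (cmodel c) (cmap c ` cdom c) \<and>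
     homeomorphic_map (subtopology M (cdom c)) (subtopology (cmodel c) (cmap c ` cdom c)) (cmap c)"

definition local_rep :: "('m, 'a) chart \<Rightarrow> ('m \<Rightarrow> 'n) \<Rightarrow> ('n, 'b) chart \<Rightarrow> 'a \<Rightarrow> 'b" where
  "local_rep c f d = cmap d \<circ> f \<circ> inv_into (cdom c) (cmap c)"

text \<open>Chart changes are the local representatives of the identity.\<close>

definition compatible_charts ::
  "('m, 'a::real_vector) chart \<Rightarrow> ('m, 'a) chart \<Rightarrow> bool" where
  "compatible_charts c d \<longleftrightarrow>
     smooth_map_on (cmodel c) (cmap c ` (cdom c \<inter> cdom d)) (cmodel d) (local_rep c id d) \<and>
     smooth_map_on (cmodel d) (cmap d ` (cdom c \<inter> cdom d)) (cmodel c) (local_rep d id c)"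

definition smooth_manifold :: "'m topology \<Rightarrow> ('m, 'a::real_vector) chart set \<Rightarrow> bool" where
  "smooth_manifold M A \<longleftrightarrow>
     Hausdorff_space M \<and> (\<forall>c\<in>A. is_chart M c) \<and> (\<Union>c\<in>A. cdom c) = topspace M \<and>
     (\<forall>c\<in>A. \<forall>d\<in>A. compatible_charts c d)"

definition banach_manifold :: "'m topology \<Rightarrow> ('m, 'a::real_vector) chart set \<Rightarrow> bool" where
  "banach_manifold M A \<longleftrightarrow> smooth_manifold M A \<and> (\<forall>c\<in>A. banach_space (cmodel c))"

text \<open>
  Each finite-dimensional model space carries its usual (complete) norm topology; the dimension may
  vary from chart to chart.
\<close>

definition finite_dimensional_manifold ::
  "'m topology \<Rightarrow> ('m, 'a::real_vector) chart set \<Rightarrow> bool" where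
  "finite_dimensional_manifold M A \<longleftrightarrow>
     banach_manifold M A \<and> (\<forall>c\<in>A. finite_dimensional (cmodel c))"

text \<open>\<open>chart_at M A m c\<close>: \<open>c\<close> is a chart of the maximal atlas generated by \<open>A\<close>, sending \<open>m\<close> to \<open>0\<close>.\<close>

definition chart_at ::
  "'m topology \<Rightarrow> ('m, 'a::real_vector) chart set \<Rightarrow> 'm \<Rightarrow> ('m, 'a) chart \<Rightarrow> bool" where
  "chart_at M A m c \<longleftrightarrow>
     is_chart M c \<and> (\<forall>d\<in>A. compatible_charts c d) \<and> m \<in> cdom c \<and> cmap c m = 0"

definition smooth_manifold_map ::
  "'m topology \<Rightarrow> ('m, 'a::real_vector) chart set \<Rightarrow>
   'n topology \<Rightarrow> ('n, 'b::real_vector) chart set \<Rightarrow> ('m \<Rightarrow> 'n) \<Rightarrow> bool" where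
  "smooth_manifold_map M A N B f \<longleftrightarrow>
     continuous_map M N f \<and>
     (\<forall>c\<in>A. \<forall>d\<in>B. smooth_map_on (cmodel c) (cmap c ` {p \<in> cdom c. f p \<in> cdom d}) (cmodel d)
                     (local_rep c f d))"

section \<open>Tangent spaces and tangent maps\<close>

text \<open>
  A tangent vector at \<open>m\<close> is a family of vectors, one in the model space of each chart around \<open>m\<close>,
  transforming under the derivatives of the chart changes.  Such families are added and scaled
  componentwise.
\<close>

instantiation "fun" :: (type, real_vector) real_vector
begin

definition scaleR_fun :: "real \<Rightarrow> ('a \<Rightarrow> 'b) \<Rightarrow> 'a \<Rightarrow> 'b" where
  "scaleR_fun t f = (\<lambda>x. t *\<^sub>R f x)"

instance
  by standard (simp_all add: scaleR_fun_def fun_eq_iff scaleR_add_right scaleR_add_left)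

end

definition charts_around :: "('m, 'a) chart set \<Rightarrow> 'm \<Rightarrow> ('m, 'a) chart set" where
  "charts_around A m = {c \<in> A. m \<in> cdom c}"

definition tangent_vectors ::
  "('m, 'a::real_vector) chart set \<Rightarrow> 'm \<Rightarrow> (('m, 'a) chart \<Rightarrow> 'a) set" where
  "tangent_vectors A m =
     {v. (\<forall>c. c \<notin> charts_around A m \<longrightarrow> v c = 0) \<and>
         (\<forall>c\<in>charts_around A m. v c \<in> topspace (cmodel c)) \<and>
         (\<forall>c\<in>charts_around A m. \<forall>d\<in>charts_around A m.
            v d = dir_deriv (cmodel d) (local_rep c id d) (cmap c m) (v c))}"

text \<open>
  The coarsest topology making all components continuous; since the components determine each other
  by topological isomorphisms, each single one is then a homeomorphism onto its model space.
\<close>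

definition tangent_space ::
  "('m, 'a::real_vector) chart set \<Rightarrow> 'm \<Rightarrow> (('m, 'a) chart \<Rightarrow> 'a) topology" where
  "tangent_space A m =
     topology_generated_by
       {{v \<in> tangent_vectors A m. v c \<in> W} | c W. c \<in> charts_around A m \<and> openin (cmodel c) W}"

text \<open>By the chain rule, the chosen chart \<open>c\<close> around \<open>m\<close> does not matter.\<close>

definition tangent_map ::
  "('m, 'a::real_vector) chart set \<Rightarrow> ('n, 'b::real_vector) chart set \<Rightarrow> ('m \<Rightarrow> 'n) \<Rightarrow> 'm \<Rightarrow>
   (('m, 'a) chart \<Rightarrow> 'a) \<Rightarrow> (('n, 'b) chart \<Rightarrow> 'b)" where
  "tangent_map A B f m v =
     (let c = (SOME c. c \<in> charts_around A m) in
      (\<lambda>d. if d \<in> charts_around B (f m)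
           then dir_deriv (cmodel d) (local_rep c f d) (cmap c m) (v c) else 0))"

section \<open>Normal forms\<close>

definition abstract_normal_form ::
  "'a::real_vector topology \<Rightarrow> 'a set \<Rightarrow> 'a set \<Rightarrow> 'b::real_vector topology \<Rightarrow> 'b set \<Rightarrow> 'b set \<Rightarrow>
   ('a \<Rightarrow> 'b) \<Rightarrow> 'a set \<Rightarrow> ('a \<Rightarrow> 'b) \<Rightarrow> bool" where
  "abstract_normal_form X Ker Coim Y Coker Img fhat U fsing \<longleftrightarrow>
     locally_convex_space X \<and> locally_convex_space Y \<and>
     topological_direct_sum X Ker Coim \<and> topological_direct_sum Y Coker Img \<and>
     linear_map_on Coim fhat \<and>
     homeomorphic_map (subtopology X Coim) (subtopology Y Img) fhat \<and>
     openin X U \<and> 0 \<in> U \<and>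
     smooth_map_on X U (subtopology Y Coker) fsing \<and>
     (\<forall>x\<in>U \<inter> Coim. fsing x = 0) \<and>
     (\<forall>v\<in>topspace X. dir_deriv (subtopology Y Coker) fsing 0 v = 0)"

definition direct_sum_snd :: "'a::real_vector set \<Rightarrow> 'a set \<Rightarrow> 'a \<Rightarrow> 'a" where
  "direct_sum_snd K L x = (THE l. l \<in> L \<and> x - l \<in> K)"

definition normal_form_map ::
  "'a::real_vector set \<Rightarrow> 'a set \<Rightarrow> ('a \<Rightarrow> 'b::real_vector) \<Rightarrow> ('a \<Rightarrow> 'b) \<Rightarrow> 'a \<Rightarrow> 'b" where
  "normal_form_map Ker Coim fhat fsing x = fhat (direct_sum_snd Ker Coim x) + fsing x"

definition can_be_brought_into_normal_form_at ::
  "'m topology \<Rightarrow> ('m, 'a::real_vector) chart set \<Rightarrow>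
   'n topology \<Rightarrow> ('n, 'b::real_vector) chart set \<Rightarrow> ('m \<Rightarrow> 'n) \<Rightarrow> 'm \<Rightarrow> bool" where
  "can_be_brought_into_normal_form_at M A N B f m \<longleftrightarrow>
     (\<exists>X Ker Coim Y Coker Img fhat U fsing c d.
        abstract_normal_form X Ker Coim Y Coker Img fhat U fsing \<and>
        chart_at M A m c \<and> cmodel c = X \<and> cmap c ` cdom c = U \<and>
        chart_at N B (f m) d \<and> cmodel d = Y \<and>
        f ` cdom c \<subseteq> cdom d \<and>
        (\<forall>p\<in>cdom c. cmap d (f p) = normal_form_map Ker Coim fhat fsing (cmap c p)))"

end

theory Submission
  imports Defs
begin

text \<open>
  Work in charts centred at \<open>m\<close> and \<open>f m\<close>, so that \<open>f\<close> becomes a smooth map \<open>g\<close> between open subsets of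
  Banach spaces \<open>X\<close> and \<open>Y\<close> with \<open>g 0 = 0\<close>, and let \<open>T\<close> be its derivative at \<open>0\<close>.  Regularity of \<open>T\<close>
  splits \<open>X = K \<oplus> L\<close> and \<open>Y = C \<oplus> I\<close> with \<open>K\<close> the kernel and \<open>I\<close> the image of \<open>T\<close>, and \<open>T\<close> restricts to a
  topological isomorphism of \<open>L\<close> onto \<open>I\<close>.  Write \<open>p\<close> and \<open>q\<close> for the projections onto \<open>L\<close> and \<open>I\<close>, and
  \<open>R\<close> for \<open>q\<close> followed by the inverse of that isomorphism.

  The map \<open>\<phi> x = x - p x + R (g x)\<close> has the identity as derivative at \<open>0\<close>, so by the inverse function
  theorem it is a local diffeomorphism, and in the coordinates it defines the \<open>I\<close>-component of \<open>g\<close> is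
  exactly \<open>T \<circ> p\<close>.  The remaining component \<open>h\<close>, with values in \<open>C\<close>, need not vanish on \<open>L\<close>; the shear
  \<open>\<rho> y = y - h (R y)\<close> of the target, which is invertible because \<open>R\<close> kills \<open>C\<close>, subtracts the value of
  \<open>h\<close> at the \<open>L\<close>-component and leaves the singular part \<open>h x - h (p x)\<close>.  This is
  \<open>local_normal_form\<close>.

  Smoothness means that iterated directional derivatives exist and are jointly continuous in the base
  point and the directions.  To show that a map is smooth it is enough to find a family of jointly
  continuous functions which contains the map and is closed under directional differentiation
  (\<open>smooth_map_onI_family\<close>).  For compositions the family consists of the terms of Faa di Bruno's
  formula, for inverse maps of the trees that arise by differentiating
  \<open>D\<psi> y = (D\<phi> (\<psi> y))\<inverse>\<close> again and again.  Both families are closed under differentiation by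
  one rule, \<open>has_dir_deriv_iter_deriv\<close>, which differentiates an iterated derivative whose base point and
  directions all move.  The inverse function theorem itself is the usual contraction argument; the
  estimate it rests on, strict differentiability, follows from joint continuity of the second derivative
  (\<open>smooth_strict_derivative\<close>).

  Evaluating a tangent vector in a chart is a linear homeomorphism of the tangent space onto the model
  space, so regularity of the tangent map is regularity of the derivative of a local representative
  (\<open>regular_tangent_map_in_charts\<close>).  Between finite-dimensional spaces every linear map is regular
  (\<open>finite_dimensional_regular\<close>), since linear maps are continuous and subspaces are complemented there.
\<close>

section \<open>Normed topologies on subspaces of a vector space\<close>

text \<open>
  A space may carry many norms inducing its topology; estimates need one of them as an explicit object,
  while purely topological statements only use \<open>normable\<close>.
\<close>

definition norm_on :: "'a::real_vector topology \<Rightarrow> ('a \<Rightarrow> real) \<Rightarrow> bool" where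
  "norm_on X n \<longleftrightarrow>
     subspace (topspace X) \<and>
     (\<forall>x\<in>topspace X. 0 \<le> n x \<and> (n x = 0 \<longleftrightarrow> x = 0)) \<and>
     (\<forall>x\<in>topspace X. \<forall>t. n (t *\<^sub>R x) = \<bar>t\<bar> * n x) \<and>
     (\<forall>x\<in>topspace X. \<forall>y\<in>topspace X. n (x + y) \<le> n x + n y) \<and>
     Metric_space (topspace X) (\<lambda>x y. n (x - y)) \<and>
     Metric_space.mtopology (topspace X) (\<lambda>x y. n (x - y)) = X"

definition normable :: "'a::real_vector topology \<Rightarrow> bool" where
  "normable X \<longleftrightarrow> (\<exists>n. norm_on X n)"

lemma banach_space_iff:
  "banach_space X \<longleftrightarrow>
     (\<exists>n. norm_on X n \<and> Metric_space.mcomplete (topspace X) (\<lambda>x y. n (x - y)))"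
  unfolding banach_space_def norm_on_def by auto

lemma banach_space_imp_normable: "banach_space X \<Longrightarrow> normable X"
  unfolding banach_space_iff normable_def by auto

lemma normable_subspace: "normable X \<Longrightarrow> subspace (topspace X)"
  unfolding normable_def norm_on_def by auto

lemma norm_on_imp_normable: "norm_on X n \<Longrightarrow> normable X"
  unfolding normable_def by auto

lemma norm_on_imp_subspace: "norm_on X n \<Longrightarrow> subspace (topspace X)"
  unfolding norm_on_def by auto

lemma norm_on_nonneg: "norm_on X n \<Longrightarrow> x \<in> topspace X \<Longrightarrow> 0 \<le> n x"
  unfolding norm_on_def by auto

lemma norm_on_zero_iff: "norm_on X n \<Longrightarrow> x \<in> topspace X \<Longrightarrow> n x = 0 \<longleftrightarrow> x = 0"
  unfolding norm_on_def by auto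

lemma norm_on_zero: "norm_on X n \<Longrightarrow> n 0 = 0"
  using norm_on_zero_iff[of X n 0] subspace_0[OF norm_on_imp_subspace[of X n]] by auto

lemma norm_on_scale: "norm_on X n \<Longrightarrow> x \<in> topspace X \<Longrightarrow> n (t *\<^sub>R x) = \<bar>t\<bar> * n x"
  unfolding norm_on_def by auto

lemma norm_on_add:
  "norm_on X n \<Longrightarrow> x \<in> topspace X \<Longrightarrow> y \<in> topspace X \<Longrightarrow> n (x + y) \<le> n x + n y"
  unfolding norm_on_def by auto

lemma norm_on_minus: "norm_on X n \<Longrightarrow> x \<in> topspace X \<Longrightarrow> n (- x) = n x"
  using norm_on_scale[of X n x "-1"] by simp

lemma norm_on_diff_commute:
  "norm_on X n \<Longrightarrow> x \<in> topspace X \<Longrightarrow> y \<in> topspace X \<Longrightarrow> n (x - y) = n (y - x)"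
  using norm_on_minus[of X n "x - y"] subspace_diff[OF norm_on_imp_subspace[of X n]] by auto

lemma norm_on_diff:
  assumes "norm_on X n" "x \<in> topspace X" "y \<in> topspace X"
  shows "n (x - y) \<le> n x + n y"
  using norm_on_add[OF assms(1,2), of "- y"] norm_on_minus[OF assms(1,3)]
    subspace_neg[OF norm_on_imp_subspace[OF assms(1)] assms(3)] by simp

lemma norm_on_triangle:
  assumes "norm_on X n" "x \<in> topspace X" "y \<in> topspace X" "z \<in> topspace X"
  shows "n (x - z) \<le> n (x - y) + n (y - z)"
  using norm_on_add[OF assms(1), of "x - y" "y - z"] assms
    subspace_diff[OF norm_on_imp_subspace[OF assms(1)]] by (simp add: algebra_simps)

lemma norm_on_Metric_space: "norm_on X n \<Longrightarrow> Metric_space (topspace X) (\<lambda>x y. n (x - y))"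
  unfolding norm_on_def by auto

lemma norm_on_mtopology:
  "norm_on X n \<Longrightarrow> Metric_space.mtopology (topspace X) (\<lambda>x y. n (x - y)) = X"
  unfolding norm_on_def by auto

lemma norm_on_limitin_iff:
  assumes "norm_on X n"
  shows "limitin X f l F \<longleftrightarrow>
    l \<in> topspace X \<and> (\<forall>e>0. \<forall>\<^sub>F i in F. f i \<in> topspace X \<and> n (f i - l) < e)"
  using Metric_space.limitin_metric[OF norm_on_Metric_space[OF assms], of f l F]
  unfolding norm_on_mtopology[OF assms] .

lemma norm_on_openin_iff:
  assumes "norm_on X n"
  shows "openin X U \<longleftrightarrow>
    U \<subseteq> topspace X \<and> (\<forall>x\<in>U. \<exists>r>0. \<forall>y\<in>topspace X. n (y - x) < r \<longrightarrow> y \<in> U)"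
proof -
  interpret Metric_space "topspace X" "\<lambda>x y. n (x - y)"
    by (rule norm_on_Metric_space[OF assms])
  have *: "mball x r \<subseteq> U \<longleftrightarrow> (\<forall>y\<in>topspace X. n (y - x) < r \<longrightarrow> y \<in> U)" if "x \<in> topspace X" for x r
    using that commute[of x] by (auto simp: subset_iff)
  have "openin X U \<longleftrightarrow> openin mtopology U" by (simp only: norm_on_mtopology[OF assms])
  also have "\<dots> \<longleftrightarrow> U \<subseteq> topspace X \<and> (\<forall>x. x \<in> U \<longrightarrow> (\<exists>r>0. mball x r \<subseteq> U))"
    by (rule openin_mtopology)
  finally show ?thesis using * by (meson subsetD)
qed

lemma norm_on_openin_ball:
  assumes n: "norm_on X n" and "c \<in> topspace X"
  shows "openin X {x \<in> topspace X. n (x - c) < r}"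
  unfolding norm_on_openin_iff[OF n]
proof (intro conjI ballI)
  fix x assume x: "x \<in> {x \<in> topspace X. n (x - c) < r}"
  show "\<exists>s>0. \<forall>y\<in>topspace X. n (y - x) < s \<longrightarrow> y \<in> {x \<in> topspace X. n (x - c) < r}"
  proof (intro exI[of _ "r - n (x - c)"] conjI ballI impI)
    fix y assume "y \<in> topspace X" "n (y - x) < r - n (x - c)"
    then show "y \<in> {x \<in> topspace X. n (x - c) < r}"
      using norm_on_triangle[OF n, of y x c] x assms(2) by auto
  qed (use x in auto)
qed auto

lemma norm_on_Hausdorff: "norm_on X n \<Longrightarrow> Hausdorff_space X"
  using Metric_space.Hausdorff_space_mtopology[OF norm_on_Metric_space[of X n]]
    norm_on_mtopology[of X n] by simp

lemma normable_Hausdorff: "normable X \<Longrightarrow> Hausdorff_space X"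
  unfolding normable_def using norm_on_Hausdorff by auto

lemma limitin_add:
  assumes X: "normable X" and f: "limitin X f l F" and g: "limitin X g m F"
  shows "limitin X (\<lambda>i. f i + g i) (l + m) F"
proof -
  obtain n where n: "norm_on X n" using X unfolding normable_def by auto
  note lim = norm_on_limitin_iff[OF n]
  note sub = norm_on_imp_subspace[OF n]
  have lm: "l \<in> topspace X" "m \<in> topspace X" using f g by (auto simp: lim)
  show ?thesis unfolding lim
  proof (intro conjI allI impI)
    fix e :: real assume "e > 0"
    then have "e / 2 > 0" by simp
    then have "\<forall>\<^sub>F i in F. f i \<in> topspace X \<and> n (f i - l) < e / 2"
      "\<forall>\<^sub>F i in F. g i \<in> topspace X \<and> n (g i - m) < e / 2"
      using f g unfolding lim by blast+
    then show "\<forall>\<^sub>F i in F. f i + g i \<in> topspace X \<and> n (f i + g i - (l + m)) < e"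
    proof eventually_elim
      case (elim i)
      then show ?case
        using norm_on_add[OF n, of "f i - l" "g i - m"] lm subspace_add[OF sub] subspace_diff[OF sub]
        by (auto simp: algebra_simps)
    qed
  qed (use lm subspace_add[OF sub] in auto)
qed

lemma limitin_scaleR:
  assumes X: "normable X" and c: "(c \<longlongrightarrow> a) F" and f: "limitin X f l F"
  shows "limitin X (\<lambda>i. c i *\<^sub>R f i) (a *\<^sub>R l) F"
proof -
  obtain n where n: "norm_on X n" using X unfolding normable_def by auto
  note lim = norm_on_limitin_iff[OF n]
  note sub = norm_on_imp_subspace[OF n]
  have l: "l \<in> topspace X" using f by (auto simp: lim)
  have nl: "0 \<le> n l" using norm_on_nonneg[OF n l] .
  show ?thesis unfolding lim
  proof (intro conjI allI impI)
    fix e :: real assume e: "e > 0"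
    define d where "d = e / (2 * (\<bar>a\<bar> + 1))"
    define d' where "d' = min 1 (e / (2 * (n l + 1)))"
    have "d > 0" "d' > 0" using e nl by (auto simp: d_def d'_def)
    then have "\<forall>\<^sub>F i in F. f i \<in> topspace X \<and> n (f i - l) < d"
      "\<forall>\<^sub>F i in F. \<bar>c i - a\<bar> < d'"
      using f c unfolding lim tendsto_iff dist_real_def by auto
    then show "\<forall>\<^sub>F i in F. c i *\<^sub>R f i \<in> topspace X \<and> n (c i *\<^sub>R f i - a *\<^sub>R l) < e"
    proof eventually_elim
      case (elim i)
      have fi: "f i \<in> topspace X" and fl: "f i - l \<in> topspace X"
        using elim l subspace_diff[OF sub] by auto
      have "c i *\<^sub>R f i - a *\<^sub>R l = c i *\<^sub>R (f i - l) + (c i - a) *\<^sub>R l"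
        by (simp add: algebra_simps)
      then have "n (c i *\<^sub>R f i - a *\<^sub>R l) \<le> \<bar>c i\<bar> * n (f i - l) + \<bar>c i - a\<bar> * n l"
        using norm_on_add[OF n, of "c i *\<^sub>R (f i - l)" "(c i - a) *\<^sub>R l"] fl l
          subspace_scale[OF sub] norm_on_scale[OF n] by auto
      also have "\<bar>c i\<bar> * n (f i - l) \<le> (\<bar>a\<bar> + 1) * n (f i - l)"
        using elim norm_on_nonneg[OF n fl] by (intro mult_right_mono) (auto simp: d'_def)
      also have "(\<bar>a\<bar> + 1) * n (f i - l) < (\<bar>a\<bar> + 1) * d"
        using elim by (intro mult_strict_left_mono) auto
      also have "(\<bar>a\<bar> + 1) * d = e / 2" by (simp add: d_def field_simps)
      also have "\<bar>c i - a\<bar> * n l \<le> d' * n l" using elim nl by (intro mult_right_mono) auto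
      also have "d' * n l \<le> e / (2 * (n l + 1)) * n l" using nl by (intro mult_right_mono) (auto simp: d'_def)
      also have "\<dots> \<le> e / 2" using nl e by (simp add: field_simps)
      finally have "n (c i *\<^sub>R f i - a *\<^sub>R l) < e" by simp
      then show ?case using fi subspace_scale[OF sub] by auto
    qed
  qed (use l subspace_scale[OF sub] in auto)
qed

lemma limitin_scaleR_const:
  "normable X \<Longrightarrow> limitin X f l F \<Longrightarrow> limitin X (\<lambda>i. a *\<^sub>R f i) (a *\<^sub>R l) F"
  using limitin_scaleR[of X "\<lambda>_. a" a F f l] by simp

lemma limitin_uminus: "normable X \<Longrightarrow> limitin X f l F \<Longrightarrow> limitin X (\<lambda>i. - f i) (- l) F"
  using limitin_scaleR_const[of X f l F "-1"] by simp

lemma limitin_diff: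
  "normable X \<Longrightarrow> limitin X f l F \<Longrightarrow> limitin X g m F \<Longrightarrow> limitin X (\<lambda>i. f i - g i) (l - m) F"
  using limitin_add[of X f l F "\<lambda>i. - g i" "- m"] limitin_uminus[of X g m F] by simp

lemma limitin_sum:
  assumes X: "normable X" and "finite I" and "\<And>j. j \<in> I \<Longrightarrow> limitin X (f j) (l j) F"
  shows "limitin X (\<lambda>i. \<Sum>j\<in>I. f j i) (\<Sum>j\<in>I. l j) F"
  using assms(2,3)
proof (induction I rule: finite_induct)
  case empty
  then show ?case using subspace_0[OF normable_subspace[OF X]] by simp
next
  case (insert j I)
  then show ?case using limitin_add[OF X, of "f j" "l j" F] by simp
qed

lemma normable_limitin_unique:
  "normable X \<Longrightarrow> limitin X f l F \<Longrightarrow> limitin X f m F \<Longrightarrow> F \<noteq> bot \<Longrightarrow> l = m"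
  using limitin_Hausdorff_unique[of X f l F m] normable_Hausdorff by auto

lemma limitin_reparametrize: "limitin X f l G \<Longrightarrow> filterlim h G F \<Longrightarrow> limitin X (\<lambda>i. f (h i)) l F"
  unfolding limitin_def filterlim_iff by auto

lemma limitin_eventually_topspace: "limitin X f l F \<Longrightarrow> \<forall>\<^sub>F i in F. f i \<in> topspace X"
  unfolding limitin_def by auto

lemma continuous_map_add:
  "normable X \<Longrightarrow> continuous_map Z X f \<Longrightarrow> continuous_map Z X g \<Longrightarrow> continuous_map Z X (\<lambda>z. f z + g z)"
  unfolding continuous_map_atin by (auto intro: limitin_add)

lemma continuous_map_diff:
  "normable X \<Longrightarrow> continuous_map Z X f \<Longrightarrow> continuous_map Z X g \<Longrightarrow> continuous_map Z X (\<lambda>z. f z - g z)"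
  unfolding continuous_map_atin by (auto intro: limitin_diff)

lemma continuous_map_scaleR:
  "normable X \<Longrightarrow> continuous_map Z euclideanreal c \<Longrightarrow> continuous_map Z X g \<Longrightarrow>
   continuous_map Z X (\<lambda>z. c z *\<^sub>R g z)"
  unfolding continuous_map_atin by (auto intro: limitin_scaleR)

lemma continuous_map_sum:
  "normable X \<Longrightarrow> finite I \<Longrightarrow> (\<And>j. j \<in> I \<Longrightarrow> continuous_map Z X (f j)) \<Longrightarrow>
   continuous_map Z X (\<lambda>z. \<Sum>j\<in>I. f j z)"
  unfolding continuous_map_atin by (auto intro: limitin_sum)

lemma norm_on_subtopology:
  assumes n: "norm_on X n" and S: "subspace S" "S \<subseteq> topspace X"
  shows "norm_on (subtopology X S) n"
proof -
  have "topspace (subtopology X S) = S" using S by auto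
  interpret M: Metric_space "topspace X" "\<lambda>x y. n (x - y)" by (rule norm_on_Metric_space[OF n])
  interpret Submetric "topspace X" "\<lambda>x y. n (x - y)" S by unfold_locales (rule S)
  show ?thesis
    using n S sub.Metric_space_axioms mtopology_submetric
    unfolding norm_on_def norm_on_mtopology[OF n] \<open>topspace (subtopology X S) = S\<close>
    by (auto simp: subset_iff simp del: topspace_subtopology)
qed

lemma normable_subtopology:
  "normable X \<Longrightarrow> subspace S \<Longrightarrow> S \<subseteq> topspace X \<Longrightarrow> normable (subtopology X S)"
  unfolding normable_def using norm_on_subtopology by blast

lemma continuous_map_norm:
  assumes n: "norm_on X n"
  shows "continuous_map X euclideanreal n"
  unfolding continuous_map_atin
proof
  fix x assume x: "x \<in> topspace X"
  have "(n \<longlongrightarrow> n x) (atin X x)" unfolding tendsto_iff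
  proof (intro allI impI)
    fix e :: real assume e: "e > 0"
    have "limitin X (\<lambda>y. y) x (atin X x)"
      using limitin_continuous_map[of X X "\<lambda>y. y" x x] x by simp
    then have "\<forall>\<^sub>F y in atin X x. y \<in> topspace X \<and> n (y - x) < e"
      using e unfolding norm_on_limitin_iff[OF n] by auto
    then show "\<forall>\<^sub>F y in atin X x. dist (n y) (n x) < e"
    proof eventually_elim
      case (elim y)
      then have "n y \<le> n (y - x) + n x" "n x \<le> n (x - y) + n y" "n (x - y) = n (y - x)"
        using norm_on_add[OF n, of "y - x" x] norm_on_add[OF n, of "x - y" y] x
          norm_on_diff_commute[OF n, of x y] subspace_diff[OF norm_on_imp_subspace[OF n]] by auto
      then show ?case using elim by (auto simp: dist_real_def)
    qed
  qed
  then show "limitin euclideanreal n (n x) (atin X x)" by simp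
qed

section \<open>Linear maps\<close>

lemma linear_map_on_add: "linear_map_on S T \<Longrightarrow> x \<in> S \<Longrightarrow> y \<in> S \<Longrightarrow> T (x + y) = T x + T y"
  unfolding linear_map_on_def by auto

lemma linear_map_on_scale: "linear_map_on S T \<Longrightarrow> x \<in> S \<Longrightarrow> T (a *\<^sub>R x) = a *\<^sub>R T x"
  unfolding linear_map_on_def by auto

lemma linear_map_on_zero: "linear_map_on S T \<Longrightarrow> subspace S \<Longrightarrow> T 0 = 0"
  using linear_map_on_scale[of S T 0 0] subspace_0[of S] by auto

lemma linear_map_on_minus: "linear_map_on S T \<Longrightarrow> x \<in> S \<Longrightarrow> T (- x) = - T x"
  using linear_map_on_scale[of S T x "-1"] by auto

lemma linear_map_on_diff:
  "linear_map_on S T \<Longrightarrow> subspace S \<Longrightarrow> x \<in> S \<Longrightarrow> y \<in> S \<Longrightarrow> T (x - y) = T x - T y"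
  using linear_map_on_add[of S T x "- y"] linear_map_on_minus[of S T y] subspace_neg[of S y] by auto

lemma linear_map_on_sum:
  assumes "linear_map_on S T" "subspace S" "finite I" "\<And>i. i \<in> I \<Longrightarrow> x i \<in> S"
  shows "T (\<Sum>i\<in>I. x i) = (\<Sum>i\<in>I. T (x i))"
  using assms(3,4)
proof (induction I rule: finite_induct)
  case (insert i I)
  then show ?case using assms(1,2) linear_map_on_add[of S T "x i" "sum x I"] subspace_sum[of S I x] by auto
qed (use assms linear_map_on_zero in auto)

section \<open>Directional derivatives and the mean value inequality\<close>

lemma has_dir_deriv_topspace: "has_dir_deriv Y f x v l \<Longrightarrow> l \<in> topspace Y"
  unfolding has_dir_deriv_def by (rule limitin_topspace)

lemma has_dir_deriv_unique:
  "normable Y \<Longrightarrow> has_dir_deriv Y f x v l \<Longrightarrow> has_dir_deriv Y f x v m \<Longrightarrow> l = m"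
  unfolding has_dir_deriv_def by (rule normable_limitin_unique) auto

lemma dir_deriv_eq: "normable Y \<Longrightarrow> has_dir_deriv Y f x v l \<Longrightarrow> dir_deriv Y f x v = l"
  unfolding dir_deriv_def by (rule the_equality) (auto dest: has_dir_deriv_unique)

lemma has_dir_deriv_dir_deriv:
  "normable Y \<Longrightarrow> has_dir_deriv Y f x v l \<Longrightarrow> has_dir_deriv Y f x v (dir_deriv Y f x v)"
  using dir_deriv_eq[of Y f x v l] by simp

text \<open>
  The points of a line through \<open>x\<close> converge to \<open>x\<close>; hence they eventually lie in every open set
  around \<open>x\<close>, which makes directional derivatives local.
\<close>

lemma limitin_line:
  assumes X: "normable X" and x: "x \<in> topspace X" and v: "v \<in> topspace X"
  shows "limitin X (\<lambda>t. x + t *\<^sub>R v) x (at 0)"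
  using limitin_add[OF X, of "\<lambda>_. x" x "at 0" "\<lambda>t. t *\<^sub>R v" "0 *\<^sub>R v"]
    limitin_scaleR[OF X, of "\<lambda>t. t" 0 "at 0" "\<lambda>_. v" v] x v by (simp add: tendsto_ident_at)

lemma eventually_line_in:
  assumes X: "normable X" and U: "openin X U" and x: "x \<in> U" and v: "v \<in> topspace X"
  shows "\<forall>\<^sub>F t in at (0::real). x + t *\<^sub>R v \<in> U"
  using limitinD[OF limitin_line[OF X _ v, of x] U] openin_subset[OF U] x by auto

lemma has_dir_deriv_cong:
  assumes X: "normable X" and U: "openin X U" and x: "x \<in> U" and v: "v \<in> topspace X"
    and fg: "\<And>y. y \<in> U \<Longrightarrow> f y = g y" and f: "has_dir_deriv Y f x v l"
  shows "has_dir_deriv Y g x v l"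
  using f unfolding has_dir_deriv_def
  by (rule limitin_transform_eventually[rotated])
    (use eventually_line_in[OF X U x v] fg x in \<open>auto elim: eventually_mono\<close>)

lemma has_dir_deriv_const: "c - c \<in> topspace Y \<Longrightarrow> has_dir_deriv Y (\<lambda>_. c) x v 0"
  unfolding has_dir_deriv_def by simp

lemma has_dir_deriv_add:
  "normable Y \<Longrightarrow> has_dir_deriv Y f x v l \<Longrightarrow> has_dir_deriv Y g x v m \<Longrightarrow>
   has_dir_deriv Y (\<lambda>y. f y + g y) x v (l + m)"
  unfolding has_dir_deriv_def
  by (drule (2) limitin_add) (simp add: algebra_simps)

lemma has_dir_deriv_scaleR:
  "normable Y \<Longrightarrow> has_dir_deriv Y f x v l \<Longrightarrow> has_dir_deriv Y (\<lambda>y. a *\<^sub>R f y) x v (a *\<^sub>R l)"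
  unfolding has_dir_deriv_def
  by (drule (1) limitin_scaleR_const[of _ _ _ _ a]) (simp add: algebra_simps)

lemma has_dir_deriv_scaleR_direction:
  assumes Y: "normable Y" and f: "has_dir_deriv Y f x v l"
  shows "has_dir_deriv Y f x (a *\<^sub>R v) (a *\<^sub>R l)"
proof (cases "a = 0")
  case True
  then show ?thesis using subspace_0[OF normable_subspace[OF Y]] by (simp add: has_dir_deriv_def)
next
  case False
  have "filterlim (\<lambda>t. t * a) (at 0) (at (0::real))"
    unfolding filterlim_at using False
    by (auto simp: eventually_at_filter intro!: tendsto_eq_intros)
  from limitin_reparametrize[OF f[unfolded has_dir_deriv_def] this]
  have "limitin Y (\<lambda>t. a *\<^sub>R ((f (x + (t * a) *\<^sub>R v) - f x) /\<^sub>R (t * a))) (a *\<^sub>R l) (at 0)"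
    by (rule limitin_scaleR_const[OF Y])
  then show ?thesis unfolding has_dir_deriv_def using False by (simp add: field_simps)
qed

text \<open>
  If the increment of \<open>c - s *\<^sub>R l\<close> over \<open>[0, 1]\<close> exceeded the bound, bisection would produce
  arbitrarily short intervals around one point with the same excess, against differentiability there.
  \<open>Bolzano\<close> is this bisection principle.
\<close>

lemma mean_value_inequality:
  fixes c :: "real \<Rightarrow> 'b::real_vector"
  assumes n: "norm_on Y n" and l: "l \<in> topspace Y"
    and c: "\<And>s. 0 \<le> s \<Longrightarrow> s \<le> 1 \<Longrightarrow> c s \<in> topspace Y"
    and c': "\<And>s. 0 \<le> s \<Longrightarrow> s \<le> 1 \<Longrightarrow> has_dir_deriv Y c s 1 (c' s)"
    and le: "\<And>s. 0 \<le> s \<Longrightarrow> s \<le> 1 \<Longrightarrow> n (c' s - l) \<le> e"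
  shows "n (c 1 - c 0 - l) \<le> e"
proof (rule field_le_epsilon)
  fix d :: real assume d: "d > 0"
  note sub = norm_on_imp_subspace[OF n]
  \<comment> \<open>The claim on a subinterval, with a slack \<open>d\<close> that absorbs the error term of the derivative.\<close>
  define P where "P a b \<longleftrightarrow> (0 \<le> a \<and> b \<le> 1 \<and> a \<le> b \<longrightarrow> n (c b - c a - (b - a) *\<^sub>R l) \<le> (e + d) * (b - a))"
    for a b
  have mem: "c b - c a - r *\<^sub>R l \<in> topspace Y" if "0 \<le> a" "a \<le> 1" "0 \<le> b" "b \<le> 1" for a b r
    using that c l subspace_diff[OF sub] subspace_scale[OF sub] by auto
  have "P 0 1"
  proof (rule Bolzano)
    fix r s t assume trans: "P r s" "P s t" "r \<le> s" "s \<le> t"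
    show "P r t" unfolding P_def
    proof safe
      assume "0 \<le> r" "t \<le> 1" "r \<le> t"
      then have "n (c s - c r - (s - r) *\<^sub>R l) \<le> (e + d) * (s - r)"
        "n (c t - c s - (t - s) *\<^sub>R l) \<le> (e + d) * (t - s)"
        using trans by (auto simp: P_def)
      moreover have "c t - c r - (t - r) *\<^sub>R l = (c s - c r - (s - r) *\<^sub>R l) + (c t - c s - (t - s) *\<^sub>R l)"
        by (simp add: algebra_simps)
      ultimately show "n (c t - c r - (t - r) *\<^sub>R l) \<le> (e + d) * (t - r)"
        using norm_on_add[OF n, of "c s - c r - (s - r) *\<^sub>R l" "c t - c s - (t - s) *\<^sub>R l"]
          mem[of r s "s - r"] mem[of s t "t - s"] \<open>0 \<le> r\<close> \<open>t \<le> 1\<close> trans(3,4)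
        by (simp add: algebra_simps)
    qed
  next
    fix x :: real assume local: "0 \<le> x" "x \<le> 1"
    have c'x: "c' x \<in> topspace Y" using has_dir_deriv_topspace[OF c'[OF local]] .
    have "\<forall>\<^sub>F t in at 0. (c (x + t) - c x) /\<^sub>R t \<in> topspace Y \<and> n ((c (x + t) - c x) /\<^sub>R t - c' x) < d"
      using c'[OF local] d unfolding has_dir_deriv_def norm_on_limitin_iff[OF n] by simp
    then obtain r where r: "r > 0"
      and rr: "\<And>t. t \<noteq> 0 \<Longrightarrow> \<bar>t\<bar> < r \<Longrightarrow> n ((c (x + t) - c x) /\<^sub>R t - c' x) < d"
      unfolding eventually_at by (auto simp: dist_real_def)
    \<comment> \<open>Seen from the point \<open>x\<close> itself the estimate holds on either side; intervals containing \<open>x\<close> follow.\<close>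
    have one: "n (c y - c x - (y - x) *\<^sub>R l) \<le> (e + d) * \<bar>y - x\<bar>"
      if "0 \<le> y" "y \<le> 1" "\<bar>y - x\<bar> < r" for y
    proof (cases "y = x")
      case False
      let ?q = "(c y - c x) /\<^sub>R (y - x)"
      have q: "?q \<in> topspace Y" using c that local subspace_diff[OF sub] subspace_scale[OF sub] by auto
      have "n (?q - l) \<le> n (?q - c' x) + n (c' x - l)"
        by (rule norm_on_triangle[OF n q c'x l])
      also have "n (?q - c' x) \<le> d" using rr[of "y - x"] that False by simp
      also have "n (c' x - l) \<le> e" by (rule le[OF local])
      finally have "\<bar>y - x\<bar> * n (?q - l) \<le> \<bar>y - x\<bar> * (d + e)" by (intro mult_left_mono) auto
      also have "\<bar>y - x\<bar> * n (?q - l) = n ((y - x) *\<^sub>R (?q - l))"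
        using norm_on_scale[OF n, of "?q - l"] subspace_diff[OF sub q l] by simp
      also have "(y - x) *\<^sub>R (?q - l) = c y - c x - (y - x) *\<^sub>R l"
        using False by (simp add: scaleR_diff_right)
      finally show ?thesis by (simp add: algebra_simps)
    qed (use norm_on_zero[OF n] in auto)
    show "\<exists>d>0. \<forall>a b. a \<le> x \<and> x \<le> b \<and> b - a < d \<longrightarrow> P a b"
    proof (intro exI[of _ r] conjI allI impI)
      fix a b assume ab: "a \<le> x \<and> x \<le> b \<and> b - a < r"
      show "P a b" unfolding P_def
      proof safe
        assume ab': "0 \<le> a" "b \<le> 1" "a \<le> b"
        have "n (c b - c x - (b - x) *\<^sub>R l) \<le> (e + d) * (b - x)"
          "n (c a - c x - (a - x) *\<^sub>R l) \<le> (e + d) * (x - a)"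
          using one[of b] one[of a] ab ab' local by auto
        moreover have "c b - c a - (b - a) *\<^sub>R l = (c b - c x - (b - x) *\<^sub>R l) - (c a - c x - (a - x) *\<^sub>R l)"
          by (simp add: algebra_simps)
        ultimately show "n (c b - c a - (b - a) *\<^sub>R l) \<le> (e + d) * (b - a)"
          using norm_on_diff[OF n mem[of x b "b - x"] mem[of x a "a - x"]] ab ab' local
          by (simp add: algebra_simps)
      qed
    qed (rule r)
  qed simp
  then show "n (c 1 - c 0 - l) \<le> e + d" by (simp add: P_def)
qed

lemma segment_mean_value_inequality:
  assumes n: "norm_on Y n" and l: "l \<in> topspace Y"
    and f: "\<And>s. 0 \<le> s \<Longrightarrow> s \<le> 1 \<Longrightarrow> f (y + s *\<^sub>R w) \<in> topspace Y"
    and f': "\<And>s. 0 \<le> s \<Longrightarrow> s \<le> 1 \<Longrightarrow> has_dir_deriv Y f (y + s *\<^sub>R w) w (f' s)"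
    and le: "\<And>s. 0 \<le> s \<Longrightarrow> s \<le> 1 \<Longrightarrow> n (f' s - l) \<le> e"
  shows "n (f (y + w) - f y - l) \<le> e"
proof -
  have "has_dir_deriv Y (\<lambda>s. f (y + s *\<^sub>R w)) s 1 (f' s)" if "0 \<le> s" "s \<le> 1" for s
    using f'[OF that] unfolding has_dir_deriv_def by (simp add: algebra_simps)
  from mean_value_inequality[OF n l f this le] show ?thesis by simp
qed

text \<open>
  A difference quotient is an average of derivatives over a short segment, so it converges whenever
  base point, direction and the parameter \<open>p\<close> converge, as long as the derivative is jointly continuous.
  With a moving base point this yields additivity of the derivative, with a moving direction and
  parameter the chain rule.
\<close>

lemma difference_quotient_limit:
  fixes f :: "'p \<Rightarrow> 'a::real_vector \<Rightarrow> 'b::real_vector"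
  assumes X: "normable X" and Y: "normable Y" and V: "openin X V"
    and f: "\<And>p y. p \<in> topspace P \<Longrightarrow> y \<in> V \<Longrightarrow> f p y \<in> topspace Y"
    and f': "\<And>p y u. p \<in> topspace P \<Longrightarrow> y \<in> V \<Longrightarrow> u \<in> topspace X \<Longrightarrow> has_dir_deriv Y (f p) y u (f' p y u)"
    and cont: "continuous_map (prod_topology P (prod_topology (subtopology X V) X)) Y (\<lambda>(p, y, u). f' p y u)"
    and p: "limitin P p p0 F" and y: "limitin X y y0 F" "y0 \<in> V" and u: "limitin X u u0 F"
    and t: "(t \<longlongrightarrow> 0) F" and t0: "\<forall>\<^sub>F i in F. t i \<noteq> 0"
  shows "limitin Y (\<lambda>i. (f (p i) (y i + t i *\<^sub>R u i) - f (p i) (y i)) /\<^sub>R t i) (f' p0 y0 u0) F"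
proof -
  obtain m where m: "norm_on X m" using X unfolding normable_def by auto
  obtain n where n: "norm_on Y n" using Y unfolding normable_def by auto
  note subX = norm_on_imp_subspace[OF m] and subY = norm_on_imp_subspace[OF n]
  have p0: "p0 \<in> topspace P" and u0: "u0 \<in> topspace X" using p u by (auto dest: limitin_topspace)
  have VX: "V \<subseteq> topspace X" using V openin_subset by auto
  let ?l = "f' p0 y0 u0"
  have l: "?l \<in> topspace Y" using f'[OF p0 y(2) u0] has_dir_deriv_topspace by blast
  show ?thesis unfolding norm_on_limitin_iff[OF n]
  proof (intro conjI allI impI l)
    fix e :: real assume e: "e > 0"
    define O' where "O' = {z \<in> topspace Y. n (z - ?l) < e / 2}"
    have "openin Y O'" unfolding O'_def by (rule norm_on_openin_ball[OF n l])
    from openin_continuous_map_preimage[OF cont this]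
    have N: "openin (prod_topology P (prod_topology (subtopology X V) X))
        {z \<in> topspace (prod_topology P (prod_topology (subtopology X V) X)). (case z of (p, y, u) \<Rightarrow> f' p y u) \<in> O'}"
      (is "openin _ ?N") .
    have "?l \<in> O'" unfolding O'_def using l e norm_on_zero[OF n] by auto
    then have "(p0, y0, u0) \<in> ?N" using p0 y(2) u0 VX by auto
    then obtain Op Oq where Op: "openin P Op" "p0 \<in> Op" and Oq: "openin (prod_topology (subtopology X V) X) Oq"
      "(y0, u0) \<in> Oq" "Op \<times> Oq \<subseteq> ?N"
      using N unfolding openin_prod_topology_alt by meson
    then obtain Oy Ou where Oy: "openin (subtopology X V) Oy" "y0 \<in> Oy" and Ou: "openin X Ou" "u0 \<in> Ou"
      and sub: "Oy \<times> Ou \<subseteq> Oq"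
      unfolding openin_prod_topology_alt by meson
    have OyX: "openin X Oy" and OyV: "Oy \<subseteq> V" using Oy(1) V openin_trans_full openin_imp_subset by blast+
    then obtain r where r: "r > 0" and rr: "\<And>z. z \<in> topspace X \<Longrightarrow> m (z - y0) < r \<Longrightarrow> z \<in> Oy"
      using Oy(2) unfolding norm_on_openin_iff[OF m] by meson
    have y0: "y0 \<in> topspace X" using VX y by auto
    have "limitin X (\<lambda>i. t i *\<^sub>R u i) 0 F" using limitin_scaleR[OF X t u] by simp
    then have e1: "\<forall>\<^sub>F i in F. t i *\<^sub>R u i \<in> topspace X \<and> m (t i *\<^sub>R u i - 0) < r / 2"
      using r half_gt_zero unfolding norm_on_limitin_iff[OF m] by blast
    have e2: "\<forall>\<^sub>F i in F. y i \<in> topspace X \<and> m (y i - y0) < r / 2"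
      using r half_gt_zero y unfolding norm_on_limitin_iff[OF m] by blast
    from e1 e2 limitinD[OF p Op] limitinD[OF u Ou] t0
    show "\<forall>\<^sub>F i in F. (f (p i) (y i + t i *\<^sub>R u i) - f (p i) (y i)) /\<^sub>R t i \<in> topspace Y \<and>
            n ((f (p i) (y i + t i *\<^sub>R u i) - f (p i) (y i)) /\<^sub>R t i - ?l) < e"
    proof eventually_elim
      case (elim i)
      have pi: "p i \<in> topspace P" and ui: "u i \<in> topspace X" and yi: "y i \<in> topspace X"
        using elim openin_subset[OF Op(1)] openin_subset[OF Ou(1)] by auto
      have seg: "y i + s *\<^sub>R (t i *\<^sub>R u i) \<in> Oy" if s: "0 \<le> s" "s \<le> 1" for s
      proof (rule rr)
        show "y i + s *\<^sub>R (t i *\<^sub>R u i) \<in> topspace X"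
          using yi ui subspace_add[OF subX] subspace_scale[OF subX] by auto
        have "m ((y i - y0) + s *\<^sub>R (t i *\<^sub>R u i)) \<le> m (y i - y0) + \<bar>s\<bar> * m (t i *\<^sub>R u i)"
          using norm_on_add[OF m subspace_diff[OF subX yi y0] subspace_scale[OF subX], of "t i *\<^sub>R u i" s]
            norm_on_scale[OF m, of "t i *\<^sub>R u i" s] elim by simp
        also have "\<bar>s\<bar> * m (t i *\<^sub>R u i) \<le> 1 * m (t i *\<^sub>R u i)"
          using s elim norm_on_nonneg[OF m] by (intro mult_right_mono) auto
        also have "m (y i - y0) + 1 * m (t i *\<^sub>R u i) < r" using elim by auto
        finally show "m (y i + s *\<^sub>R t i *\<^sub>R u i - y0) < r" by (simp add: algebra_simps)
      qed
      \<comment> \<open>Dividing by \<open>t i\<close> turns the derivative along the segment into \<open>f' (p i) z (u i)\<close>.\<close>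
      let ?g = "\<lambda>z. f (p i) z /\<^sub>R t i"
      have "n (?g (y i + t i *\<^sub>R u i) - ?g (y i) - ?l) \<le> e / 2"
      proof (rule segment_mean_value_inequality[OF n l])
        fix s :: real assume s: "0 \<le> s" "s \<le> 1"
        let ?z = "y i + s *\<^sub>R (t i *\<^sub>R u i)"
        have z: "?z \<in> V" using seg[OF s] OyV by auto
        show "?g ?z \<in> topspace Y" using f[OF pi z] subspace_scale[OF subY] by auto
        show "has_dir_deriv Y ?g ?z (t i *\<^sub>R u i) (f' (p i) ?z (u i))"
          using has_dir_deriv_scaleR[OF Y has_dir_deriv_scaleR_direction[OF Y f'[OF pi z ui], of "t i"], of "inverse (t i)"]
            elim by simp
        have "(p i, ?z, u i) \<in> ?N" using Oq(3) sub seg[OF s] elim by blast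
        then show "n (f' (p i) ?z (u i) - ?l) \<le> e / 2" by (auto simp: O'_def)
      qed
      moreover have "y i \<in> V" "y i + t i *\<^sub>R u i \<in> V" using seg[of 0] seg[of 1] OyV by auto
      ultimately show ?case using f[OF pi] subspace_diff[OF subY] subspace_scale[OF subY] e
        by (auto simp: scaleR_diff_right)
    qed
  qed
qed

section \<open>Iterated derivatives of smooth maps\<close>

text \<open>
  Move along \<open>a\<close> first and then along \<open>b\<close>: the second quotient has moving base point \<open>x + t a\<close>, and by
  joint continuity its limit is the derivative at \<open>x\<close> itself.
\<close>

lemma continuous_dir_deriv_linear:
  assumes X: "normable X" and Y: "normable Y" and V: "openin X V"
    and f: "\<And>y. y \<in> V \<Longrightarrow> f y \<in> topspace Y"
    and f': "\<And>y u. y \<in> V \<Longrightarrow> u \<in> topspace X \<Longrightarrow> has_dir_deriv Y f y u (f' y u)"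
    and cont: "continuous_map (prod_topology (subtopology X V) X) Y (\<lambda>(y, u). f' y u)"
    and x: "x \<in> V"
  shows "linear_map_on (topspace X) (f' x)"
  unfolding linear_map_on_def
proof safe
  fix a assume a: "a \<in> topspace X"
  fix r show "f' x (r *\<^sub>R a) = r *\<^sub>R f' x a"
    using has_dir_deriv_scaleR_direction[OF Y f'[OF x a], of r]
      has_dir_deriv_unique[OF Y f'[OF x, of "r *\<^sub>R a"]] subspace_scale[OF normable_subspace[OF X] a]
    by auto
next
  fix a b assume a: "a \<in> topspace X" and b: "b \<in> topspace X"
  note sub = normable_subspace[OF X]
  have xX: "x \<in> topspace X" using x openin_subset[OF V] by auto
  have "continuous_map (prod_topology (euclideanreal) (prod_topology (subtopology X V) X)) Y
      ((\<lambda>(y, u). f' y u) \<circ> snd)"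
    by (rule continuous_map_compose[OF continuous_map_snd cont])
  then have cont': "continuous_map (prod_topology (euclideanreal) (prod_topology (subtopology X V) X)) Y
      (\<lambda>(p, y, u). f' y u)"
    by (simp add: o_def case_prod_unfold)
  have "limitin Y (\<lambda>t. (f ((x + t *\<^sub>R a) + t *\<^sub>R b) - f (x + t *\<^sub>R a)) /\<^sub>R t) (f' x b) (at 0)"
    by (rule difference_quotient_limit[OF X Y V, where f = "\<lambda>_. f" and P = "euclideanreal"
          and p = "\<lambda>_. 0" and f' = "\<lambda>_. f'", OF f f' cont' _ limitin_line[OF X xX a]])
      (use x b in \<open>auto simp: tendsto_ident_at eventually_at_filter\<close>)
  then have "limitin Y (\<lambda>t. (f ((x + t *\<^sub>R a) + t *\<^sub>R b) - f (x + t *\<^sub>R a)) /\<^sub>R t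
      + (f (x + t *\<^sub>R a) - f x) /\<^sub>R t) (f' x b + f' x a) (at 0)"
    by (rule limitin_add[OF Y _ f'[OF x a, unfolded has_dir_deriv_def]])
  then have "has_dir_deriv Y f x (a + b) (f' x b + f' x a)"
    unfolding has_dir_deriv_def by (simp add: algebra_simps)
  from has_dir_deriv_unique[OF Y this f'[OF x]] show "f' x (a + b) = f' x a + f' x b"
    using a b subspace_add[OF sub] by (simp add: add.commute)
qed

lemma iter_deriv_cong_directions:
  "(\<And>i. i < k \<Longrightarrow> v i = w i) \<Longrightarrow> iter_deriv Y f k v = iter_deriv Y f k w"
proof (induction k)
  case (Suc k)
  then have "iter_deriv Y f k v = iter_deriv Y f k w" "v k = w k" by auto
  then show ?case by simp
qed simp

lemma smooth_map_on_openin: "smooth_map_on X U Y f \<Longrightarrow> openin X U"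
  unfolding smooth_map_on_def by auto

lemma smooth_has_dir_deriv:
  assumes Y: "normable Y" and f: "smooth_map_on X U Y f" and x: "x \<in> U"
    and v: "\<And>i. i \<le> k \<Longrightarrow> v i \<in> topspace X"
  shows "has_dir_deriv Y (iter_deriv Y f k v) x (v k) (iter_deriv Y f (Suc k) v x)"
proof -
  have "v \<in> {..k} \<rightarrow> topspace X" using v by auto
  then obtain l where "has_dir_deriv Y (iter_deriv Y f k v) x (v k) l"
    using f x unfolding smooth_map_on_def by blast
  from has_dir_deriv_dir_deriv[OF Y this] show ?thesis by simp
qed

text \<open>
  The form in which joint continuity is used: base point and directions may depend continuously on an
  arbitrary parameter space.
\<close>

lemma smooth_iter_deriv_continuous:
  assumes f: "smooth_map_on X U Y f" and y: "continuous_map Z (subtopology X U) y"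
    and w: "\<And>i. i < k \<Longrightarrow> continuous_map Z X (w i)"
  shows "continuous_map Z Y (\<lambda>z. iter_deriv Y f k (\<lambda>i. w i z) (y z))"
proof -
  have "continuous_map Z (prod_topology (subtopology X U) (product_topology (\<lambda>_. X) {..<k}))
      (\<lambda>z. (y z, \<lambda>i\<in>{..<k}. w i z))"
    using y w by (auto intro!: continuous_map_pairedI simp: continuous_map_componentwise)
  moreover have "continuous_map (prod_topology (subtopology X U) (product_topology (\<lambda>_. X) {..<k})) Y
      (\<lambda>(x, v). iter_deriv Y f k v x)"
    using f unfolding smooth_map_on_def by auto
  ultimately have "continuous_map Z Y
      ((\<lambda>(x, v). iter_deriv Y f k v x) \<circ> (\<lambda>z. (y z, \<lambda>i\<in>{..<k}. w i z)))"
    by (rule continuous_map_compose)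
  moreover have "iter_deriv Y f k (\<lambda>i\<in>{..<k}. w i z) = iter_deriv Y f k (\<lambda>i. w i z)" for z
    by (rule iter_deriv_cong_directions) auto
  ultimately show ?thesis by (simp add: o_def)
qed

lemma smooth_iter_deriv_limit:
  assumes f: "smooth_map_on X U Y f" and y: "limitin X y y0 F" "y0 \<in> U"
    and w: "\<And>i. i < k \<Longrightarrow> limitin X (w i) (w0 i) F"
  shows "limitin Y (\<lambda>t. iter_deriv Y f k (\<lambda>i. w i t) (y t)) (iter_deriv Y f k w0 y0) F"
proof -
  have "limitin (subtopology X U) y y0 F"
    unfolding limitin_subtopology using y limitinD[OF y(1) smooth_map_on_openin[OF f] y(2)] by auto
  moreover have "limitin (product_topology (\<lambda>_. X) {..<k}) (\<lambda>t. \<lambda>i\<in>{..<k}. w i t) (\<lambda>i\<in>{..<k}. w0 i) F"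
    unfolding limitin_componentwise
  proof (intro conjI ballI)
    have "\<forall>\<^sub>F t in F. \<forall>i\<in>{..<k}. w i t \<in> topspace X"
      by (intro eventually_ball_finite ballI limitin_eventually_topspace[OF w]) auto
    then show "\<forall>\<^sub>F t in F. (\<lambda>i\<in>{..<k}. w i t) \<in> topspace (product_topology (\<lambda>_. X) {..<k})"
      by eventually_elim auto
  qed (use w in auto)
  ultimately have "limitin (prod_topology (subtopology X U) (product_topology (\<lambda>_. X) {..<k}))
      (\<lambda>t. (y t, \<lambda>i\<in>{..<k}. w i t)) (y0, \<lambda>i\<in>{..<k}. w0 i) F"
    by (simp add: limitin_pairwise o_def)
  moreover have "continuous_map (prod_topology (subtopology X U) (product_topology (\<lambda>_. X) {..<k})) Y
      (\<lambda>(x, v). iter_deriv Y f k v x)"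
    using f unfolding smooth_map_on_def by auto
  ultimately have "limitin Y ((\<lambda>(x, v). iter_deriv Y f k v x) \<circ> (\<lambda>t. (y t, \<lambda>i\<in>{..<k}. w i t)))
      ((\<lambda>(x, v). iter_deriv Y f k v x) (y0, \<lambda>i\<in>{..<k}. w0 i)) F"
    by (intro continuous_map_limit)
  moreover have "iter_deriv Y f k (\<lambda>i\<in>{..<k}. w i t) = iter_deriv Y f k (\<lambda>i. w i t)" for t
    by (rule iter_deriv_cong_directions) auto
  moreover have "iter_deriv Y f k (\<lambda>i\<in>{..<k}. w0 i) = iter_deriv Y f k w0"
    by (rule iter_deriv_cong_directions) auto
  ultimately show ?thesis by (simp add: o_def)
qed

lemma smooth_iter_deriv_topspace:
  assumes f: "smooth_map_on X U Y f" and x: "x \<in> U" and v: "\<And>i. i < k \<Longrightarrow> v i \<in> topspace X"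
  shows "iter_deriv Y f k v x \<in> topspace Y"
proof -
  have "x \<in> topspace X" using x openin_subset[OF smooth_map_on_openin[OF f]] by auto
  then show ?thesis
    using smooth_iter_deriv_limit[OF f, of "\<lambda>_. x" x "at (0::real)" k "\<lambda>i _. v i" v] x v by simp
qed

lemma smooth_map_on_topspace: "smooth_map_on X U Y f \<Longrightarrow> x \<in> U \<Longrightarrow> f x \<in> topspace Y"
  using smooth_iter_deriv_topspace[of X U Y f x 0] by simp

lemma smooth_map_on_continuous_map: "smooth_map_on X U Y f \<Longrightarrow> continuous_map (subtopology X U) Y f"
  using smooth_iter_deriv_continuous[of X U Y f "subtopology X U" "\<lambda>x. x" 0] by simp

lemma smooth_has_dir_deriv1:
  assumes "normable Y" "smooth_map_on X U Y f" "x \<in> U" "v \<in> topspace X"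
  shows "has_dir_deriv Y f x v (dir_deriv Y f x v)"
  using smooth_has_dir_deriv[of Y X U f x 0 "\<lambda>_. v"] assms by simp

text \<open>
  Linearity in the last direction is linearity of a derivative; in an earlier direction it is inherited
  from the derivative of lower order, since limits of difference quotients preserve it.
\<close>

lemma smooth_iter_deriv_linear:
  assumes X: "normable X" and Y: "normable Y" and f: "smooth_map_on X U Y f"
    and x: "x \<in> U" and i: "i < k" and w: "\<And>j. j < k \<Longrightarrow> w j \<in> topspace X"
  shows "linear_map_on (topspace X) (\<lambda>a. iter_deriv Y f k (w(i := a)) x)"
  using x i w
proof (induction k arbitrary: x)
  case (Suc k)
  show ?case
  proof (cases "i = k")
    case True
    have cong: "iter_deriv Y f k (w(k := u)) = iter_deriv Y f k w" for u
      by (rule iter_deriv_cong_directions) auto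
    show ?thesis unfolding True
    proof (rule continuous_dir_deriv_linear[OF X Y smooth_map_on_openin[OF f]])
      show "iter_deriv Y f k w y \<in> topspace Y" if "y \<in> U" for y
        using smooth_iter_deriv_topspace[OF f that] Suc by auto
      show "has_dir_deriv Y (iter_deriv Y f k w) y u (iter_deriv Y f (Suc k) (w(k := u)) y)"
        if "y \<in> U" "u \<in> topspace X" for y u
        using smooth_has_dir_deriv[OF Y f that(1), of k "w(k := u)"] that Suc cong by auto
      have "continuous_map (prod_topology (subtopology X U) X) Y
          (\<lambda>z. iter_deriv Y f (Suc k) (\<lambda>i. if i = k then snd z else w i) (fst z))"
        by (rule smooth_iter_deriv_continuous[OF f continuous_map_fst])
          (use Suc in \<open>auto intro: continuous_map_snd\<close>)
      moreover have "(\<lambda>z. iter_deriv Y f (Suc k) (\<lambda>i. if i = k then snd z else w i) (fst z))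
        = (\<lambda>(y, u). iter_deriv Y f (Suc k) (w(k := u)) y)"
        by (simp add: case_prod_unfold fun_upd_def)
      ultimately show "continuous_map (prod_topology (subtopology X U) X) Y
          (\<lambda>(y, u). iter_deriv Y f (Suc k) (w(k := u)) y)" by metis
    qed (use Suc in auto)
  next
    case False
    then have ik: "i < k" using Suc by auto
    have IH: "linear_map_on (topspace X) (\<lambda>a. iter_deriv Y f k (w(i := a)) y)" if "y \<in> U" for y
      by (rule Suc.IH[OF that ik]) (use Suc.prems in auto)
    have D: "has_dir_deriv Y (iter_deriv Y f k (w(i := a))) x (w k) (iter_deriv Y f (Suc k) (w(i := a)) x)"
      if "a \<in> topspace X" for a
      using smooth_has_dir_deriv[OF Y f Suc.prems(1), of k "w(i := a)"] that Suc.prems False by auto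
    note cong = has_dir_deriv_cong[OF X smooth_map_on_openin[OF f] Suc.prems(1) Suc.prems(3)[of k]]
    show ?thesis unfolding linear_map_on_def
    proof safe
      fix a b assume a: "a \<in> topspace X" and b: "b \<in> topspace X"
      then have ab: "a + b \<in> topspace X" using subspace_add[OF normable_subspace[OF X]] by auto
      have "has_dir_deriv Y (\<lambda>y. iter_deriv Y f k (w(i := a)) y + iter_deriv Y f k (w(i := b)) y) x (w k)
         (iter_deriv Y f (Suc k) (w(i := a + b)) x)"
        by (rule cong[OF _ _ D[OF ab]]) (use linear_map_on_add[OF IH a b] in auto)
      from has_dir_deriv_unique[OF Y this has_dir_deriv_add[OF Y D[OF a] D[OF b]]]
      show "iter_deriv Y f (Suc k) (w(i := a + b)) x =
        iter_deriv Y f (Suc k) (w(i := a)) x + iter_deriv Y f (Suc k) (w(i := b)) x" .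
    next
      fix a and r :: real assume a: "a \<in> topspace X"
      then have ra: "r *\<^sub>R a \<in> topspace X" using subspace_scale[OF normable_subspace[OF X]] by auto
      have "has_dir_deriv Y (\<lambda>y. r *\<^sub>R iter_deriv Y f k (w(i := a)) y) x (w k)
         (iter_deriv Y f (Suc k) (w(i := r *\<^sub>R a)) x)"
        by (rule cong[OF _ _ D[OF ra]]) (use linear_map_on_scale[OF IH a] in auto)
      from has_dir_deriv_unique[OF Y this has_dir_deriv_scaleR[OF Y D[OF a]]]
      show "iter_deriv Y f (Suc k) (w(i := r *\<^sub>R a)) x = r *\<^sub>R iter_deriv Y f (Suc k) (w(i := a)) x" .
    qed
  qed
qed simp

lemma smooth_dir_deriv_linear:
  assumes "normable X" "normable Y" "smooth_map_on X U Y f" "x \<in> U"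
  shows "linear_map_on (topspace X) (dir_deriv Y f x)"
  using smooth_iter_deriv_linear[OF assms, of 0 1 "\<lambda>_. 0"] subspace_0[OF normable_subspace[OF assms(1)]]
  by simp

lemma smooth_dir_deriv_continuous:
  assumes "smooth_map_on X U Y f" "x \<in> U"
  shows "continuous_map X Y (dir_deriv Y f x)"
  using smooth_iter_deriv_continuous[OF assms(1), of X "\<lambda>_. x" 1 "\<lambda>_ z. z"] assms
    openin_subset[OF smooth_map_on_openin[OF assms(1)]] by auto

lemma has_dir_deriv_limit:
  assumes X: "normable X" and y: "has_dir_deriv X y z v y'" and yz: "y z \<in> topspace X"
  shows "limitin X (\<lambda>t. y (z + t *\<^sub>R v)) (y z) (at 0)"
proof -
  have "limitin X (\<lambda>t. y z + t *\<^sub>R ((y (z + t *\<^sub>R v) - y z) /\<^sub>R t)) (y z + 0 *\<^sub>R y') (at 0)"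
    using y yz unfolding has_dir_deriv_def
    by (intro limitin_add[OF X] limitin_scaleR[OF X]) (auto simp: tendsto_ident_at)
  moreover have "\<forall>\<^sub>F t in at 0. y z + t *\<^sub>R ((y (z + t *\<^sub>R v) - y z) /\<^sub>R t) = y (z + t *\<^sub>R v)"
    by (auto simp: eventually_at_filter)
  ultimately show ?thesis using limitin_transform_eventually by fastforce
qed

text \<open>
  The chain and Leibniz rule for an iterated derivative of \<open>f\<close> with moving base point \<open>y z\<close> and moving
  directions \<open>w i z\<close>: moving the base point adds \<open>y'\<close> as a further, last direction, and moving the
  \<open>i\<close>-th direction replaces it by its derivative, because the iterated derivative is linear in it.
\<close>

lemma has_dir_deriv_iter_deriv:
  fixes y :: "'c::real_vector \<Rightarrow> 'a::real_vector"
  assumes X: "normable X" and Y: "normable Y" and f: "smooth_map_on X U Y f"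
    and y: "has_dir_deriv X y z v y'" and yz: "y z \<in> U"
    and w: "\<And>i. i < k \<Longrightarrow> has_dir_deriv X (w i) z v (w' i)"
    and wz: "\<And>i. i < k \<Longrightarrow> w i z \<in> topspace X"
  shows "has_dir_deriv Y (\<lambda>z. iter_deriv Y f k (\<lambda>i. w i z) (y z)) z v
    (iter_deriv Y f (Suc k) ((\<lambda>i. w i z)(k := y')) (y z) +
     (\<Sum>i<k. iter_deriv Y f k ((\<lambda>j. w j z)(i := w' i)) (y z)))"
proof -
  note U = smooth_map_on_openin[OF f]
  note sub = normable_subspace[OF X]
  have yX: "y z \<in> topspace X" using yz openin_subset[OF U] by auto
  define W where "W t i = w i (z + t *\<^sub>R v)" for t i
  define W0 where "W0 i = w i z" for i
  have W: "limitin X (\<lambda>t. W t i) (W0 i) (at 0)" if "i < k" for i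
    unfolding W_def W0_def using has_dir_deriv_limit[OF X w wz] that by auto
  have W0: "W0 i \<in> topspace X" if "i < k" for i using wz[OF that] by (simp add: W0_def)
  have W': "limitin X (\<lambda>t. (W t i - W0 i) /\<^sub>R t) (w' i) (at 0)" if "i < k" for i
    using w[OF that] unfolding has_dir_deriv_def W_def W0_def .
  have evW: "\<forall>\<^sub>F t in at 0. \<forall>i\<in>{..<k}. W t i \<in> topspace X"
    by (intro eventually_ball_finite ballI limitin_eventually_topspace[OF W]) auto

  \<comment> \<open>First let the base point move while the directions are frozen at their values at time \<open>t\<close>;
    they act as a parameter that converges.\<close>
  let ?P = "product_topology (\<lambda>_. X) {..<k}"
  have cong: "iter_deriv Y f k (p(k := u)) = iter_deriv Y f k p" for p u
    by (rule iter_deriv_cong_directions) auto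
  have A1: "limitin Y (\<lambda>t. (iter_deriv Y f k (\<lambda>i\<in>{..<k}. W t i) (y z + t *\<^sub>R ((y (z + t *\<^sub>R v) - y z) /\<^sub>R t))
      - iter_deriv Y f k (\<lambda>i\<in>{..<k}. W t i) (y z)) /\<^sub>R t)
      (iter_deriv Y f (Suc k) ((\<lambda>i\<in>{..<k}. W0 i)(k := y')) (y z)) (at 0)"
  proof (rule difference_quotient_limit[OF X Y U, where f = "iter_deriv Y f k" and P = ?P
        and f' = "\<lambda>p y u. iter_deriv Y f (Suc k) (p(k := u)) y"])
    show "iter_deriv Y f k p x \<in> topspace Y" if "p \<in> topspace ?P" "x \<in> U" for p x
      using smooth_iter_deriv_topspace[OF f that(2), of k p] that(1) by auto
    show "has_dir_deriv Y (iter_deriv Y f k p) x u (iter_deriv Y f (Suc k) (p(k := u)) x)"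
      if "p \<in> topspace ?P" "x \<in> U" "u \<in> topspace X" for p x u
    proof -
      have "(p(k := u)) i \<in> topspace X" if "i \<le> k" for i
        using that \<open>p \<in> topspace ?P\<close> \<open>u \<in> topspace X\<close> by (auto simp: PiE_iff)
      from smooth_has_dir_deriv[OF Y f \<open>x \<in> U\<close>, of k "p(k := u)", OF this] show ?thesis by (simp only: cong fun_upd_same)
    qed
    have "continuous_map (prod_topology ?P (prod_topology (subtopology X U) X)) Y
        (\<lambda>q. iter_deriv Y f (Suc k) (\<lambda>i. if i = k then snd (snd q) else fst q i) (fst (snd q)))"
    proof (rule smooth_iter_deriv_continuous[OF f])
      show "continuous_map (prod_topology ?P (prod_topology (subtopology X U) X)) (subtopology X U) (\<lambda>q. fst (snd q))"
        using continuous_map_compose[OF continuous_map_snd continuous_map_fst] by (simp add: o_def)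
      fix i assume "i < Suc k"
      then show "continuous_map (prod_topology ?P (prod_topology (subtopology X U) X)) X
          (\<lambda>q. if i = k then snd (snd q) else fst q i)"
        using continuous_map_compose[OF continuous_map_snd continuous_map_snd]
          continuous_map_compose[OF continuous_map_fst continuous_map_product_projection[of i "{..<k}" "\<lambda>_. X"]]
        by (auto simp: o_def)
    qed
    moreover have "(\<lambda>q. iter_deriv Y f (Suc k) (\<lambda>i. if i = k then snd (snd q) else fst q i) (fst (snd q)))
      = (\<lambda>(p, y, u). iter_deriv Y f (Suc k) (p(k := u)) y)"
      by (simp add: case_prod_unfold fun_upd_def)
    ultimately show "continuous_map (prod_topology ?P (prod_topology (subtopology X U) X)) Y
        (\<lambda>(p, y, u). iter_deriv Y f (Suc k) (p(k := u)) y)" by metis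
    show "limitin ?P (\<lambda>t. \<lambda>i\<in>{..<k}. W t i) (\<lambda>i\<in>{..<k}. W0 i) (at 0)"
      unfolding limitin_componentwise
      by (intro conjI ballI eventually_mono[OF evW]) (use W in \<open>auto\<close>)
    show "limitin X (\<lambda>t. (y (z + t *\<^sub>R v) - y z) /\<^sub>R t) y' (at 0)"
      using y unfolding has_dir_deriv_def .
  qed (use yX yz in \<open>auto simp: tendsto_ident_at eventually_at_filter\<close>)
  have cong1: "iter_deriv Y f k (\<lambda>i\<in>{..<k}. W t i) = iter_deriv Y f k (W t)" for t
    by (rule iter_deriv_cong_directions) auto
  have cong2: "iter_deriv Y f (Suc k) ((\<lambda>i\<in>{..<k}. W0 i)(k := y')) = iter_deriv Y f (Suc k) (W0(k := y'))"
    by (rule iter_deriv_cong_directions) auto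
  have A: "limitin Y (\<lambda>t. (iter_deriv Y f k (W t) (y (z + t *\<^sub>R v)) - iter_deriv Y f k (W t) (y z)) /\<^sub>R t)
      (iter_deriv Y f (Suc k) (W0(k := y')) (y z)) (at 0)"
    using A1 unfolding cong1 cong2
    by (rule limitin_transform_eventually[rotated]) (auto simp: eventually_at_filter)

  \<comment> \<open>Then exchange the directions one after the other: \<open>M t i\<close> has the first \<open>i\<close> of them already
    moved to time \<open>t\<close>.\<close>
  define M where "M t i j = (if j < i then W t j else W0 j)" for t and i j :: nat
  have B1: "limitin Y (\<lambda>t. (iter_deriv Y f k (M t (Suc i)) (y z) - iter_deriv Y f k (M t i) (y z)) /\<^sub>R t)
      (iter_deriv Y f k (W0(i := w' i)) (y z)) (at 0)" if i: "i < k" for i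
  proof -
    have "limitin Y (\<lambda>t. iter_deriv Y f k (\<lambda>j. ((M t i)(i := (W t i - W0 i) /\<^sub>R t)) j) (y z))
        (iter_deriv Y f k (W0(i := w' i)) (y z)) (at 0)"
    proof (rule smooth_iter_deriv_limit[OF f _ yz])
      fix j assume j: "j < k"
      have "limitin X (\<lambda>t. M t i j) (W0 j) (at 0)"
        using W[OF j] W0[OF j] by (cases "j < i") (auto simp: M_def)
      then show "limitin X (\<lambda>t. ((M t i)(i := (W t i - W0 i) /\<^sub>R t)) j) ((W0(i := w' i)) j) (at 0)"
        using W'[OF i] by (cases "j = i") auto
    qed (use yX in auto)
    moreover have "\<forall>\<^sub>F t in at 0. iter_deriv Y f k (\<lambda>j. ((M t i)(i := (W t i - W0 i) /\<^sub>R t)) j) (y z)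
       = (iter_deriv Y f k (M t (Suc i)) (y z) - iter_deriv Y f k (M t i) (y z)) /\<^sub>R t"
      using evW
    proof eventually_elim
      case (elim t)
      have M: "M t i j \<in> topspace X" if "j < k" for j using elim that W0 by (auto simp: M_def)
      note lin = smooth_iter_deriv_linear[OF X Y f yz i, of "M t i", OF M]
      have "M t (Suc i) = (M t i)(i := W t i)" "M t i = (M t i)(i := W0 i)"
        by (auto simp: M_def fun_eq_iff)
      moreover have "W t i \<in> topspace X" "W0 i \<in> topspace X" "W t i - W0 i \<in> topspace X"
        using elim W0 i subspace_diff[OF sub] by auto
      ultimately show ?case
        using linear_map_on_scale[OF lin, of "W t i - W0 i" "inverse t"]
          linear_map_on_diff[OF lin sub, of "W t i" "W0 i"] by (simp del: fun_upd_apply)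
    qed
    ultimately show ?thesis using limitin_transform_eventually by fastforce
  qed
  have "limitin Y (\<lambda>t. \<Sum>i<k. (iter_deriv Y f k (M t (Suc i)) (y z) - iter_deriv Y f k (M t i) (y z)) /\<^sub>R t)
      (\<Sum>i<k. iter_deriv Y f k (W0(i := w' i)) (y z)) (at 0)"
    by (rule limitin_sum[OF Y]) (use B1 in auto)
  moreover have "(\<Sum>i<k. (iter_deriv Y f k (M t (Suc i)) (y z) - iter_deriv Y f k (M t i) (y z)) /\<^sub>R t)
      = (iter_deriv Y f k (W t) (y z) - iter_deriv Y f k W0 (y z)) /\<^sub>R t" for t
  proof -
    have "(\<Sum>i<k. (iter_deriv Y f k (M t (Suc i)) (y z) - iter_deriv Y f k (M t i) (y z)) /\<^sub>R t)
      = (iter_deriv Y f k (M t k) (y z) - iter_deriv Y f k (M t 0) (y z)) /\<^sub>R t"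
      unfolding scaleR_sum_right[symmetric]
      using sum_lessThan_telescope[of "\<lambda>i. iter_deriv Y f k (M t i) (y z)" k] by simp
    moreover have "iter_deriv Y f k (M t k) = iter_deriv Y f k (W t)"
      by (rule iter_deriv_cong_directions) (simp add: M_def)
    moreover have "M t 0 = W0" by (simp add: M_def fun_eq_iff)
    ultimately show ?thesis by simp
  qed
  ultimately have B: "limitin Y (\<lambda>t. (iter_deriv Y f k (W t) (y z) - iter_deriv Y f k W0 (y z)) /\<^sub>R t)
      (\<Sum>i<k. iter_deriv Y f k (W0(i := w' i)) (y z)) (at 0)" by simp
  have "limitin Y (\<lambda>t. (iter_deriv Y f k (W t) (y (z + t *\<^sub>R v)) - iter_deriv Y f k W0 (y z)) /\<^sub>R t)
     (iter_deriv Y f (Suc k) (W0(k := y')) (y z) + (\<Sum>i<k. iter_deriv Y f k (W0(i := w' i)) (y z))) (at 0)"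
    using limitin_add[OF Y A B] by (simp add: algebra_simps)
  moreover have "W0 = (\<lambda>i. w i z)" "W t = (\<lambda>i. w i (z + t *\<^sub>R v))" for t
    by (auto simp: W0_def W_def fun_eq_iff)
  ultimately show ?thesis unfolding has_dir_deriv_def by simp
qed

section \<open>Families of functions closed under differentiation\<close>

text \<open>
  Candidates \<open>D k\<close> for the iterated derivatives suffice, even when they are described through infinite
  sequences of directions.
\<close>

lemma smooth_map_onI_jets:
  fixes f :: "'a::real_vector \<Rightarrow> 'b::real_vector" and D :: "nat \<Rightarrow> (nat \<Rightarrow> 'a) \<Rightarrow> 'a \<Rightarrow> 'b"
  assumes X: "normable X" and Y: "normable Y" and U: "openin X U"
    and D0: "\<And>v x. (\<And>i. v i \<in> topspace X) \<Longrightarrow> x \<in> U \<Longrightarrow> D 0 v x = f x"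
    and D: "\<And>k v x. (\<And>i. v i \<in> topspace X) \<Longrightarrow> x \<in> U \<Longrightarrow> has_dir_deriv Y (D k v) x (v k) (D (Suc k) v x)"
    and cont: "\<And>k. continuous_map (prod_topology (subtopology X U) (product_topology (\<lambda>_. X) UNIV)) Y
        (\<lambda>(x, v). D k v x)"
  shows "smooth_map_on X U Y f"
proof -
  have zero: "0 \<in> topspace X" using subspace_0[OF normable_subspace[OF X]] .
  have eq: "iter_deriv Y f k v x = D k v x" if "\<And>i. v i \<in> topspace X" "x \<in> U" for k :: nat and v x
    using that(2)
  proof (induction k arbitrary: x)
    case (Suc k)
    have "has_dir_deriv Y (iter_deriv Y f k v) x (v k) (D (Suc k) v x)"
      by (rule has_dir_deriv_cong[OF X U Suc.prems that(1) _ D[OF that(1) Suc.prems]]) (simp add: Suc.IH)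
    from dir_deriv_eq[OF Y this] show ?case by simp
  qed (use D0[of v] that in auto)
  show ?thesis unfolding smooth_map_on_def
  proof (intro conjI allI ballI U)
    fix k :: nat and x v assume x: "x \<in> U" and v: "v \<in> {..k} \<rightarrow> topspace X"
    \<comment> \<open>The sequence is completed by \<open>0\<close> beyond the index \<open>k\<close>, so that all its members lie in \<open>X\<close>.\<close>
    define w where "w i = (if i \<le> k then v i else 0)" for i
    have w: "w i \<in> topspace X" for i using v zero by (auto simp: w_def)
    have "iter_deriv Y f k v = iter_deriv Y f k w" by (rule iter_deriv_cong_directions) (auto simp: w_def)
    moreover have "has_dir_deriv Y (iter_deriv Y f k w) x (w k) (D (Suc k) w x)"
      by (rule has_dir_deriv_cong[OF X U x w _ D[OF w x]]) (simp add: eq[OF w])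
    moreover have "w k = v k" by (simp add: w_def)
    ultimately show "\<exists>l. has_dir_deriv Y (iter_deriv Y f k v) x (v k) l" by metis
  next
    fix k :: nat
    let ?Z = "prod_topology (subtopology X U) (product_topology (\<lambda>_. X) {..<k})"
    let ?e = "\<lambda>v i. if i < k then v i else 0"
    have "continuous_map ?Z (prod_topology (subtopology X U) (product_topology (\<lambda>_. X) UNIV))
        (\<lambda>z. (fst z, ?e (snd z)))"
    proof (intro continuous_map_pairedI continuous_map_fst)
      show "continuous_map ?Z (product_topology (\<lambda>_. X) UNIV) (\<lambda>z. ?e (snd z))"
        unfolding continuous_map_componentwise
      proof (intro conjI ballI)
        fix i :: nat
        show "continuous_map ?Z X (\<lambda>z. ?e (snd z) i)"
          using continuous_map_compose[OF continuous_map_snd continuous_map_product_projection[of i "{..<k}" "\<lambda>_. X"]] zero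
          by (auto simp: o_def)
      qed auto
    qed
    from continuous_map_compose[OF this cont[of k]]
    have "continuous_map ?Z Y (\<lambda>z. D k (?e (snd z)) (fst z))" by (simp add: o_def)
    then show "continuous_map ?Z Y (\<lambda>(x, v). iter_deriv Y f k v x)"
    proof (rule continuous_map_eq)
      fix z assume "z \<in> topspace ?Z"
      then have z': "fst z \<in> U" "snd z \<in> {..<k} \<rightarrow>\<^sub>E topspace X" by (auto simp: mem_Times_iff)
      have z: "?e (snd z) i \<in> topspace X" for i using z'(2) zero by (auto simp: PiE_iff)
      have "iter_deriv Y f k (snd z) = iter_deriv Y f k (?e (snd z))" by (rule iter_deriv_cong_directions) auto
      then show "D k (?e (snd z)) (fst z) = (case z of (x, v) \<Rightarrow> iter_deriv Y f k v x)"
        using eq[of "?e (snd z)" "fst z" k, OF z z'(1)] by (simp add: case_prod_unfold)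
    qed
  qed
qed

text \<open>
  Higher derivatives are usually too complicated to be written down.  It is enough that a class of
  functions of (directions, point) contains the map and that each of its members has, in the direction
  with any index \<open>k\<close>, a derivative that belongs to the class again.
\<close>

lemma smooth_map_onI_family:
  fixes f :: "'a::real_vector \<Rightarrow> 'b::real_vector" and \<H> :: "((nat \<Rightarrow> 'a) \<Rightarrow> 'a \<Rightarrow> 'b) \<Rightarrow> bool"
  assumes X: "normable X" and Y: "normable Y" and U: "openin X U"
    and H0: "\<H> H0" and init: "\<And>v x. (\<And>i. v i \<in> topspace X) \<Longrightarrow> x \<in> U \<Longrightarrow> H0 v x = f x"
    and step: "\<And>H k. \<H> H \<Longrightarrow> \<exists>H'. \<H> H' \<and> (\<forall>v x. (\<forall>i. v i \<in> topspace X) \<longrightarrow> x \<in> U \<longrightarrow>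
        has_dir_deriv Y (H v) x (v k) (H' v x))"
    and cont: "\<And>H. \<H> H \<Longrightarrow> continuous_map (prod_topology (subtopology X U) (product_topology (\<lambda>_. X) UNIV)) Y
        (\<lambda>(x, v). H v x)"
  shows "smooth_map_on X U Y f"
proof -
  define N where "N k H = (SOME H'. \<H> H' \<and> (\<forall>v x. (\<forall>i. v i \<in> topspace X) \<longrightarrow> x \<in> U \<longrightarrow>
        has_dir_deriv Y (H v) x (v k) (H' v x)))" for k H
  have N: "\<H> (N k H)" "\<And>v x. (\<forall>i. v i \<in> topspace X) \<Longrightarrow> x \<in> U \<Longrightarrow> has_dir_deriv Y (H v) x (v k) (N k H v x)"
    if "\<H> H" for k H
    using someI_ex[OF step[OF that, of k]] unfolding N_def by auto
  define D where "D = rec_nat H0 N"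
  have D: "D 0 = H0" "D (Suc k) = N k (D k)" for k by (auto simp: D_def)
  have HD: "\<H> (D k)" for k
  proof (induction k)
    case (Suc k)
    show ?case unfolding D(2) by (rule N(1)[OF Suc])
  qed (simp add: D(1) H0)
  show ?thesis
  proof (rule smooth_map_onI_jets[OF X Y U])
    show "D 0 v x = f x" if "\<And>i. v i \<in> topspace X" "x \<in> U" for v x
      unfolding D(1) by (rule init[OF that])
    show "has_dir_deriv Y (D k v) x (v k) (D (Suc k) v x)" if "\<And>i. v i \<in> topspace X" "x \<in> U" for k v x
      unfolding D(2) by (rule N(2)[OF HD]) (use that in auto)
    show "continuous_map (prod_topology (subtopology X U) (product_topology (\<lambda>_. X) UNIV)) Y (\<lambda>(x, v). D k v x)" for k
      by (rule cont[OF HD])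
  qed
qed

section \<open>Operations on smooth maps\<close>

lemma continuous_map_direction:
  "continuous_map (prod_topology Z (product_topology (\<lambda>_. X) UNIV)) X (\<lambda>z. snd z j)"
  using continuous_map_compose[OF continuous_map_snd continuous_map_product_projection[of j UNIV "\<lambda>_. X"]]
  by (simp add: o_def)

lemma smooth_map_on_subset_cong:
  assumes X: "normable X" and Y: "normable Y" and f: "smooth_map_on X U Y f"
    and U': "openin X U'" "U' \<subseteq> U" and eq: "\<And>x. x \<in> U' \<Longrightarrow> g x = f x"
  shows "smooth_map_on X U' Y g"
proof (rule smooth_map_onI_jets[OF X Y U'(1), where D = "iter_deriv Y f"])
  show "has_dir_deriv Y (iter_deriv Y f k v) x (v k) (iter_deriv Y f (Suc k) v x)"
    if "\<And>i. v i \<in> topspace X" "x \<in> U'" for k v x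
    by (rule smooth_has_dir_deriv[OF Y f]) (use that U' in auto)
  fix k
  have "continuous_map (prod_topology (subtopology X U') (product_topology (\<lambda>_. X) UNIV)) (subtopology X U) fst"
    using continuous_map_fst[of "subtopology X U'" "product_topology (\<lambda>_. X) UNIV"] U'(2)
    by (auto simp: continuous_map_in_subtopology)
  from smooth_iter_deriv_continuous[OF f this continuous_map_direction]
  show "continuous_map (prod_topology (subtopology X U') (product_topology (\<lambda>_. X) UNIV)) Y
      (\<lambda>(x, v). iter_deriv Y f k v x)" by (simp add: case_prod_unfold)
qed (use eq in auto)

lemma smooth_map_on_cong:
  assumes "normable X" "normable Y" "smooth_map_on X U Y f" "\<And>x. x \<in> U \<Longrightarrow> g x = f x"
  shows "smooth_map_on X U Y g"
  using smooth_map_on_subset_cong[OF assms(1-3) smooth_map_on_openin[OF assms(3)]] assms(4) by auto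

lemma smooth_map_on_add:
  assumes X: "normable X" and Y: "normable Y" and f: "smooth_map_on X U Y f" and g: "smooth_map_on X U Y g"
  shows "smooth_map_on X U Y (\<lambda>x. f x + g x)"
proof (rule smooth_map_onI_jets[OF X Y smooth_map_on_openin[OF f],
      where D = "\<lambda>k v x. iter_deriv Y f k v x + iter_deriv Y g k v x"])
  show "has_dir_deriv Y (\<lambda>x. iter_deriv Y f k v x + iter_deriv Y g k v x) x (v k)
      (iter_deriv Y f (Suc k) v x + iter_deriv Y g (Suc k) v x)"
    if "\<And>i. v i \<in> topspace X" "x \<in> U" for k v x
    by (intro has_dir_deriv_add[OF Y] smooth_has_dir_deriv[OF Y f] smooth_has_dir_deriv[OF Y g] that)
  fix k
  show "continuous_map (prod_topology (subtopology X U) (product_topology (\<lambda>_. X) UNIV)) Y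
      (\<lambda>(x, v). iter_deriv Y f k v x + iter_deriv Y g k v x)"
    unfolding case_prod_unfold
    by (intro continuous_map_add[OF Y] smooth_iter_deriv_continuous[OF f continuous_map_fst continuous_map_direction]
        smooth_iter_deriv_continuous[OF g continuous_map_fst continuous_map_direction])
qed simp

lemma smooth_map_on_linear:
  fixes T :: "'a::real_vector \<Rightarrow> 'b::real_vector"
  assumes X: "normable X" and Y: "normable Y"
    and T: "linear_map_on (topspace X) T" "continuous_map X Y T"
  shows "smooth_map_on X (topspace X) Y T"
proof (rule smooth_map_onI_jets[OF X Y openin_topspace,
      where D = "\<lambda>k v x. if k = 0 then T x else if k = 1 then T (v 0) else 0"])
  have zY: "0 \<in> topspace Y" using subspace_0[OF normable_subspace[OF Y]] .
  fix k :: nat and v :: "nat \<Rightarrow> 'a" and x assume v: "\<And>i. v i \<in> topspace X" and x: "x \<in> topspace X"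
  have "has_dir_deriv Y T x (v 0) (T (v 0))"
    unfolding has_dir_deriv_def
  proof (rule limitin_eventually)
    show "\<forall>\<^sub>F t in at 0. (T (x + t *\<^sub>R v 0) - T x) /\<^sub>R t = T (v 0)"
      using x v[of 0] subspace_scale[OF normable_subspace[OF X]]
      by (auto simp: eventually_at_filter linear_map_on_add[OF T(1)] linear_map_on_scale[OF T(1)])
  qed (use continuous_map_image_subset_topspace[OF T(2)] v in auto)
  then show "has_dir_deriv Y (\<lambda>x. if k = 0 then T x else if k = 1 then T (v 0) else 0) x (v k)
     (if Suc k = 0 then T x else if Suc k = 1 then T (v 0) else 0)"
    using has_dir_deriv_const[of _ Y] zY by (cases k) auto
next
  have zY: "0 \<in> topspace Y" using subspace_0[OF normable_subspace[OF Y]] .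
  fix k :: nat
  show "continuous_map (prod_topology (subtopology X (topspace X)) (product_topology (\<lambda>_. X) UNIV)) Y
      (\<lambda>(x, v). if k = 0 then T x else if k = 1 then T (v 0) else 0)"
    using continuous_map_compose[OF continuous_map_fst T(2)] continuous_map_compose[OF continuous_map_direction T(2)] zY
    by (auto simp: case_prod_unfold o_def)
qed auto

lemma smooth_map_on_const:
  assumes X: "normable X" and Y: "normable Y" and U: "openin X U" and c: "c \<in> topspace Y"
  shows "smooth_map_on X U Y (\<lambda>_. c)"
proof (rule smooth_map_onI_jets[OF X Y U, where D = "\<lambda>k v x. if k = 0 then c else 0"])
  have zY: "0 \<in> topspace Y" using subspace_0[OF normable_subspace[OF Y]] .
  show "has_dir_deriv Y (\<lambda>x. if k = 0 then c else 0) x (v k) (if Suc k = 0 then c else 0)" for k v x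
    using has_dir_deriv_const[of _ Y] zY by auto
  show "continuous_map (prod_topology (subtopology X U) (product_topology (\<lambda>_. X) UNIV)) Y
      (\<lambda>(x, v). if k = 0 then c else 0)" for k
    using zY c by (auto simp: case_prod_unfold)
qed auto

lemma smooth_map_on_id: "normable X \<Longrightarrow> openin X U \<Longrightarrow> smooth_map_on X U X (\<lambda>x. x)"
  using smooth_map_on_subset_cong[of X X "topspace X" "\<lambda>x. x" U "\<lambda>x. x"] smooth_map_on_linear[of X X "\<lambda>x. x"]
    openin_subset[of X U]
  by (auto simp: linear_map_on_def)

text \<open>
  The terms of Faa di Bruno's formula: a derivative of \<open>g\<close> whose directions are derivatives of \<open>f\<close> in
  blocks of the given directions.  In \<open>base\<close> the \<open>i\<close>-th block has length \<open>m i\<close> and consists of the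
  directions with indices \<open>s i 0, \<dots>, s i (m i - 1)\<close>.
\<close>

inductive chain_rule_term ::
  "'b::real_vector topology \<Rightarrow> ('a::real_vector \<Rightarrow> 'b) \<Rightarrow> 'c::real_vector topology \<Rightarrow> ('b \<Rightarrow> 'c) \<Rightarrow>
   ((nat \<Rightarrow> 'a) \<Rightarrow> 'a \<Rightarrow> 'c) \<Rightarrow> bool"
  for Y f Z g where
  zero: "chain_rule_term Y f Z g (\<lambda>v x. 0)"
| add: "chain_rule_term Y f Z g H \<Longrightarrow> chain_rule_term Y f Z g H' \<Longrightarrow>
    chain_rule_term Y f Z g (\<lambda>v x. H v x + H' v x)"
| base: "chain_rule_term Y f Z g
    (\<lambda>v x. iter_deriv Z g j (\<lambda>i. iter_deriv Y f (m i) (\<lambda>l. v (s i l)) x) (f x))"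

lemma chain_rule_term_sum:
  "finite I \<Longrightarrow> (\<And>i. i \<in> I \<Longrightarrow> chain_rule_term Y f Z g (H i)) \<Longrightarrow>
   chain_rule_term Y f Z g (\<lambda>v x. \<Sum>i\<in>I. H i v x)"
proof (induction I rule: finite_induct)
  case empty
  then show ?case using chain_rule_term.zero by simp
next
  case (insert i I)
  then show ?case using chain_rule_term.add[of Y f Z g "H i" "\<lambda>v x. \<Sum>i\<in>I. H i v x"] by simp
qed

lemma smooth_iter_deriv_step:
  assumes Y: "normable Y" and f: "smooth_map_on X U Y f" and x: "x \<in> U" and v: "\<And>i. v i \<in> topspace X"
  shows "has_dir_deriv Y (\<lambda>x. iter_deriv Y f m (\<lambda>l. v (s l)) x) x (v k)
    (iter_deriv Y f (Suc m) (\<lambda>l. v ((s(m := k)) l)) x)"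
proof -
  have "iter_deriv Y f m (\<lambda>l. v ((s(m := k)) l)) = iter_deriv Y f m (\<lambda>l. v (s l))"
    by (rule iter_deriv_cong_directions) auto
  moreover have "has_dir_deriv Y (iter_deriv Y f m (\<lambda>l. v ((s(m := k)) l))) x (v ((s(m := k)) m))
      (iter_deriv Y f (Suc m) (\<lambda>l. v ((s(m := k)) l)) x)"
    by (rule smooth_has_dir_deriv[OF Y f x]) (rule v)
  ultimately show ?thesis by (simp only: fun_upd_same)
qed

lemma smooth_map_on_compose:
  fixes f :: "'a::real_vector \<Rightarrow> 'b::real_vector" and g :: "'b \<Rightarrow> 'c::real_vector"
  assumes X: "normable X" and Y: "normable Y" and Z: "normable Z"
    and f: "smooth_map_on X U Y f" and g: "smooth_map_on Y V Z g" and fU: "f ` U \<subseteq> V"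
  shows "smooth_map_on X U Z (\<lambda>x. g (f x))"
proof (rule smooth_map_onI_family[OF X Z smooth_map_on_openin[OF f], where \<H> = "chain_rule_term Y f Z g"])
  show "chain_rule_term Y f Z g
    (\<lambda>v x. iter_deriv Z g 0 (\<lambda>i. iter_deriv Y f ((\<lambda>_. 0) i) (\<lambda>l. v ((\<lambda>_ _. 0) i l)) x) (f x))"
    by (rule chain_rule_term.base)
  show "iter_deriv Z g 0 (\<lambda>i. iter_deriv Y f 0 (\<lambda>l. v 0) x) (f x) = g (f x)" for v :: "nat \<Rightarrow> 'a" and x by simp
next
  have zero: "0 \<in> topspace Z" using subspace_0[OF normable_subspace[OF Z]] .
  let ?Q = "prod_topology (subtopology X U) (product_topology (\<lambda>_::nat. X) UNIV)"
  have fq: "continuous_map ?Q (subtopology Y V) (\<lambda>q. f (fst q))"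
    unfolding continuous_map_in_subtopology
    using continuous_map_compose[OF continuous_map_fst smooth_map_on_continuous_map[OF f], of "product_topology (\<lambda>_::nat. X) UNIV"] fU
    by (auto simp: o_def)
  show "continuous_map ?Q Z (\<lambda>(x, v). H v x)" if "chain_rule_term Y f Z g H" for H
    using that
  proof (induction rule: chain_rule_term.induct)
    case (add H H')
    then show ?case using continuous_map_add[OF Z] by (auto simp: case_prod_unfold)
  next
    case (base j m s)
    have "continuous_map ?Q Z (\<lambda>q. iter_deriv Z g j (\<lambda>i. iter_deriv Y f (m i) (\<lambda>l. snd q (s i l)) (fst q)) (f (fst q)))"
      by (intro smooth_iter_deriv_continuous[OF g fq] smooth_iter_deriv_continuous[OF f continuous_map_fst]
          continuous_map_direction)
    then show ?case by (simp add: case_prod_unfold)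
  qed (use zero in auto)
  fix H :: "(nat \<Rightarrow> 'a) \<Rightarrow> 'a \<Rightarrow> 'c" and k :: nat
  assume "chain_rule_term Y f Z g H"
  then show "\<exists>H'. chain_rule_term Y f Z g H' \<and> (\<forall>v x. (\<forall>i. v i \<in> topspace X) \<longrightarrow> x \<in> U \<longrightarrow>
        has_dir_deriv Z (H v) x (v k) (H' v x))"
  proof (induction rule: chain_rule_term.induct)
    case zero
    show ?case using chain_rule_term.zero has_dir_deriv_const[of 0 Z] \<open>0 \<in> topspace Z\<close> by fastforce
  next
    case (add H1 H2)
    then obtain H1' H2' where "chain_rule_term Y f Z g H1'" "chain_rule_term Y f Z g H2'"
      "\<And>v x. (\<forall>i. v i \<in> topspace X) \<Longrightarrow> x \<in> U \<Longrightarrow> has_dir_deriv Z (H1 v) x (v k) (H1' v x)"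
      "\<And>v x. (\<forall>i. v i \<in> topspace X) \<Longrightarrow> x \<in> U \<Longrightarrow> has_dir_deriv Z (H2 v) x (v k) (H2' v x)"
      by blast
    then show ?case
      by (intro exI[of _ "\<lambda>v x. H1' v x + H2' v x"]) (auto intro: chain_rule_term.add has_dir_deriv_add[OF Z])
  next
    case (base j m s)
    define E where "E m s v x = (\<lambda>i. iter_deriv Y f (m i) (\<lambda>l. v (s i l)) x)" for m and s :: "nat \<Rightarrow> nat \<Rightarrow> nat" and v and x :: 'a
    \<comment> \<open>Differentiating in direction \<open>k\<close> either opens a new block \<open>[k]\<close> or appends \<open>k\<close> to the \<open>i\<close>-th block.\<close>
    define m' where "m' i = m(i := Suc (m i))" for i
    define s' where "s' i = s(i := (s i)(m i := k))" for i
    define H' where "H' v x = iter_deriv Z g (Suc j) (E (m(j := 1)) (s(j := \<lambda>_. k)) v x) (f x)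
      + (\<Sum>i<j. iter_deriv Z g j (E (m' i) (s' i) v x) (f x))" for v x
    have "chain_rule_term Y f Z g H'"
      unfolding H'_def E_def
      by (intro chain_rule_term.add chain_rule_term_sum chain_rule_term.base) auto
    moreover have "has_dir_deriv Z (\<lambda>x. iter_deriv Z g j (\<lambda>i. iter_deriv Y f (m i) (\<lambda>l. v (s i l)) x) (f x)) x (v k) (H' v x)"
      if v: "\<forall>i. v i \<in> topspace X" and x: "x \<in> U" for v x
    proof -
      have E1: "(\<lambda>i. iter_deriv Y f (m i) (\<lambda>l. v (s i l)) x)(j := dir_deriv Y f x (v k)) = E (m(j := 1)) (s(j := \<lambda>_. k)) v x"
        by (simp add: E_def fun_eq_iff)
      have E2: "(\<lambda>i. iter_deriv Y f (m i) (\<lambda>l. v (s i l)) x)(i := iter_deriv Y f (Suc (m i)) (\<lambda>l. v (((s i)(m i := k)) l)) x)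
          = E (m' i) (s' i) v x" for i
        by (simp add: E_def m'_def s'_def fun_eq_iff del: iter_deriv.simps)
      show ?thesis
        unfolding H'_def E1[symmetric] E2[symmetric]
      proof (rule has_dir_deriv_iter_deriv[OF Y Z g])
        show "has_dir_deriv Y f x (v k) (dir_deriv Y f x (v k))"
          by (rule smooth_has_dir_deriv1[OF Y f x]) (use v in auto)
        show "f x \<in> V" using fU x by auto
        show "has_dir_deriv Y (\<lambda>x. iter_deriv Y f (m i) (\<lambda>l. v (s i l)) x) x (v k)
           (iter_deriv Y f (Suc (m i)) (\<lambda>l. v (((s i)(m i := k)) l)) x)" for i
          by (rule smooth_iter_deriv_step[OF Y f x]) (use v in auto)
        show "iter_deriv Y f (m i) (\<lambda>l. v (s i l)) x \<in> topspace Y" for i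
          by (rule smooth_iter_deriv_topspace[OF f x]) (use v in auto)
      qed
    qed
    ultimately show ?case by blast
  qed
qed

lemma has_dir_deriv_chain:
  assumes "normable Y" "normable Z" "smooth_map_on Y V Z g" "has_dir_deriv Y f x v l" "f x \<in> V"
  shows "has_dir_deriv Z (\<lambda>x. g (f x)) x v (dir_deriv Z g (f x) l)"
  using has_dir_deriv_iter_deriv[OF assms, of 0] by simp

definition diffeo_on ::
  "'a::real_vector topology \<Rightarrow> 'a set \<Rightarrow> 'b::real_vector topology \<Rightarrow> 'b set \<Rightarrow> ('a \<Rightarrow> 'b) \<Rightarrow> ('b \<Rightarrow> 'a) \<Rightarrow> bool" where
  "diffeo_on X U Y V f g \<longleftrightarrow>
     smooth_map_on X U Y f \<and> smooth_map_on Y V X g \<and> f ` U \<subseteq> V \<and> g ` V \<subseteq> U \<and>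
     (\<forall>x\<in>U. g (f x) = x) \<and> (\<forall>y\<in>V. f (g y) = y)"

section \<open>Strict differentiability\<close>

text \<open>
  Joint continuity of the first derivative alone does not make it continuous in the operator norm, but
  joint continuity of the second derivative does: that one vanishes at \<open>(x0, 0, 0)\<close>, hence is bounded by \<open>1\<close> for small arguments, and
  by bilinearity this is a bound in terms of the norms of the directions.  The mean value inequality
  turns it into an operator norm estimate for the first derivative, and a second application gives strict
  differentiability.
\<close>

lemma smooth_strict_derivative:
  assumes m: "norm_on X m" and n: "norm_on Y n" and f: "smooth_map_on X U Y f" and x0: "x0 \<in> U" and e: "e > 0"
  obtains d where "d > 0" "{x \<in> topspace X. m (x - x0) < d} \<subseteq> U"
    "\<And>x v. x \<in> topspace X \<Longrightarrow> m (x - x0) < d \<Longrightarrow> v \<in> topspace X \<Longrightarrow>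
       n (dir_deriv Y f x v - dir_deriv Y f x0 v) \<le> e * m v"
    "\<And>x y. x \<in> topspace X \<Longrightarrow> m (x - x0) < d \<Longrightarrow> y \<in> topspace X \<Longrightarrow> m (y - x0) < d \<Longrightarrow>
       n (f x - f y - dir_deriv Y f x0 (x - y)) \<le> e * m (x - y)"
proof -
  have X: "normable X" and Y: "normable Y" using m n norm_on_imp_normable by auto
  note U = smooth_map_on_openin[OF f] and subX = normable_subspace[OF X] and subY = normable_subspace[OF Y]
  have UX: "U \<subseteq> topspace X" using openin_subset[OF U] .
  have x0X: "x0 \<in> topspace X" using x0 UX by auto
  have zX: "0 \<in> topspace X" and zY: "0 \<in> topspace Y" using subspace_0 subX subY by auto
  define D2 where "D2 x v w = iter_deriv Y f (Suc (Suc 0)) ((\<lambda>_. v)(Suc 0 := w)) x" for x v w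
  have D2top: "D2 x v w \<in> topspace Y" if "x \<in> U" "v \<in> topspace X" "w \<in> topspace X" for x v w
    unfolding D2_def by (rule smooth_iter_deriv_topspace[OF f that(1)]) (use that in auto)
  have D2lin: "linear_map_on (topspace X) (D2 x v)" if "x \<in> U" "v \<in> topspace X" for x v
    using smooth_iter_deriv_linear[OF X Y f that(1), of "Suc 0" "Suc (Suc 0)" "\<lambda>_. v"] that(2)
    unfolding D2_def by (auto simp del: iter_deriv.simps)
  have D2deriv: "has_dir_deriv Y (\<lambda>x. dir_deriv Y f x v) x w (D2 x v w)"
    if "x \<in> U" "v \<in> topspace X" "w \<in> topspace X" for x v w
  proof -
    have "((\<lambda>_::nat. v)(Suc 0 := w)) i \<in> topspace X" for i using that by auto
    from smooth_has_dir_deriv[OF Y f that(1), of "Suc 0" "(\<lambda>_. v)(Suc 0 := w)", OF this] show ?thesis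
      unfolding D2_def by simp
  qed
  define Q where "Q = prod_topology (subtopology X U) (prod_topology X X)"
  have "continuous_map Q Y (\<lambda>q. iter_deriv Y f (Suc (Suc 0)) (\<lambda>i. if i = Suc 0 then snd (snd q) else fst (snd q)) (fst q))"
  proof (rule smooth_iter_deriv_continuous[OF f])
    show "continuous_map Q X (\<lambda>q. if i = Suc 0 then snd (snd q) else fst (snd q))" for i
      using continuous_map_compose[OF continuous_map_snd continuous_map_snd, of "subtopology X U" X X]
        continuous_map_compose[OF continuous_map_snd continuous_map_fst, of "subtopology X U" X X]
      by (auto simp: Q_def o_def)
  qed (simp add: Q_def continuous_map_fst)
  then have D2c: "continuous_map Q Y (\<lambda>q. D2 (fst q) (fst (snd q)) (snd (snd q)))"
    unfolding D2_def fun_upd_def .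
  obtain \<delta> where \<delta>: "\<delta> > 0" "\<And>x. x \<in> topspace X \<Longrightarrow> m (x - x0) < \<delta> \<Longrightarrow> x \<in> U"
    "\<And>x v w. x \<in> topspace X \<Longrightarrow> m (x - x0) < \<delta> \<Longrightarrow> v \<in> topspace X \<Longrightarrow> m v < \<delta> \<Longrightarrow> w \<in> topspace X \<Longrightarrow> m w < \<delta> \<Longrightarrow>
      n (D2 x v w) < 1"
  proof -
    let ?N = "{q \<in> topspace Q. D2 (fst q) (fst (snd q)) (snd (snd q)) \<in> {y \<in> topspace Y. n (y - 0) < 1}}"
    have N: "openin Q ?N" using openin_continuous_map_preimage[OF D2c norm_on_openin_ball[OF n zY, of 1]] .
    have "D2 x0 0 0 = 0" using linear_map_on_zero[OF D2lin[OF x0 zX] subX] .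
    then have "(x0, 0, 0) \<in> ?N" using x0 x0X zX zY norm_on_zero[OF n] by (auto simp: Q_def)
    then obtain Ox Ovw where Ox: "openin (subtopology X U) Ox" "x0 \<in> Ox" and Ovw: "openin (prod_topology X X) Ovw"
      "(0, 0) \<in> Ovw" "Ox \<times> Ovw \<subseteq> ?N"
      using N unfolding Q_def openin_prod_topology_alt by meson
    then obtain Ov Ow where Ov: "openin X Ov" "0 \<in> Ov" and Ow: "openin X Ow" "0 \<in> Ow" "Ov \<times> Ow \<subseteq> Ovw"
      unfolding openin_prod_topology_alt by meson
    have OxX: "openin X Ox" "Ox \<subseteq> U" using Ox(1) U openin_trans_full openin_imp_subset by blast+
    obtain r1 where r1: "r1 > 0" "\<And>x. x \<in> topspace X \<Longrightarrow> m (x - x0) < r1 \<Longrightarrow> x \<in> Ox"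
      using OxX(1) Ox(2) unfolding norm_on_openin_iff[OF m] by meson
    obtain r2 where r2: "r2 > 0" "\<And>x. x \<in> topspace X \<Longrightarrow> m (x - 0) < r2 \<Longrightarrow> x \<in> Ov"
      using Ov unfolding norm_on_openin_iff[OF m] by meson
    obtain r3 where r3: "r3 > 0" "\<And>x. x \<in> topspace X \<Longrightarrow> m (x - 0) < r3 \<Longrightarrow> x \<in> Ow"
      using Ow unfolding norm_on_openin_iff[OF m] by meson
    show ?thesis
    proof (rule that[of "min r1 (min r2 r3)"])
      fix x v w assume "x \<in> topspace X" "m (x - x0) < min r1 (min r2 r3)" "v \<in> topspace X"
        "m v < min r1 (min r2 r3)" "w \<in> topspace X" "m w < min r1 (min r2 r3)"
      then have "(x, v, w) \<in> ?N" using r1 r2 r3 Ow Ovw by (auto simp: subset_iff)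
      then show "n (D2 x v w) < 1" by auto
    qed (use r1 r2 r3 OxX in auto)
  qed
  \<comment> \<open>A displacement of norm below \<open>k * \<delta>\<close> is \<open>k\<close> times a vector of norm below \<open>\<delta>\<close>, and a direction
    can be rescaled to norm \<open>\<delta> / 2\<close>; so the derivative changes by at most \<open>2 * k / \<delta>\<close> in operator norm.\<close>
  define k where "k = min 1 (e * \<delta> / 2)"
  define d where "d = k * \<delta>"
  have k: "k > 0" "k \<le> 1" "k \<le> e * \<delta> / 2" using e \<delta> by (auto simp: k_def)
  have d: "d > 0" "d \<le> \<delta>" using k \<delta> mult_right_mono[of k 1 \<delta>] by (auto simp: d_def)
  have seg: "y + s *\<^sub>R (x - y) \<in> topspace X \<and> m (y + s *\<^sub>R (x - y) - x0) < d"
    if "x \<in> topspace X" "m (x - x0) < d" "y \<in> topspace X" "m (y - x0) < d" "0 \<le> s" "s \<le> 1" for x y s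
  proof
    show "y + s *\<^sub>R (x - y) \<in> topspace X" using that subspace_add[OF subX] subspace_scale[OF subX] subspace_diff[OF subX] by auto
    have "y + s *\<^sub>R (x - y) - x0 = (1 - s) *\<^sub>R (y - x0) + s *\<^sub>R (x - x0)" by (simp add: algebra_simps)
    then have "m (y + s *\<^sub>R (x - y) - x0) \<le> \<bar>1 - s\<bar> * m (y - x0) + \<bar>s\<bar> * m (x - x0)"
      using that norm_on_add[OF m, of "(1 - s) *\<^sub>R (y - x0)" "s *\<^sub>R (x - x0)"] x0X subspace_scale[OF subX] subspace_diff[OF subX]
      by (simp add: norm_on_scale[OF m])
    also have "\<dots> \<le> (1 - s) * max (m (y - x0)) (m (x - x0)) + s * max (m (y - x0)) (m (x - x0))"
      using that by (intro add_mono mult_mono) (auto simp: norm_on_nonneg[OF m subspace_diff[OF subX _ x0X]])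
    also have "\<dots> = max (m (y - x0)) (m (x - x0))" by (simp add: algebra_simps)
    finally show "m (y + s *\<^sub>R (x - y) - x0) < d" using that by auto
  qed
  have center: "m (x0 - x0) < d" using d norm_on_zero[OF m] by simp
  have est: "n (dir_deriv Y f x v - dir_deriv Y f x0 v) \<le> e * m v"
    if x: "x \<in> topspace X" "m (x - x0) < d" and v: "v \<in> topspace X" for x v
  proof (cases "v = 0")
    case True
    have "dir_deriv Y f z 0 = 0" if "z \<in> U" for z
      using linear_map_on_zero[OF smooth_dir_deriv_linear[OF X Y f that] subX] .
    then show ?thesis using True x0 \<delta>(2)[OF x(1)] x(2) d norm_on_zero[OF n] norm_on_zero[OF m] by auto
  next
    case False
    have mv: "m v > 0" using norm_on_zero_iff[OF m v] norm_on_nonneg[OF m v] False by auto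
    define c where "c = \<delta> / (2 * m v)"
    have c: "c > 0" using \<delta> mv by (simp add: c_def)
    have xx: "x - x0 \<in> topspace X" using x x0X subspace_diff[OF subX] by auto
    define w' where "w' = inverse k *\<^sub>R (x - x0)"
    have w': "w' \<in> topspace X" using xx subspace_scale[OF subX] by (auto simp: w'_def)
    have mw': "m w' < \<delta>" using x k norm_on_scale[OF m xx] by (simp add: w'_def d_def field_simps)
    have xw: "x - x0 = k *\<^sub>R w'" using k by (simp add: w'_def)
    have cv: "c *\<^sub>R v \<in> topspace X" and mcv: "m (c *\<^sub>R v) < \<delta>"
      using v subspace_scale[OF subX] norm_on_scale[OF m v] c \<delta> mv by (auto simp: c_def)
    have "n (dir_deriv Y f (x0 + (x - x0)) (c *\<^sub>R v) - dir_deriv Y f x0 (c *\<^sub>R v) - 0) \<le> k"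
    proof (rule segment_mean_value_inequality[OF n zY])
      fix s :: real assume s: "0 \<le> s" "s \<le> 1"
      let ?z = "x0 + s *\<^sub>R (x - x0)"
      have z: "?z \<in> topspace X" "m (?z - x0) < \<delta>" using seg[OF x x0X center s] d by auto
      then have zU: "?z \<in> U" using \<delta>(2) by blast
      show "dir_deriv Y f ?z (c *\<^sub>R v) \<in> topspace Y"
        using smooth_has_dir_deriv1[OF Y f zU cv] has_dir_deriv_topspace by blast
      show "has_dir_deriv Y (\<lambda>z. dir_deriv Y f z (c *\<^sub>R v)) ?z (x - x0) (D2 ?z (c *\<^sub>R v) (x - x0))"
        by (rule D2deriv[OF zU cv xx])
      have "D2 ?z (c *\<^sub>R v) (x - x0) = k *\<^sub>R D2 ?z (c *\<^sub>R v) w'"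
        unfolding xw by (rule linear_map_on_scale[OF D2lin]) (use zU[unfolded xw] cv w' in auto)
      then have "n (D2 ?z (c *\<^sub>R v) (x - x0)) = k * n (D2 ?z (c *\<^sub>R v) w')"
        using norm_on_scale[OF n D2top[OF zU cv w']] k by simp
      also have "\<dots> \<le> k * 1"
        using \<delta>(3)[OF z cv mcv w' mw'] k by (intro mult_left_mono) auto
      finally show "n (D2 ?z (c *\<^sub>R v) (x - x0) - 0) \<le> k" by simp
    qed
    moreover have xU: "x \<in> U" using \<delta>(2) x d by auto
    have "dir_deriv Y f z (c *\<^sub>R v) = c *\<^sub>R dir_deriv Y f z v" if "z \<in> U" for z
      using linear_map_on_scale[OF smooth_dir_deriv_linear[OF X Y f that] v] .
    ultimately have "n (c *\<^sub>R (dir_deriv Y f x v - dir_deriv Y f x0 v)) \<le> k"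
      using x0 xU by (simp add: scaleR_diff_right)
    moreover have "dir_deriv Y f x v - dir_deriv Y f x0 v \<in> topspace Y"
      by (intro subspace_diff[OF subY] has_dir_deriv_topspace[OF smooth_has_dir_deriv1[OF Y f _ v]] xU x0)
    ultimately have "c * n (dir_deriv Y f x v - dir_deriv Y f x0 v) \<le> e * \<delta> / 2"
      using norm_on_scale[OF n] c k by auto
    then have "\<delta> * n (dir_deriv Y f x v - dir_deriv Y f x0 v) \<le> \<delta> * (e * m v)"
      using mv by (simp add: c_def field_simps)
    then show ?thesis using \<delta>(1) by simp
  qed
  show ?thesis
  proof (rule that[OF d(1) _ est])
    show "{x \<in> topspace X. m (x - x0) < d} \<subseteq> U" using \<delta>(2) d by auto
    fix x y assume xy: "x \<in> topspace X" "m (x - x0) < d" "y \<in> topspace X" "m (y - x0) < d"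
    have xyX: "x - y \<in> topspace X" using xy subspace_diff[OF subX] by auto
    have "n (f (y + (x - y)) - f y - dir_deriv Y f x0 (x - y)) \<le> e * m (x - y)"
    proof (rule segment_mean_value_inequality[OF n])
      show "dir_deriv Y f x0 (x - y) \<in> topspace Y"
        using smooth_has_dir_deriv1[OF Y f x0 xyX] has_dir_deriv_topspace by blast
      fix s :: real assume s: "0 \<le> s" "s \<le> 1"
      have z: "y + s *\<^sub>R (x - y) \<in> topspace X" "m (y + s *\<^sub>R (x - y) - x0) < d" using seg[OF xy s] by auto
      then have zU: "y + s *\<^sub>R (x - y) \<in> U" using \<delta>(2) d by auto
      show "f (y + s *\<^sub>R (x - y)) \<in> topspace Y" using smooth_map_on_topspace[OF f zU] .
      show "has_dir_deriv Y f (y + s *\<^sub>R (x - y)) (x - y) (dir_deriv Y f (y + s *\<^sub>R (x - y)) (x - y))"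
        by (rule smooth_has_dir_deriv1[OF Y f zU xyX])
      show "n (dir_deriv Y f (y + s *\<^sub>R (x - y)) (x - y) - dir_deriv Y f x0 (x - y)) \<le> e * m (x - y)"
        by (rule est[OF z xyX])
    qed
    then show "n (f x - f y - dir_deriv Y f x0 (x - y)) \<le> e * m (x - y)" by simp
  qed
qed

section \<open>The inverse function theorem\<close>

lemma limitin_norm_bound:
  assumes n: "norm_on X n" and m: "norm_on Z m" and l: "l \<in> topspace X" and g: "limitin Z g 0 F"
    and f: "\<forall>\<^sub>F i in F. f i \<in> topspace X \<and> n (f i - l) \<le> c * m (g i)"
  shows "limitin X f l F"
  unfolding norm_on_limitin_iff[OF n]
proof (intro conjI allI impI l)
  fix e :: real assume e: "e > 0"
  then have "e / (\<bar>c\<bar> + 1) > 0" by simp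
  then have "\<forall>\<^sub>F i in F. g i \<in> topspace Z \<and> m (g i - 0) < e / (\<bar>c\<bar> + 1)"
    using g unfolding norm_on_limitin_iff[OF m] by blast
  with f show "\<forall>\<^sub>F i in F. f i \<in> topspace X \<and> n (f i - l) < e"
  proof eventually_elim
    case (elim i)
    have mg: "m (g i) \<ge> 0" using elim norm_on_nonneg[OF m] by auto
    have "c * m (g i) \<le> (\<bar>c\<bar> + 1) * m (g i)" using mg by (intro mult_right_mono) auto
    also have "\<dots> < e" using elim by (simp add: pos_less_divide_eq mult.commute)
    finally show ?case using elim by auto
  qed
qed

text \<open>
  The functions that occur among the iterated derivatives of an inverse \<open>\<psi>\<close> of \<open>\<phi>\<close>, where \<open>A x\<close> is the
  inverse of the derivative of \<open>\<phi>\<close> at \<open>x\<close>.  Differentiating \<open>A (\<psi> y) w\<close> gives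
  \<open>A (\<psi> y) (w' - D\<^sup>2\<phi> (\<psi> y) (A (\<psi> y) w, A (\<psi> y) v))\<close>, so apart from \<open>\<psi>\<close>, sums and signs these functions are trees
  with \<open>A (\<psi> y) (v i)\<close> at the leaves and a derivative of \<open>\<phi>\<close> followed by \<open>A (\<psi> y)\<close> at the nodes.
\<close>

inductive inverse_term ::
  "'a::real_vector topology \<Rightarrow> ('a \<Rightarrow> 'a) \<Rightarrow> ('a \<Rightarrow> 'a) \<Rightarrow> ('a \<Rightarrow> 'a \<Rightarrow> 'a) \<Rightarrow> ((nat \<Rightarrow> 'a) \<Rightarrow> 'a \<Rightarrow> 'a) \<Rightarrow> bool"
  for X \<phi> \<psi> A where
  self: "inverse_term X \<phi> \<psi> A (\<lambda>v y. \<psi> y)"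
| zero: "inverse_term X \<phi> \<psi> A (\<lambda>v y. 0)"
| add: "inverse_term X \<phi> \<psi> A H \<Longrightarrow> inverse_term X \<phi> \<psi> A H' \<Longrightarrow> inverse_term X \<phi> \<psi> A (\<lambda>v y. H v y + H' v y)"
| minus: "inverse_term X \<phi> \<psi> A H \<Longrightarrow> inverse_term X \<phi> \<psi> A (\<lambda>v y. - H v y)"
| direction: "inverse_term X \<phi> \<psi> A (\<lambda>v y. A (\<psi> y) (v i))"
| node: "(\<And>i. i < j \<Longrightarrow> inverse_term X \<phi> \<psi> A (w i)) \<Longrightarrow>
    inverse_term X \<phi> \<psi> A (\<lambda>v y. A (\<psi> y) (iter_deriv X \<phi> j (\<lambda>i. w i v y) (\<psi> y)))"

lemma inverse_term_sum:
  "finite I \<Longrightarrow> (\<And>i. i \<in> I \<Longrightarrow> inverse_term X \<phi> \<psi> A (H i)) \<Longrightarrow>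
   inverse_term X \<phi> \<psi> A (\<lambda>v y. \<Sum>i\<in>I. H i v y)"
proof (induction I rule: finite_induct)
  case empty
  then show ?case using inverse_term.zero by simp
next
  case (insert i I)
  then show ?case using inverse_term.add[of X \<phi> \<psi> A "H i" "\<lambda>v y. \<Sum>i\<in>I. H i v y"] by simp
qed

text \<open>
  The inverse of a smooth map is smooth once it satisfies a Lipschitz bound and the inverses \<open>A x\<close> of the
  derivatives are bounded uniformly in the base point.
\<close>

locale smooth_bijection =
  fixes X :: "'a::real_vector topology" and n \<Omega> \<Omega>' \<phi> \<psi> A
  assumes n: "norm_on X n" and smooth: "smooth_map_on X \<Omega> X \<phi>" and \<Omega>': "openin X \<Omega>'"
    and \<psi>: "\<And>y. y \<in> \<Omega>' \<Longrightarrow> \<psi> y \<in> \<Omega>" and \<phi>\<psi>: "\<And>y. y \<in> \<Omega>' \<Longrightarrow> \<phi> (\<psi> y) = y"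
    and lipschitz: "\<And>x y. x \<in> \<Omega> \<Longrightarrow> y \<in> \<Omega> \<Longrightarrow> n (x - y) \<le> 2 * n (\<phi> x - \<phi> y)"
    and A_in: "\<And>x w. x \<in> \<Omega> \<Longrightarrow> w \<in> topspace X \<Longrightarrow> A x w \<in> topspace X"
    and A: "\<And>x w. x \<in> \<Omega> \<Longrightarrow> w \<in> topspace X \<Longrightarrow> dir_deriv X \<phi> x (A x w) = w"
    and lower: "\<And>x v. x \<in> \<Omega> \<Longrightarrow> v \<in> topspace X \<Longrightarrow> n v \<le> 2 * n (dir_deriv X \<phi> x v)"
begin

lemma X: "normable X" using norm_on_imp_normable[OF n] .
lemma sub: "subspace (topspace X)" using normable_subspace[OF X] .
lemma \<Omega>X: "x \<in> \<Omega> \<Longrightarrow> x \<in> topspace X" using openin_subset[OF smooth_map_on_openin[OF smooth]] by auto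
lemma \<Omega>'X: "y \<in> \<Omega>' \<Longrightarrow> y \<in> topspace X" using openin_subset[OF \<Omega>'] by auto

lemma linear_deriv: "x \<in> \<Omega> \<Longrightarrow> linear_map_on (topspace X) (dir_deriv X \<phi> x)"
  by (rule smooth_dir_deriv_linear[OF X X smooth])

lemma deriv_in: "x \<in> \<Omega> \<Longrightarrow> v \<in> topspace X \<Longrightarrow> dir_deriv X \<phi> x v \<in> topspace X"
  using has_dir_deriv_topspace[OF smooth_has_dir_deriv1[OF X smooth]] .

lemma deriv_inject:
  assumes "x \<in> \<Omega>" "u \<in> topspace X" "v \<in> topspace X" "dir_deriv X \<phi> x u = dir_deriv X \<phi> x v"
  shows "u = v"
proof -
  have uv: "u - v \<in> topspace X" using assms subspace_diff[OF sub] by auto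
  have "dir_deriv X \<phi> x (u - v) = 0" using linear_map_on_diff[OF linear_deriv[OF assms(1)] sub] assms by auto
  then have "n (u - v) \<le> 0" using lower[OF assms(1) uv] norm_on_zero[OF n] by auto
  then show ?thesis using norm_on_nonneg[OF n uv] norm_on_zero_iff[OF n uv] by auto
qed

lemma A_deriv_cancel: "x \<in> \<Omega> \<Longrightarrow> v \<in> topspace X \<Longrightarrow> A x (dir_deriv X \<phi> x v) = v"
  by (rule deriv_inject[of x]) (auto simp: A A_in deriv_in)

lemma A_linear:
  assumes x: "x \<in> \<Omega>" shows "linear_map_on (topspace X) (A x)"
  unfolding linear_map_on_def
proof safe
  fix a b assume ab: "a \<in> topspace X" "b \<in> topspace X"
  then have "a + b \<in> topspace X" using subspace_add[OF sub] by auto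
  then show "A x (a + b) = A x a + A x b"
    using ab x by (intro deriv_inject[OF x, of "A x (a + b)" "A x a + A x b"])
      (auto simp: A_in A subspace_add[OF sub] linear_map_on_add[OF linear_deriv[OF x]])
next
  fix a and t :: real assume a: "a \<in> topspace X"
  then have "t *\<^sub>R a \<in> topspace X" using subspace_scale[OF sub] by auto
  then show "A x (t *\<^sub>R a) = t *\<^sub>R A x a"
    using a x by (intro deriv_inject[OF x, of "A x (t *\<^sub>R a)" "t *\<^sub>R A x a"])
      (auto simp: A_in A subspace_scale[OF sub] linear_map_on_scale[OF linear_deriv[OF x]])
qed

text \<open>
  Apply the uniform lower bound to \<open>A (x i) (w i) - A x0 w0\<close>: its image under the derivative at \<open>x i\<close> is
  \<open>w i - D\<phi> (x i) (A x0 w0)\<close>, which tends to \<open>0\<close> by joint continuity of \<open>D\<phi>\<close>.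
\<close>

lemma A_limit:
  assumes x: "limitin X x x0 F" "x0 \<in> \<Omega>" and w: "limitin X w w0 F"
  shows "limitin X (\<lambda>i. A (x i) (w i)) (A x0 w0) F"
proof -
  have w0: "w0 \<in> topspace X" using limitin_topspace[OF w] .
  let ?a = "A x0 w0"
  have a: "?a \<in> topspace X" by (rule A_in[OF x(2) w0])
  have "limitin X (\<lambda>i. iter_deriv X \<phi> 1 (\<lambda>_. ?a) (x i)) (iter_deriv X \<phi> 1 (\<lambda>_. ?a) x0) F"
    by (rule smooth_iter_deriv_limit[OF smooth x]) (use a in auto)
  then have "limitin X (\<lambda>i. dir_deriv X \<phi> (x i) ?a) w0 F" using A[OF x(2) w0] by simp
  from limitin_diff[OF X w this] have lim: "limitin X (\<lambda>i. w i - dir_deriv X \<phi> (x i) ?a) 0 F" by simp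
  show ?thesis
  proof (rule limitin_norm_bound[OF n n a lim])
    from limitinD[OF x(1) smooth_map_on_openin[OF smooth] x(2)] limitin_eventually_topspace[OF w]
    show "\<forall>\<^sub>F i in F. A (x i) (w i) \<in> topspace X \<and> n (A (x i) (w i) - ?a) \<le> 2 * n (w i - dir_deriv X \<phi> (x i) ?a)"
    proof eventually_elim
      case (elim i)
      then have "A (x i) (w i) \<in> topspace X" using A_in by auto
      then show ?case
        using lower[OF elim(1), of "A (x i) (w i) - ?a"] linear_map_on_diff[OF linear_deriv[OF elim(1)] sub _ a]
          A[OF elim] subspace_diff[OF sub _ a] by auto
    qed
  qed
qed

lemma A_continuous:
  assumes x: "continuous_map Z (subtopology X \<Omega>) x" and w: "continuous_map Z X w"
  shows "continuous_map Z X (\<lambda>z. A (x z) (w z))"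
  unfolding continuous_map_atin
proof
  fix z assume z: "z \<in> topspace Z"
  have "limitin X x (x z) (atin Z z)" "x z \<in> \<Omega>"
    using x z by (auto simp: continuous_map_atin limitin_subtopology)
  then show "limitin X (\<lambda>z. A (x z) (w z)) (A (x z) (w z)) (atin Z z)"
    using w z by (intro A_limit) (auto simp: continuous_map_atin)
qed

text \<open>
  The difference quotients of \<open>\<psi>\<close> are bounded by the Lipschitz estimate, so the error of strict
  differentiability of \<open>\<phi>\<close> at \<open>\<psi> y\<close> stays small after division by \<open>t\<close>, and the derivative at \<open>\<psi> y\<close> maps
  the quotient close to \<open>v\<close>.
\<close>

lemma \<psi>_deriv:
  assumes y: "y \<in> \<Omega>'" and v: "v \<in> topspace X"
  shows "has_dir_deriv X \<psi> y v (A (\<psi> y) v)"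
  unfolding has_dir_deriv_def norm_on_limitin_iff[OF n]
proof (intro conjI allI impI)
  let ?x = "\<psi> y"
  have x: "?x \<in> \<Omega>" using \<psi>[OF y] .
  show a: "A ?x v \<in> topspace X" by (rule A_in[OF x v])
  fix e :: real assume e: "e > 0"
  have nv: "n v \<ge> 0" using norm_on_nonneg[OF n v] .
  \<comment> \<open>Two factors \<open>2\<close>, one from the Lipschitz bound for \<open>\<psi>\<close> and one from inverting the derivative,
    multiply the error \<open>c * n v\<close>.\<close>
  define c where "c = e / (4 * n v + 1)"
  have c: "c > 0" unfolding c_def using e nv by (intro divide_pos_pos) auto
  obtain d where d: "d > 0" and "{x \<in> topspace X. n (x - ?x) < d} \<subseteq> \<Omega>"
    and "\<And>x v. x \<in> topspace X \<Longrightarrow> n (x - ?x) < d \<Longrightarrow> v \<in> topspace X \<Longrightarrow>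
       n (dir_deriv X \<phi> x v - dir_deriv X \<phi> ?x v) \<le> c * n v"
    and strict: "\<And>x y. x \<in> topspace X \<Longrightarrow> n (x - ?x) < d \<Longrightarrow> y \<in> topspace X \<Longrightarrow> n (y - ?x) < d \<Longrightarrow>
       n (\<phi> x - \<phi> y - dir_deriv X \<phi> ?x (x - y)) \<le> c * n (x - y)"
    by (rule smooth_strict_derivative[OF n n smooth x c], rule that)
  have "d / (2 * n v + 1) > 0" using d nv by (intro divide_pos_pos) auto
  then have "\<forall>\<^sub>F t in at (0::real). t \<noteq> 0 \<and> \<bar>t\<bar> < d / (2 * n v + 1)"
    unfolding eventually_at by (intro exI[of _ "d / (2 * n v + 1)"]) (auto simp: dist_real_def)
  with eventually_line_in[OF X \<Omega>' y v]
  show "\<forall>\<^sub>F t in at 0. (\<psi> (y + t *\<^sub>R v) - ?x) /\<^sub>R t \<in> topspace X \<and> n ((\<psi> (y + t *\<^sub>R v) - ?x) /\<^sub>R t - A ?x v) < e"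
  proof eventually_elim
    case (elim t)
    let ?z = "\<psi> (y + t *\<^sub>R v)"
    have z: "?z \<in> \<Omega>" using \<psi> elim by auto
    have zx: "?z - ?x \<in> topspace X" using \<Omega>X[OF z] \<Omega>X[OF x] subspace_diff[OF sub] by auto
    have q: "(?z - ?x) /\<^sub>R t \<in> topspace X" using zx subspace_scale[OF sub] by auto
    have tv: "\<phi> ?z - \<phi> ?x = t *\<^sub>R v" using \<phi>\<psi> elim y by auto
    have nzx: "n (?z - ?x) \<le> 2 * (\<bar>t\<bar> * n v)"
      using lipschitz[OF z x] norm_on_scale[OF n v] tv by auto
    have "\<bar>t\<bar> * (2 * n v) \<le> \<bar>t\<bar> * (2 * n v + 1)" by (intro mult_left_mono) auto
    also have "\<dots> < d" using elim nv by (simp add: pos_less_divide_eq)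
    finally have "n (?z - ?x) < d" using nzx by simp
    then have s: "n (\<phi> ?z - \<phi> ?x - dir_deriv X \<phi> ?x (?z - ?x)) \<le> c * n (?z - ?x)"
      using strict[of ?z ?x] \<Omega>X[OF z] \<Omega>X[OF x] d norm_on_zero[OF n] by auto
    define D where "D = dir_deriv X \<phi> ?x (?z - ?x)"
    have DX: "D \<in> topspace X" unfolding D_def by (rule deriv_in[OF x zx])
    have "dir_deriv X \<phi> ?x ((?z - ?x) /\<^sub>R t - A ?x v) = D /\<^sub>R t - v"
      unfolding D_def using linear_map_on_diff[OF linear_deriv[OF x] sub q a] A[OF x v]
        linear_map_on_scale[OF linear_deriv[OF x] zx] by simp
    also have "\<dots> = (- inverse t) *\<^sub>R (t *\<^sub>R v - D)"
      using elim by (simp add: scaleR_diff_right)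
    finally have "n (dir_deriv X \<phi> ?x ((?z - ?x) /\<^sub>R t - A ?x v)) = \<bar>inverse t\<bar> * n (t *\<^sub>R v - D)"
      using norm_on_scale[OF n, of "t *\<^sub>R v - D" "- inverse t"] DX v subspace_diff[OF sub] subspace_scale[OF sub] by auto
    also have "\<dots> \<le> \<bar>inverse t\<bar> * (c * (2 * (\<bar>t\<bar> * n v)))"
      using order_trans[OF s[unfolded tv, folded D_def] mult_left_mono[OF nzx, of c]] c
      by (intro mult_left_mono) auto
    also have "\<dots> = (\<bar>inverse t\<bar> * \<bar>t\<bar>) * (c * (2 * n v))" by (simp only: ac_simps)
    also have "\<bar>inverse t\<bar> * \<bar>t\<bar> = 1" using elim by (simp flip: abs_mult)
    finally have "n ((?z - ?x) /\<^sub>R t - A ?x v) \<le> 2 * (1 * (c * (2 * n v)))"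
      using lower[OF x subspace_diff[OF sub q a]] by linarith
    also have "\<dots> = e * (4 * n v) / (4 * n v + 1)" by (simp add: c_def)
    also have "\<dots> < e"
    proof -
      have "4 * n v + 1 > 0" using nv by linarith
      then show ?thesis using e by (simp add: pos_divide_less_eq)
    qed
    finally show ?case using q by auto
  qed
qed

text \<open>
  Differentiate the identity \<open>D\<phi> (\<psi> y) (A (\<psi> y) (W y)) = W y\<close> and solve for the derivative of
  \<open>A (\<psi> y) (W y)\<close>.
\<close>

lemma A_deriv:
  assumes y: "y \<in> \<Omega>'" and v: "v \<in> topspace X" and W: "has_dir_deriv X W y v W'" and Wy: "W y \<in> topspace X"
  shows "has_dir_deriv X (\<lambda>y. A (\<psi> y) (W y)) y v
    (A (\<psi> y) (W' - iter_deriv X \<phi> (Suc (Suc 0)) ((\<lambda>_. A (\<psi> y) (W y))(Suc 0 := A (\<psi> y) v)) (\<psi> y)))"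
proof -
  let ?x = "\<psi> y" let ?a = "A ?x (W y)"
  have x: "?x \<in> \<Omega>" using \<psi>[OF y] .
  have a: "?a \<in> topspace X" by (rule A_in[OF x Wy])
  have zX: "0 \<in> topspace X" using subspace_0[OF sub] .
  have "has_dir_deriv X (\<lambda>z. iter_deriv X \<phi> (Suc 0) (\<lambda>_. ?a) (\<psi> z)) y v
     (iter_deriv X \<phi> (Suc (Suc 0)) ((\<lambda>_. ?a)(Suc 0 := A ?x v)) ?x
      + (\<Sum>i<Suc 0. iter_deriv X \<phi> (Suc 0) ((\<lambda>_. ?a)(i := 0)) ?x))"
    by (rule has_dir_deriv_iter_deriv[OF X X smooth \<psi>_deriv[OF y v] x])
      (use a zX in \<open>auto intro: has_dir_deriv_const\<close>)
  moreover have "dir_deriv X \<phi> ?x 0 = 0" using linear_map_on_zero[OF linear_deriv[OF x] sub] .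
  ultimately have C: "has_dir_deriv X (\<lambda>z. dir_deriv X \<phi> (\<psi> z) ?a) y v
     (iter_deriv X \<phi> (Suc (Suc 0)) ((\<lambda>_. ?a)(Suc 0 := A ?x v)) ?x)" by simp
  have "limitin X (\<lambda>t. A (\<psi> (y + t *\<^sub>R v)) ((W (y + t *\<^sub>R v) - W y) /\<^sub>R t
        - (dir_deriv X \<phi> (\<psi> (y + t *\<^sub>R v)) ?a - dir_deriv X \<phi> ?x ?a) /\<^sub>R t))
     (A ?x (W' - iter_deriv X \<phi> (Suc (Suc 0)) ((\<lambda>_. ?a)(Suc 0 := A ?x v)) ?x)) (at 0)"
    by (intro A_limit has_dir_deriv_limit[OF X \<psi>_deriv[OF y v] \<Omega>X[OF x]] x limitin_diff[OF X]
        W[unfolded has_dir_deriv_def] C[unfolded has_dir_deriv_def])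
  then show ?thesis unfolding has_dir_deriv_def
  proof (rule limitin_transform_eventually[rotated])
    from eventually_line_in[OF X \<Omega>' y v] limitin_eventually_topspace[OF has_dir_deriv_limit[OF X W Wy]]
    show "\<forall>\<^sub>F t in at 0. A (\<psi> (y + t *\<^sub>R v)) ((W (y + t *\<^sub>R v) - W y) /\<^sub>R t
        - (dir_deriv X \<phi> (\<psi> (y + t *\<^sub>R v)) ?a - dir_deriv X \<phi> ?x ?a) /\<^sub>R t)
        = (A (\<psi> (y + t *\<^sub>R v)) (W (y + t *\<^sub>R v)) - A (\<psi> y) (W y)) /\<^sub>R t"
    proof eventually_elim
      case (elim t)
      let ?z = "\<psi> (y + t *\<^sub>R v)"
      have z: "?z \<in> \<Omega>" using \<psi> elim by auto
      have D: "dir_deriv X \<phi> ?z ?a \<in> topspace X" by (rule deriv_in[OF z a])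
      have "A ?z ((W (y + t *\<^sub>R v) - W y) /\<^sub>R t - (dir_deriv X \<phi> ?z ?a - dir_deriv X \<phi> ?x ?a) /\<^sub>R t)
         = A ?z (inverse t *\<^sub>R (W (y + t *\<^sub>R v) - dir_deriv X \<phi> ?z ?a))"
        using A[OF x Wy] by (simp add: algebra_simps)
      also have "\<dots> = inverse t *\<^sub>R (A ?z (W (y + t *\<^sub>R v)) - ?a)"
        using linear_map_on_scale[OF A_linear[OF z]] linear_map_on_diff[OF A_linear[OF z] sub elim(2) D]
          subspace_diff[OF sub elim(2) D] A_deriv_cancel[OF z a] by simp
      finally show ?case .
    qed
  qed
qed

lemma \<psi>_continuous: "continuous_map (subtopology X \<Omega>') (subtopology X \<Omega>) \<psi>"
proof -
  have "continuous_map (subtopology X \<Omega>') X \<psi>"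
    unfolding continuous_map_atin
  proof
    fix y assume "y \<in> topspace (subtopology X \<Omega>')"
    then have y: "y \<in> \<Omega>'" by auto
    let ?F = "atin (subtopology X \<Omega>') y"
    have id: "limitin (subtopology X \<Omega>') (\<lambda>z. z) y ?F"
      using limitin_continuous_map[of "subtopology X \<Omega>'" "subtopology X \<Omega>'" "\<lambda>z. z" y y] y \<Omega>'X by auto
    then have idX: "limitin X (\<lambda>z. z) y ?F" and ev: "\<forall>\<^sub>F z in ?F. z \<in> \<Omega>'"
      by (auto simp: limitin_subtopology)
    have "limitin X (\<lambda>_. y) y ?F" using \<Omega>'X[OF y] by simp
    from limitin_diff[OF X idX this]
    have lim: "limitin X (\<lambda>z. z - y) 0 ?F" by simp
    show "limitin X \<psi> (\<psi> y) ?F"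
    proof (rule limitin_norm_bound[OF n n \<Omega>X[OF \<psi>[OF y]] lim, where c = 2])
      show "\<forall>\<^sub>F z in ?F. \<psi> z \<in> topspace X \<and> n (\<psi> z - \<psi> y) \<le> 2 * n (z - y)"
        using ev
      proof eventually_elim
        case (elim z)
        then show ?case using lipschitz[OF \<psi>[OF elim] \<psi>[OF y]] \<Omega>X[OF \<psi>[OF elim]] \<phi>\<psi>[OF elim] \<phi>\<psi>[OF y] by simp
      qed
    qed
  qed
  then show ?thesis using \<psi> by (auto simp: continuous_map_in_subtopology)
qed

lemma inverse_term_continuous:
  assumes "inverse_term X \<phi> \<psi> A H"
  shows "continuous_map (prod_topology (subtopology X \<Omega>') (product_topology (\<lambda>_::nat. X) UNIV)) X (\<lambda>q. H (snd q) (fst q))"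
    (is "continuous_map ?Q X _")
proof -
  have zX: "0 \<in> topspace X" using subspace_0[OF sub] .
  have fq: "continuous_map ?Q (subtopology X \<Omega>) (\<lambda>q. \<psi> (fst q))"
    using continuous_map_compose[OF continuous_map_fst \<psi>_continuous] by (simp add: o_def)
  show ?thesis
    using assms
  proof (induction rule: inverse_term.induct)
    case self show ?case using fq by (auto simp: continuous_map_in_subtopology)
  next
    case zero show ?case using zX by auto
  next
    case (add H H') show ?case by (rule continuous_map_add[OF X add.IH])
  next
    case (minus H) show ?case
      using continuous_map_diff[OF X _ minus.IH, of "\<lambda>_. 0"] zX by auto
  next
    case (direction i) show ?case by (rule A_continuous[OF fq continuous_map_direction])
  next
    case (node j w) show ?case
      by (intro A_continuous[OF fq] smooth_iter_deriv_continuous[OF smooth fq] node.IH)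
  qed
qed

lemma inverse_term_topspace:
  assumes H: "inverse_term X \<phi> \<psi> A H" and y: "y \<in> \<Omega>'" and v: "\<forall>i. v i \<in> topspace X"
  shows "H v y \<in> topspace X"
proof -
  have "(y, v) \<in> topspace (prod_topology (subtopology X \<Omega>') (product_topology (\<lambda>_::nat. X) UNIV))"
    using y v \<Omega>'X[OF y] by auto
  from subsetD[OF continuous_map_image_subset_topspace[OF inverse_term_continuous[OF H]] imageI[OF this]]
  show ?thesis by simp
qed

lemma inverse_term_derivative:
  assumes "inverse_term X \<phi> \<psi> A H"
  shows "\<exists>H'. inverse_term X \<phi> \<psi> A H' \<and> (\<forall>v y. (\<forall>i. v i \<in> topspace X) \<longrightarrow> y \<in> \<Omega>' \<longrightarrow>
        has_dir_deriv X (H v) y (v k) (H' v y))"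
proof -
  have zX: "0 \<in> topspace X" using subspace_0[OF sub] .
  \<comment> \<open>\<open>B H\<close> is the correction term that stems from the motion of the base point \<open>\<psi> y\<close>.\<close>
  define B where "B H v y = A (\<psi> y) (iter_deriv X \<phi> (Suc (Suc 0)) (\<lambda>i. (if i = Suc 0 then (\<lambda>v y. A (\<psi> y) (v k)) else H) v y) (\<psi> y))"
    for H v y
  have B: "inverse_term X \<phi> \<psi> A (B H)" if "inverse_term X \<phi> \<psi> A H" for H
    unfolding B_def by (rule inverse_term.node) (use that inverse_term.direction in auto)
  have B_eq: "B H v y = A (\<psi> y) (iter_deriv X \<phi> (Suc (Suc 0)) ((\<lambda>_. H v y)(Suc 0 := A (\<psi> y) (v k))) (\<psi> y))" for H v y
  proof -
    have "(\<lambda>i. (if i = Suc 0 then (\<lambda>v y. A (\<psi> y) (v k)) else H) v y) = (\<lambda>_::nat. H v y)(Suc 0 := A (\<psi> y) (v k))"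
      by (simp add: fun_eq_iff)
    then show ?thesis unfolding B_def by (simp only:)
  qed
  have D2: "iter_deriv X \<phi> (Suc (Suc 0)) ((\<lambda>_. a)(Suc 0 := b)) x \<in> topspace X"
    if "x \<in> \<Omega>" "a \<in> topspace X" "b \<in> topspace X" for a b x
    by (rule smooth_iter_deriv_topspace[OF smooth that(1)]) (use that in auto)
  show ?thesis
    using assms
  proof (induction rule: inverse_term.induct)
    case self
    show ?case using inverse_term.direction \<psi>_deriv by blast
  next
    case zero
    show ?case using inverse_term.zero has_dir_deriv_const[of 0 X] zX by fastforce
  next
    case (add H1 H2)
    then obtain H1' H2' where "inverse_term X \<phi> \<psi> A H1'" "inverse_term X \<phi> \<psi> A H2'"
      "\<And>v x. (\<forall>i. v i \<in> topspace X) \<Longrightarrow> x \<in> \<Omega>' \<Longrightarrow> has_dir_deriv X (H1 v) x (v k) (H1' v x)"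
      "\<And>v x. (\<forall>i. v i \<in> topspace X) \<Longrightarrow> x \<in> \<Omega>' \<Longrightarrow> has_dir_deriv X (H2 v) x (v k) (H2' v x)"
      by blast
    then show ?case
      by (intro exI[of _ "\<lambda>v x. H1' v x + H2' v x"]) (auto intro: inverse_term.add has_dir_deriv_add[OF X])
  next
    case (minus H)
    then obtain H' where "inverse_term X \<phi> \<psi> A H'"
      and H': "\<And>v x. (\<forall>i. v i \<in> topspace X) \<Longrightarrow> x \<in> \<Omega>' \<Longrightarrow> has_dir_deriv X (H v) x (v k) (H' v x)"
      by blast
    moreover have "has_dir_deriv X (\<lambda>y. - H v y) y (v k) (- H' v y)" if "\<forall>i. v i \<in> topspace X" "y \<in> \<Omega>'" for v y
      using has_dir_deriv_scaleR[OF X H'[OF that], of "-1"] by simp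
    ultimately show ?case by (intro exI[of _ "\<lambda>v x. - H' v x"]) (auto intro: inverse_term.minus)
  next
    case (direction i)
    let ?H = "\<lambda>v y. A (\<psi> y) (v i)"
    have T: "inverse_term X \<phi> \<psi> A (\<lambda>v y. - B ?H v y)"
      by (intro inverse_term.minus B inverse_term.direction)
    have "has_dir_deriv X (?H v) y (v k) (- B ?H v y)" if v: "\<forall>i. v i \<in> topspace X" and y: "y \<in> \<Omega>'" for v y
    proof -
      have vX: "v i \<in> topspace X" "v k \<in> topspace X" using v by auto
      have x: "\<psi> y \<in> \<Omega>" by (rule \<psi>[OF y])
      have "has_dir_deriv X (\<lambda>_. v i) y (v k) 0" using has_dir_deriv_const[of "v i" X] zX by simp
      from A_deriv[OF y vX(2) this vX(1)]
      show ?thesis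
        unfolding B_eq using linear_map_on_minus[OF A_linear[OF x] D2[OF x A_in[OF x vX(1)] A_in[OF x vX(2)]]]
        by (simp del: iter_deriv.simps)
    qed
    with T show ?case by blast
  next
    case (node j w)
    let ?H = "\<lambda>v y. A (\<psi> y) (iter_deriv X \<phi> j (\<lambda>i. w i v y) (\<psi> y))"
    have "\<forall>i. \<exists>w'. i < j \<longrightarrow> inverse_term X \<phi> \<psi> A w' \<and> (\<forall>v y. (\<forall>i. v i \<in> topspace X) \<longrightarrow> y \<in> \<Omega>' \<longrightarrow>
        has_dir_deriv X (w i v) y (v k) (w' v y))"
      using node.IH by blast
    then obtain w' where w'T: "\<And>i. i < j \<Longrightarrow> inverse_term X \<phi> \<psi> A (w' i)"
      and w': "\<And>i v y. i < j \<Longrightarrow> \<forall>i. v i \<in> topspace X \<Longrightarrow> y \<in> \<Omega>' \<Longrightarrow> has_dir_deriv X (w i v) y (v k) (w' i v y)"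
      by (subst (asm) choice_iff) blast
    define u where "u = w(j := \<lambda>v y. A (\<psi> y) (v k))"
    define z where "z i = w(i := w' i)" for i
    define C1 where "C1 v y = iter_deriv X \<phi> (Suc j) (\<lambda>l. u l v y) (\<psi> y)" for v y
    define C2 where "C2 i v y = iter_deriv X \<phi> j (\<lambda>l. z i l v y) (\<psi> y)" for i v y
    define H' where "H' v y = A (\<psi> y) (C1 v y) + (\<Sum>i<j. A (\<psi> y) (C2 i v y)) + - B ?H v y" for v y
    have uT: "inverse_term X \<phi> \<psi> A (u i)" if "i < Suc j" for i
      using that node.hyps inverse_term.direction by (auto simp: u_def)
    have zT: "inverse_term X \<phi> \<psi> A (z i l)" if "i < j" "l < j" for i l
      using that node.hyps w'T by (auto simp: z_def)
    have "inverse_term X \<phi> \<psi> A H'"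
      unfolding H'_def C1_def C2_def
      by (intro inverse_term.add inverse_term_sum inverse_term.minus B inverse_term.node) (auto intro: uT zT node.hyps)
    moreover have "has_dir_deriv X (?H v) y (v k) (H' v y)" if v: "\<forall>i. v i \<in> topspace X" and y: "y \<in> \<Omega>'" for v y
    proof -
      have vk: "v k \<in> topspace X" using v by auto
      have x: "\<psi> y \<in> \<Omega>" by (rule \<psi>[OF y])
      have wX: "w i v y \<in> topspace X" if "i < j" for i
        by (rule inverse_term_topspace[OF _ y v]) (use node.hyps that in auto)
      have W: "iter_deriv X \<phi> j (\<lambda>i. w i v y) (\<psi> y) \<in> topspace X"
        by (rule smooth_iter_deriv_topspace[OF smooth x wX])
      have C1X: "C1 v y \<in> topspace X"
        unfolding C1_def by (rule smooth_iter_deriv_topspace[OF smooth x inverse_term_topspace[OF uT y v]])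
      have C2X: "C2 i v y \<in> topspace X" if "i < j" for i
        unfolding C2_def by (rule smooth_iter_deriv_topspace[OF smooth x inverse_term_topspace[OF zT[OF that] y v]])
      have e1: "(\<lambda>i. w i v y)(j := A (\<psi> y) (v k)) = (\<lambda>l. u l v y)" by (simp add: u_def fun_eq_iff)
      have e2: "(\<lambda>l. w l v y)(i := w' i v y) = (\<lambda>l. z i l v y)" for i by (simp add: z_def fun_eq_iff)
      have "has_dir_deriv X (\<lambda>y. iter_deriv X \<phi> j (\<lambda>i. w i v y) (\<psi> y)) y (v k) (C1 v y + (\<Sum>i<j. C2 i v y))"
        unfolding C1_def C2_def e1[symmetric] e2[symmetric]
        by (rule has_dir_deriv_iter_deriv[OF X X smooth \<psi>_deriv[OF y vk] x]) (use w'[OF _ v y] wX in auto)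
      from A_deriv[OF y vk this W]
      have "has_dir_deriv X (?H v) y (v k) (A (\<psi> y) (C1 v y + (\<Sum>i<j. C2 i v y) -
           iter_deriv X \<phi> (Suc (Suc 0)) ((\<lambda>_. ?H v y)(Suc 0 := A (\<psi> y) (v k))) (\<psi> y)))"
        by (simp del: iter_deriv.simps)
      also have "A (\<psi> y) (C1 v y + (\<Sum>i<j. C2 i v y) -
           iter_deriv X \<phi> (Suc (Suc 0)) ((\<lambda>_. ?H v y)(Suc 0 := A (\<psi> y) (v k))) (\<psi> y)) = H' v y"
      proof -
        have S: "(\<Sum>i<j. C2 i v y) \<in> topspace X" by (rule subspace_sum[OF sub]) (use C2X in auto)
        note lin = A_linear[OF x]
        show ?thesis
          unfolding H'_def B_eq
          using linear_map_on_diff[OF lin sub subspace_add[OF sub C1X S] D2[OF x A_in[OF x W] A_in[OF x vk]]]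
            linear_map_on_add[OF lin C1X S] linear_map_on_sum[OF lin sub, of "{..<j}" "\<lambda>i. C2 i v y"] C2X
          by (simp del: iter_deriv.simps)
      qed
      finally show ?thesis .
    qed
    ultimately show ?case by blast
  qed
qed

lemma \<psi>_smooth: "smooth_map_on X \<Omega>' X \<psi>"
proof (rule smooth_map_onI_family[OF X X \<Omega>', where \<H> = "inverse_term X \<phi> \<psi> A" and ?H0.0 = "\<lambda>v y. \<psi> y"])
  show "inverse_term X \<phi> \<psi> A (\<lambda>v y. \<psi> y)" by (rule inverse_term.self)
  show "\<exists>H'. inverse_term X \<phi> \<psi> A H' \<and> (\<forall>v x. (\<forall>i. v i \<in> topspace X) \<longrightarrow> x \<in> \<Omega>' \<longrightarrow>
        has_dir_deriv X (H v) x (v k) (H' v x))" if "inverse_term X \<phi> \<psi> A H" for H k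
    by (rule inverse_term_derivative[OF that])
  show "continuous_map (prod_topology (subtopology X \<Omega>') (product_topology (\<lambda>_. X) UNIV)) X (\<lambda>(x, v). H v x)"
    if "inverse_term X \<phi> \<psi> A H" for H
    using inverse_term_continuous[OF that] by (simp add: case_prod_unfold)
qed (rule refl)

end

lemma contraction_fixed_point:
  assumes n: "norm_on X n" and complete: "Metric_space.mcomplete (topspace X) (\<lambda>x y. n (x - y))"
    and S: "closedin X S" "a \<in> S" and G: "\<And>x. x \<in> S \<Longrightarrow> G x \<in> S"
    and contr: "\<And>x y. x \<in> S \<Longrightarrow> y \<in> S \<Longrightarrow> n (G x - G y) \<le> 1/2 * n (x - y)"
  shows "\<exists>x\<in>S. G x = x"
proof -
  note sub = norm_on_imp_subspace[OF n]
  have SX: "x \<in> topspace X" if "x \<in> S" for x using S(1) that closedin_subset by blast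
  define x where "x k = (G ^^ k) a" for k
  have xS: "x k \<in> S" for k by (induction k) (auto simp: x_def S G)
  have xSuc: "x (Suc k) = G (x k)" for k by (simp add: x_def)
  have xX: "x k \<in> topspace X" for k using SX xS by auto
  define D where "D = n (x 1 - x 0)"
  have D: "D \<ge> 0" unfolding D_def using norm_on_nonneg[OF n] subspace_diff[OF sub] xX by auto
  \<comment> \<open>The iterates form a Cauchy sequence by comparison with a geometric series.\<close>
  have step: "n (x (Suc k) - x k) \<le> (1/2) ^ k * D" for k
  proof (induction k)
    case (Suc k)
    have "n (x (Suc (Suc k)) - x (Suc k)) \<le> 1/2 * n (x (Suc k) - x k)"
      unfolding xSuc[of "Suc k"] xSuc[of k] using contr[OF G[OF xS] xS] by (simp add: xSuc)
    also have "\<dots> \<le> 1/2 * ((1/2) ^ k * D)" using Suc by simp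
    finally show ?case by simp
  qed (simp add: D_def)
  have cauchy: "n (x (k + j) - x k) \<le> 2 * D * (1/2) ^ k * (1 - (1/2) ^ j)" for k j
  proof (induction j)
    case (Suc j)
    have "n (x (k + Suc j) - x k) \<le> n (x (Suc (k + j)) - x (k + j)) + n (x (k + j) - x k)"
      using norm_on_triangle[OF n xX xX xX] by simp
    also have "\<dots> \<le> (1/2) ^ (k + j) * D + 2 * D * (1/2) ^ k * (1 - (1/2) ^ j)"
      using Suc step[of "k + j"] by linarith
    also have "\<dots> = 2 * D * (1/2) ^ k * (1 - (1/2) ^ Suc j)" by (simp add: power_add algebra_simps)
    finally show ?case .
  qed (simp add: norm_on_zero[OF n])
  have bound: "n (x l - x k) \<le> 2 * D * (1/2) ^ k" if "k \<le> l" for k l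
  proof -
    have "2 * D * (1/2) ^ k * (1 - (1/2) ^ (l - k)) \<le> 2 * D * (1/2) ^ k * 1"
      using D by (intro mult_left_mono) auto
    then show ?thesis using cauchy[of k "l - k"] that by simp
  qed
  interpret Metric_space "topspace X" "\<lambda>x y. n (x - y)" by (rule norm_on_Metric_space[OF n])
  have "MCauchy x" unfolding MCauchy_def
  proof (intro conjI allI impI)
    show "range x \<subseteq> topspace X" using xX by auto
    fix e :: real assume e: "e > 0"
    have "(\<lambda>k. 2 * D * (1/2) ^ k) \<longlonglongrightarrow> 2 * D * 0"
      by (intro tendsto_mult_left LIMSEQ_realpow_zero) auto
    then have "\<forall>\<^sub>F k in sequentially. 2 * D * (1/2) ^ k < e" using e order_tendstoD(2) by fastforce
    then obtain N where N: "\<And>k. k \<ge> N \<Longrightarrow> 2 * D * (1/2) ^ k < e" by (auto simp: eventually_sequentially)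
    show "\<exists>N. \<forall>k k'. N \<le> k \<longrightarrow> N \<le> k' \<longrightarrow> n (x k - x k') < e"
    proof (intro exI[of _ N] allI impI)
      fix k k' assume "N \<le> k" "N \<le> k'"
      then show "n (x k - x k') < e"
        using bound[of k' k] bound[of k k'] N[of k] N[of k'] norm_on_diff_commute[OF n xX[of k] xX[of k']]
        by (cases "k \<le> k'") auto
    qed
  qed
  then obtain l where "limitin mtopology x l sequentially" using complete unfolding mcomplete_def by blast
  then have l: "limitin X x l sequentially" unfolding norm_on_mtopology[OF n] .
  have lX: "l \<in> topspace X" using limitin_topspace[OF l] .
  have lS: "l \<in> S"
  proof (rule ccontr)
    assume "l \<notin> S"
    moreover have "openin X (topspace X - S)" using S(1) by (simp add: openin_diff)
    ultimately have "\<forall>\<^sub>F k in sequentially. x k \<in> topspace X - S" using lX by (intro limitinD[OF l]) auto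
    then show False using xS by (auto simp: eventually_sequentially)
  qed
  have "limitin X (\<lambda>k. x k - l) (l - l) sequentially" using l lX by (intro limitin_diff[OF norm_on_imp_normable[OF n]]) auto
  then have "limitin X (\<lambda>k. x k - l) 0 sequentially" by simp
  then have "limitin X (\<lambda>k. x (Suc k)) (G l) sequentially"
    by (rule limitin_norm_bound[OF n n SX[OF G[OF lS]], where c = "1/2"])
      (use contr[OF xS lS] SX[OF G[OF xS]] in \<open>auto simp: xSuc\<close>)
  moreover have "limitin X (\<lambda>k. x (Suc k)) l sequentially" using limitin_sequentially_offset[OF l, of 1] by simp
  ultimately have "G l = l"
    by (rule normable_limitin_unique[OF norm_on_imp_normable[OF n] _ _ trivial_limit_sequentially])
  then show ?thesis using lS by auto
qed

lemma norm_on_closedin_cball: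
  assumes n: "norm_on X n"
  shows "closedin X {x \<in> topspace X. n x \<le> r}"
proof -
  have "closedin X {x \<in> topspace X. n x \<in> {..r}}"
    by (rule closedin_continuous_map_preimage[OF continuous_map_norm[OF n]]) auto
  then show ?thesis by simp
qed

text \<open>
  By strict differentiability \<open>\<phi>\<close> differs from the identity by a contraction with factor \<open>1/2\<close> on a
  ball.  Hence \<open>\<phi>\<close> shrinks distances by at most the factor \<open>1/2\<close>, the equation \<open>\<phi> x = y\<close> is a fixed point problem for
  \<open>x \<mapsto> y - (\<phi> x - x)\<close>, and the derivatives of \<open>\<phi>\<close>, which are as close to the identity as \<open>\<phi>\<close> is, can be
  inverted in the same way.
\<close>

theorem inverse_function_theorem:
  assumes n: "norm_on X n" and complete: "Metric_space.mcomplete (topspace X) (\<lambda>x y. n (x - y))"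
    and \<phi>: "smooth_map_on X W X \<phi>" and W: "0 \<in> W" and \<phi>0: "\<phi> 0 = 0"
    and D\<phi>: "\<And>v. v \<in> topspace X \<Longrightarrow> dir_deriv X \<phi> 0 v = v"
  obtains \<Omega> \<Omega>' \<psi> where "0 \<in> \<Omega>" "\<Omega> \<subseteq> W" "diffeo_on X \<Omega> X \<Omega>' \<phi> \<psi>"
proof -
  note X = norm_on_imp_normable[OF n] note sub = normable_subspace[OF X]
  have zX: "0 \<in> topspace X" using subspace_0[OF sub] .
  obtain d where d: "d > 0" "{x \<in> topspace X. n (x - 0) < d} \<subseteq> W"
    and est1: "\<And>x v. x \<in> topspace X \<Longrightarrow> n (x - 0) < d \<Longrightarrow> v \<in> topspace X \<Longrightarrow>
       n (dir_deriv X \<phi> x v - dir_deriv X \<phi> 0 v) \<le> 1/2 * n v"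
    and est2: "\<And>x y. x \<in> topspace X \<Longrightarrow> n (x - 0) < d \<Longrightarrow> y \<in> topspace X \<Longrightarrow> n (y - 0) < d \<Longrightarrow>
       n (\<phi> x - \<phi> y - dir_deriv X \<phi> 0 (x - y)) \<le> 1/2 * n (x - y)"
    by (rule smooth_strict_derivative[OF n n \<phi> W, where e = "1/2"], simp, rule that)
  have contr: "n (\<phi> x - \<phi> y - (x - y)) \<le> 1/2 * n (x - y)"
    if "x \<in> topspace X" "n x < d" "y \<in> topspace X" "n y < d" for x y
    using est2[of x y] that D\<phi>[of "x - y"] subspace_diff[OF sub] by auto
  have \<phi>X: "\<phi> x \<in> topspace X" if "x \<in> topspace X" "n x < d" for x
    using smooth_map_on_topspace[OF \<phi>, of x] d(2) that by auto
  have lower: "n x \<le> 2 * n w" if "x \<in> topspace X" "w \<in> topspace X" "n (w - x) \<le> 1/2 * n x" for x w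
  proof -
    have "n x \<le> n (x - w) + n w" using norm_on_add[OF n subspace_diff[OF sub that(1,2)] that(2)] by simp
    then show ?thesis using that norm_on_diff_commute[OF n that(1,2)] by simp
  qed
  define B where "B = {x \<in> topspace X. n (x - 0) < d}"
  define \<Omega>' where "\<Omega>' = {x \<in> topspace X. n (x - 0) < d / 2}"
  define \<Omega> where "\<Omega> = {x \<in> B. \<phi> x \<in> \<Omega>'}"
  have openB: "openin X B" and open': "openin X \<Omega>'"
    unfolding B_def \<Omega>'_def by (rule norm_on_openin_ball[OF n zX])+
  have BW: "B \<subseteq> W" using d(2) by (simp add: B_def)
  have \<phi>B: "smooth_map_on X B X \<phi>" by (rule smooth_map_on_subset_cong[OF X X \<phi> openB BW]) simp
  have "openin (subtopology X B) {x \<in> topspace (subtopology X B). \<phi> x \<in> \<Omega>'}"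
    by (rule openin_continuous_map_preimage[OF smooth_map_on_continuous_map[OF \<phi>B] open'])
  moreover have "{x \<in> topspace (subtopology X B). \<phi> x \<in> \<Omega>'} = \<Omega>" by (auto simp: \<Omega>_def B_def)
  ultimately have open\<Omega>: "openin X \<Omega>" using openB openin_trans_full by metis
  have \<Omega>D: "x \<in> topspace X" "n x < d" "\<phi> x \<in> \<Omega>'" if "x \<in> \<Omega>" for x using that by (auto simp: \<Omega>_def B_def)
  have \<phi>\<Omega>: "smooth_map_on X \<Omega> X \<phi>"
    by (rule smooth_map_on_subset_cong[OF X X \<phi>B open\<Omega>]) (auto simp: \<Omega>_def)
  have lip: "n (x - y) \<le> 2 * n (\<phi> x - \<phi> y)" if "x \<in> \<Omega>" "y \<in> \<Omega>" for x y
    by (rule lower) (use that \<Omega>D contr \<phi>X subspace_diff[OF sub] in auto)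
  have surj: "\<exists>x\<in>\<Omega>. \<phi> x = y" if y: "y \<in> \<Omega>'" for y
  proof -
    have yX: "y \<in> topspace X" and ny: "2 * n y < d" using y by (auto simp: \<Omega>'_def)
    have ny0: "n y \<ge> 0" by (rule norm_on_nonneg[OF n yX])
    \<comment> \<open>The fixed point map sends the closed ball of radius \<open>2 * n y\<close> into itself.\<close>
    define S where "S = {x \<in> topspace X. n x \<le> 2 * n y}"
    have SD: "x \<in> topspace X" "n x < d" "n x \<le> 2 * n y" if "x \<in> S" for x using that ny by (auto simp: S_def)
    have "\<exists>x\<in>S. y - (\<phi> x - x) = x"
    proof (rule contraction_fixed_point[OF n complete])
      show "closedin X S" unfolding S_def by (rule norm_on_closedin_cball[OF n])
      show "0 \<in> S" using zX ny0 norm_on_zero[OF n] by (auto simp: S_def)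
      fix x assume x: "x \<in> S"
      have px: "\<phi> x - x \<in> topspace X" using \<phi>X SD[OF x] subspace_diff[OF sub] by auto
      have "n (\<phi> x - x) \<le> 1/2 * n x"
        using contr[of x 0] SD[OF x] zX d norm_on_zero[OF n] \<phi>0 by simp
      then have "n (y - (\<phi> x - x)) \<le> 2 * n y" using norm_on_diff[OF n yX px] SD[OF x] by linarith
      then show "y - (\<phi> x - x) \<in> S" using subspace_diff[OF sub yX px] by (simp add: S_def)
      fix x' assume x': "x' \<in> S"
      have "y - (\<phi> x - x) - (y - (\<phi> x' - x')) = - (\<phi> x - \<phi> x' - (x - x'))" by simp
      then have "n (y - (\<phi> x - x) - (y - (\<phi> x' - x'))) = n (\<phi> x - \<phi> x' - (x - x'))"
        using norm_on_minus[OF n, of "\<phi> x - \<phi> x' - (x - x')"] SD[OF x] SD[OF x'] \<phi>X subspace_diff[OF sub] by (simp only:)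
      then show "n (y - (\<phi> x - x) - (y - (\<phi> x' - x'))) \<le> 1/2 * n (x - x')"
        using contr[of x x'] SD[OF x] SD[OF x'] by simp
    qed
    then obtain x where x: "x \<in> S" and fixed: "y - (\<phi> x - x) = x" by blast
    have "\<phi> x = y - (y - (\<phi> x - x)) + x" by simp
    then have "\<phi> x = y" unfolding fixed by simp
    note x = x this
    then have "x \<in> \<Omega>" using y SD by (auto simp: \<Omega>_def B_def)
    then show ?thesis using x by auto
  qed
  define \<psi> where "\<psi> y = (SOME x. x \<in> \<Omega> \<and> \<phi> x = y)" for y
  have \<psi>: "\<psi> y \<in> \<Omega>" "\<phi> (\<psi> y) = y" if "y \<in> \<Omega>'" for y
    using someI_ex[of "\<lambda>x. x \<in> \<Omega> \<and> \<phi> x = y"] surj[OF that] unfolding \<psi>_def by auto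
  have inj: "x = x'" if "x \<in> \<Omega>" "x' \<in> \<Omega>" "\<phi> x = \<phi> x'" for x x'
  proof -
    have "x - x' \<in> topspace X" using that by (intro subspace_diff[OF sub] \<Omega>D(1))
    then have "x - x' = 0"
      using lip[OF that(1,2)] that(3) norm_on_zero[OF n] norm_on_nonneg[OF n] norm_on_zero_iff[OF n] by fastforce
    then show ?thesis by simp
  qed
  have near: "n (dir_deriv X \<phi> x v - v) \<le> 1/2 * n v" if "x \<in> \<Omega>" "v \<in> topspace X" for x v
    using est1[of x v] that \<Omega>D[OF that(1)] D\<phi> by auto
  have DX: "dir_deriv X \<phi> x v \<in> topspace X" if "x \<in> \<Omega>" "v \<in> topspace X" for x v
    using has_dir_deriv_topspace[OF smooth_has_dir_deriv1[OF X \<phi>\<Omega> that]] .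
  have Dlower: "n v \<le> 2 * n (dir_deriv X \<phi> x v)" if "x \<in> \<Omega>" "v \<in> topspace X" for x v
    by (rule lower[OF that(2) DX[OF that] near[OF that]])
  have Dsurj: "\<exists>v\<in>topspace X. dir_deriv X \<phi> x v = w" if x: "x \<in> \<Omega>" and w: "w \<in> topspace X" for x w
  proof -
    have lin: "linear_map_on (topspace X) (dir_deriv X \<phi> x)" by (rule smooth_dir_deriv_linear[OF X X \<phi>\<Omega> x])
    have "\<exists>v\<in>topspace X. w - (dir_deriv X \<phi> x v - v) = v"
    proof (rule contraction_fixed_point[OF n complete closedin_topspace zX])
      fix v assume v: "v \<in> topspace X"
      show "w - (dir_deriv X \<phi> x v - v) \<in> topspace X" using w v DX[OF x v] subspace_diff[OF sub] by auto
      fix v' assume v': "v' \<in> topspace X"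
      have vv: "v - v' \<in> topspace X" using v v' subspace_diff[OF sub] by auto
      have e: "w - (dir_deriv X \<phi> x v - v) - (w - (dir_deriv X \<phi> x v' - v')) = - (dir_deriv X \<phi> x (v - v') - (v - v'))"
        using linear_map_on_diff[OF lin sub v v'] by simp
      show "n (w - (dir_deriv X \<phi> x v - v) - (w - (dir_deriv X \<phi> x v' - v'))) \<le> 1/2 * n (v - v')"
        unfolding e norm_on_minus[OF n subspace_diff[OF sub DX[OF x vv] vv]] by (rule near[OF x vv])
    qed
    then obtain v where v: "v \<in> topspace X" "w - (dir_deriv X \<phi> x v - v) = v" by blast
    have "dir_deriv X \<phi> x v = w - (w - (dir_deriv X \<phi> x v - v)) + v" by simp
    then have "dir_deriv X \<phi> x v = w" unfolding v(2) by simp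
    then show ?thesis using v(1) by blast
  qed
  define A where "A x w = (SOME v. v \<in> topspace X \<and> dir_deriv X \<phi> x v = w)" for x w
  have A: "A x w \<in> topspace X" "dir_deriv X \<phi> x (A x w) = w" if "x \<in> \<Omega>" "w \<in> topspace X" for x w
    using someI_ex[of "\<lambda>v. v \<in> topspace X \<and> dir_deriv X \<phi> x v = w"] Dsurj[OF that] unfolding A_def by auto
  interpret smooth_bijection X n \<Omega> \<Omega>' \<phi> \<psi> A
    by (rule smooth_bijection.intro[OF n \<phi>\<Omega> open' \<psi> lip A Dlower])
  show ?thesis
  proof (rule that)
    show "0 \<in> \<Omega>" using zX d norm_on_zero[OF n] \<phi>0 by (auto simp: \<Omega>_def B_def \<Omega>'_def)
    show "\<Omega> \<subseteq> W" using BW by (auto simp: \<Omega>_def)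
    show "diffeo_on X \<Omega> X \<Omega>' \<phi> \<psi>"
      unfolding diffeo_on_def
    proof (intro conjI ballI \<phi>\<Omega> \<psi>_smooth)
      show "\<psi> (\<phi> x) = x" if "x \<in> \<Omega>" for x
        by (rule inj[OF \<psi>[OF \<Omega>D(3)[OF that]] that \<phi>\<psi>[OF \<Omega>D(3)[OF that]]])
    qed (use \<Omega>D(3) \<psi> \<phi>\<psi> in auto)
  qed
qed

section \<open>Topological direct sums\<close>

text \<open>
  A continuous projection onto \<open>L\<close> along \<open>K\<close> provides the inverse of the addition map.
\<close>

lemma topological_direct_sumI:
  assumes X: "normable X" and K: "subspace K" "closedin X K" and L: "subspace L" "closedin X L"
    and p: "continuous_map X X p" and pL: "\<And>x. x \<in> topspace X \<Longrightarrow> p x \<in> L"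
    and pK: "\<And>x. x \<in> topspace X \<Longrightarrow> x - p x \<in> K" and pKL: "\<And>k l. k \<in> K \<Longrightarrow> l \<in> L \<Longrightarrow> p (k + l) = l"
  shows "topological_direct_sum X K L"
proof -
  have KX: "K \<subseteq> topspace X" and LX: "L \<subseteq> topspace X" using K(2) L(2) closedin_subset by auto
  let ?Q = "prod_topology (subtopology X K) (subtopology X L)"
  have "homeomorphic_maps ?Q X (\<lambda>(k, l). k + l) (\<lambda>x. (x - p x, p x))"
    unfolding homeomorphic_maps_def
  proof (intro conjI ballI)
    have "continuous_map ?Q X (\<lambda>z. fst z + snd z)"
    proof (rule continuous_map_add[OF X])
      show "continuous_map ?Q X fst" "continuous_map ?Q X snd"
        using continuous_map_fst[of "subtopology X K" "subtopology X L"] continuous_map_snd[of "subtopology X K" "subtopology X L"]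
        by (auto simp: continuous_map_in_subtopology)
    qed
    then show "continuous_map ?Q X (\<lambda>(k, l). k + l)" by (simp add: case_prod_unfold)
    have "continuous_map X X (\<lambda>x. x - p x)" by (rule continuous_map_diff[OF X continuous_map_id[unfolded id_def] p])
    then show "continuous_map X ?Q (\<lambda>x. (x - p x, p x))"
      using p pL pK by (intro continuous_map_pairedI) (auto simp: continuous_map_in_subtopology)
    show "(\<lambda>x. (x - p x, p x)) ((\<lambda>(k, l). k + l) z) = z" if "z \<in> topspace ?Q" for z
      using that pKL by (auto simp: case_prod_unfold)
  qed auto
  then show ?thesis unfolding topological_direct_sum_def
    using K L homeomorphic_maps_imp_map by blast
qed

context
  fixes X :: "'a::real_vector topology" and K L
  assumes X: "normable X" and sum: "topological_direct_sum X K L"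
begin

lemma direct_sum_subspaces: "subspace K" "subspace L" "closedin X K" "closedin X L"
  using sum unfolding topological_direct_sum_def by auto

lemma direct_sum_subsets: "K \<subseteq> topspace X" "L \<subseteq> topspace X"
  using direct_sum_subspaces closedin_subset by auto

lemma direct_sum_homeomorphic: "homeomorphic_map (prod_topology (subtopology X K) (subtopology X L)) X (\<lambda>(k, l). k + l)"
  using sum unfolding topological_direct_sum_def by auto

lemma direct_sum_topspace: "topspace (prod_topology (subtopology X K) (subtopology X L)) = K \<times> L"
  using direct_sum_subsets by auto

lemma direct_sum_snd_eq:
  assumes "l \<in> L" "x - l \<in> K" shows "direct_sum_snd K L x = l"
  unfolding direct_sum_snd_def
proof (rule the_equality)
  fix l' assume l': "l' \<in> L \<and> x - l' \<in> K"
  have "(\<lambda>(k, l). k + l) (x - l, l) = (\<lambda>(k, l). k + l) (x - l', l')" by simp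
  then have "(x - l, l) = (x - l', l')"
    by (rule inj_onD[OF homeomorphic_imp_injective_map[OF direct_sum_homeomorphic]])
      (use assms l' direct_sum_subsets in auto)
  then show "l' = l" by simp
qed (use assms in auto)

lemma direct_sum_snd_sum: "k \<in> K \<Longrightarrow> l \<in> L \<Longrightarrow> direct_sum_snd K L (k + l) = l"
  by (rule direct_sum_snd_eq) auto

lemma direct_sum_snd_snd: "l \<in> L \<Longrightarrow> direct_sum_snd K L l = l"
  using direct_sum_snd_sum[of 0 l] subspace_0[OF direct_sum_subspaces(1)] by simp

lemma direct_sum_snd_fst: "k \<in> K \<Longrightarrow> direct_sum_snd K L k = 0"
  using direct_sum_snd_sum[of k 0] subspace_0[OF direct_sum_subspaces(2)] by simp

lemma direct_sum_decompose:
  assumes "x \<in> topspace X"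
  shows "direct_sum_snd K L x \<in> L" "x - direct_sum_snd K L x \<in> K"
proof -
  have "x \<in> (\<lambda>(k, l). k + l) ` (K \<times> L)"
    using homeomorphic_imp_surjective_map[OF direct_sum_homeomorphic] assms unfolding direct_sum_topspace by auto
  then obtain k l where "k \<in> K" "l \<in> L" "x = k + l" by auto
  then show "direct_sum_snd K L x \<in> L" "x - direct_sum_snd K L x \<in> K" using direct_sum_snd_sum by auto
qed

lemma direct_sum_snd_linear: "linear_map_on (topspace X) (direct_sum_snd K L)"
  unfolding linear_map_on_def
proof safe
  note KL = direct_sum_subspaces note d = direct_sum_decompose
  fix x y assume x: "x \<in> topspace X" and y: "y \<in> topspace X"
  have "(x - direct_sum_snd K L x) + (y - direct_sum_snd K L y) \<in> K"
    by (rule subspace_add[OF KL(1) d(2)[OF x] d(2)[OF y]])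
  then show "direct_sum_snd K L (x + y) = direct_sum_snd K L x + direct_sum_snd K L y"
    by (intro direct_sum_snd_eq subspace_add[OF KL(2)] d(1) x y) (simp add: algebra_simps)
  fix t :: real
  have "t *\<^sub>R (x - direct_sum_snd K L x) \<in> K" by (rule subspace_scale[OF KL(1) d(2)[OF x]])
  then show "direct_sum_snd K L (t *\<^sub>R x) = t *\<^sub>R direct_sum_snd K L x"
    by (intro direct_sum_snd_eq subspace_scale[OF KL(2)] d(1) x) (simp add: algebra_simps)
qed

lemma direct_sum_snd_continuous: "continuous_map X X (direct_sum_snd K L)"
proof -
  obtain g where g: "homeomorphic_maps (prod_topology (subtopology X K) (subtopology X L)) X (\<lambda>(k, l). k + l) g"
    using direct_sum_homeomorphic homeomorphic_map_maps by blast
  then have c: "continuous_map X (prod_topology (subtopology X K) (subtopology X L)) g"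
    and inv: "\<And>x. x \<in> topspace X \<Longrightarrow> (case g x of (k, l) \<Rightarrow> k + l) = x"
    unfolding homeomorphic_maps_def by auto
  have "continuous_map X X (\<lambda>x. snd (g x))"
    using continuous_map_compose[OF c continuous_map_snd] by (simp add: o_def continuous_map_in_subtopology)
  then show ?thesis
  proof (rule continuous_map_eq)
    fix x assume x: "x \<in> topspace X"
    have "g x \<in> K \<times> L" using continuous_map_image_subset_topspace[OF c] x unfolding direct_sum_topspace by auto
    then show "snd (g x) = direct_sum_snd K L x"
      using direct_sum_snd_sum[of "fst (g x)" "snd (g x)"] inv[OF x] by (auto simp: case_prod_unfold mem_Times_iff)
  qed
qed

lemma topological_direct_sum_swap: "topological_direct_sum X L K"
proof (rule topological_direct_sumI[OF X direct_sum_subspaces(2,4) direct_sum_subspaces(1,3)])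
  show "continuous_map X X (\<lambda>x. x - direct_sum_snd K L x)"
    by (rule continuous_map_diff[OF X continuous_map_id[unfolded id_def] direct_sum_snd_continuous])
  show "x - (x - direct_sum_snd K L x) \<in> L" if "x \<in> topspace X" for x using direct_sum_decompose[OF that] by simp
  show "k + l - direct_sum_snd K L (k + l) = l" if "k \<in> L" "l \<in> K" for k l
    using direct_sum_snd_sum[OF that(2,1)] by (simp add: add.commute)
qed (rule direct_sum_decompose)

end

section \<open>The local normal form\<close>

lemma dir_deriv_linear:
  assumes X: "normable X" and Y: "normable Y" and T: "linear_map_on (topspace X) T" "continuous_map X Y T"
    and x: "x \<in> topspace X" and v: "v \<in> topspace X"
  shows "dir_deriv Y T x v = T v"
proof (rule dir_deriv_eq[OF Y])
  show "has_dir_deriv Y T x v (T v)" unfolding has_dir_deriv_def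
  proof (rule limitin_eventually)
    show "\<forall>\<^sub>F t in at 0. (T (x + t *\<^sub>R v) - T x) /\<^sub>R t = T v"
      using x v subspace_scale[OF normable_subspace[OF X]]
      by (auto simp: eventually_at_filter linear_map_on_add[OF T(1)] linear_map_on_scale[OF T(1)])
  qed (use continuous_map_image_subset_topspace[OF T(2)] v in auto)
qed

lemma linear_map_on_compose:
  "linear_map_on S T \<Longrightarrow> linear_map_on S' T' \<Longrightarrow> T ` S \<subseteq> S' \<Longrightarrow> linear_map_on S (\<lambda>x. T' (T x))"
  unfolding linear_map_on_def by (auto simp: image_subset_iff)

lemma continuous_map_preimage_open:
  assumes "openin X U" "continuous_map (subtopology X U) Y f" "openin Y V"
  shows "openin X {x \<in> U. f x \<in> V}"
proof -
  have "openin (subtopology X U) {x \<in> topspace (subtopology X U). f x \<in> V}"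
    by (rule openin_continuous_map_preimage[OF assms(2,3)])
  moreover have "{x \<in> topspace (subtopology X U). f x \<in> V} = {x \<in> U. f x \<in> V}"
    using openin_subset[OF assms(1)] by auto
  ultimately show ?thesis using assms(1) openin_trans_full by metis
qed

lemma diffeo_on_restrict:
  assumes X: "normable X" and Y: "normable Y" and d: "diffeo_on X U Y V f g" and U': "openin X U'" "U' \<subseteq> U"
  shows "diffeo_on X U' Y {y \<in> V. g y \<in> U'} f g"
proof -
  have f: "smooth_map_on X U Y f" and g: "smooth_map_on Y V X g" using d by (auto simp: diffeo_on_def)
  have "openin Y {y \<in> V. g y \<in> U'}"
    by (rule continuous_map_preimage_open[OF smooth_map_on_openin[OF g] smooth_map_on_continuous_map[OF g] U'(1)])
  from smooth_map_on_subset_cong[OF Y X g this, of g] smooth_map_on_subset_cong[OF X Y f U', of f]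
  show ?thesis using d U' unfolding diffeo_on_def by auto
qed

lemma diffeo_on_sym: "diffeo_on X U Y V f g \<Longrightarrow> diffeo_on Y V X U g f"
  unfolding diffeo_on_def by auto

lemma smooth_map_on_diff:
  assumes X: "normable X" and Y: "normable Y" and f: "smooth_map_on X U Y f" and g: "smooth_map_on X U Y g"
  shows "smooth_map_on X U Y (\<lambda>x. f x - g x)"
proof -
  have "linear_map_on (topspace Y) (\<lambda>y. - y)" by (auto simp: linear_map_on_def)
  moreover have "continuous_map Y Y (\<lambda>y. - y)"
    using continuous_map_diff[OF Y, of Y "\<lambda>_. 0" "\<lambda>y. y"] subspace_0[OF normable_subspace[OF Y]] by simp
  ultimately have "smooth_map_on Y (topspace Y) Y (\<lambda>y. - y)" by (rule smooth_map_on_linear[OF Y Y])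
  from smooth_map_on_compose[OF X Y Y g this] smooth_map_on_topspace[OF g]
  have "smooth_map_on X U Y (\<lambda>x. - g x)" by auto
  from smooth_map_on_add[OF X Y f this] show ?thesis by simp
qed

lemma smooth_map_on_linear_subset:
  assumes X: "normable X" and Y: "normable Y" and T: "linear_map_on (topspace X) T" "continuous_map X Y T"
    and U: "openin X U"
  shows "smooth_map_on X U Y T"
  by (rule smooth_map_on_subset_cong[OF X Y smooth_map_on_linear[OF X Y T] U openin_subset[OF U] refl])

text \<open>
  On a complement of its kernel a linear map is injective; \<open>S\<close> inverts it there.
\<close>

lemma direct_sum_section:
  assumes X: "normable X" and T: "linear_map_on (topspace X) T"
    and XKL: "topological_direct_sum X {x \<in> topspace X. T x = 0} L"
  obtains S where "\<And>x. x \<in> topspace X \<Longrightarrow> S (T x) = direct_sum_snd {x \<in> topspace X. T x = 0} L x"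
    "linear_map_on (T ` topspace X) S"
proof -
  note subX = normable_subspace[OF X]
  define K where "K = {x \<in> topspace X. T x = 0}"
  define p where "p = direct_sum_snd K L"
  note p_lin = direct_sum_snd_linear[OF X XKL, folded K_def, folded p_def]
    and p_K = direct_sum_snd_fst[OF X XKL, folded K_def, folded p_def]
  define S where "S y = p (SOME x. x \<in> topspace X \<and> T x = y)" for y
  have ST: "S (T x) = p x" if x: "x \<in> topspace X" for x
  proof -
    define x' where "x' = (SOME x'. x' \<in> topspace X \<and> T x' = T x)"
    have x': "x' \<in> topspace X" "T x' = T x"
      using someI[of "\<lambda>x'. x' \<in> topspace X \<and> T x' = T x" x] x unfolding x'_def by auto
    have "x' - x \<in> K" using x' x linear_map_on_diff[OF T subX x'(1) x] subspace_diff[OF subX] by (auto simp: K_def)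
    then have "p (x' - x) = 0" by (rule p_K)
    then show ?thesis using linear_map_on_diff[OF p_lin subX x'(1) x] unfolding S_def x'_def by simp
  qed
  have S_lin: "linear_map_on (T ` topspace X) S"
    unfolding linear_map_on_def
  proof safe
    fix x x' assume x: "x \<in> topspace X" and x': "x' \<in> topspace X"
    show "S (T x + T x') = S (T x) + S (T x')"
      using ST[OF subspace_add[OF subX x x']] by (simp add: linear_map_on_add[OF T x x'] linear_map_on_add[OF p_lin x x'] ST x x')
    fix t :: real show "S (t *\<^sub>R T x) = t *\<^sub>R S (T x)"
      using ST[OF subspace_scale[OF subX x]] by (simp add: linear_map_on_scale[OF T x] linear_map_on_scale[OF p_lin x] ST x)
  qed
  show ?thesis
    by (rule that[of S]) (use ST S_lin in \<open>auto simp: p_def K_def\<close>)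
qed

text \<open>
  The coordinate changes \<open>\<phi>\<close> of the source and \<open>\<rho>\<close> of the target are the ones described at the top.  In
  the application \<open>V0\<close> is the image of the chart of the target that \<open>\<rho>\<close> is to be composed with, so \<open>V\<close>
  has to lie in it.
\<close>

theorem local_normal_form:
  fixes X :: "'a::real_vector topology" and Y :: "'b::real_vector topology"
  assumes lcs: "locally_convex_space X" "locally_convex_space Y"
    and banach: "banach_space X" and Y: "normable Y"
    and g: "smooth_map_on X W Y g" and W: "0 \<in> W" and g0: "g 0 = 0" and gW: "g ` W \<subseteq> V0"
    and V0: "openin Y V0" and regular: "regular_operator X Y (dir_deriv Y g 0)"
  obtains Ker Coim Coker Img fhat U fsing \<Omega> \<phi> \<phi>' V V' \<rho> \<rho>'
  where "abstract_normal_form X Ker Coim Y Coker Img fhat U fsing"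
    "0 \<in> \<Omega>" "\<Omega> \<subseteq> W" "diffeo_on X \<Omega> X U \<phi> \<phi>'" "\<phi> 0 = 0"
    "V \<subseteq> V0" "diffeo_on Y V Y V' \<rho> \<rho>'" "\<rho> 0 = 0" "g ` \<Omega> \<subseteq> V"
    "\<And>x. x \<in> \<Omega> \<Longrightarrow> \<rho> (g x) = normal_form_map Ker Coim fhat fsing (\<phi> x)"
proof -
  obtain n where n: "norm_on X n" and complete: "Metric_space.mcomplete (topspace X) (\<lambda>x y. n (x - y))"
    using banach unfolding banach_space_iff by blast
  note X = norm_on_imp_normable[OF n] note subX = normable_subspace[OF X] note subY = normable_subspace[OF Y]
  have zX: "0 \<in> topspace X" and zY: "0 \<in> topspace Y" using subspace_0 subX subY by auto
  define T where "T = dir_deriv Y g 0"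
  define K where "K = {x \<in> topspace X. T x = 0}"
  define I where "I = T ` topspace X"
  have T: "linear_map_on (topspace X) T" "continuous_map X Y T" and T_open: "open_map X (subtopology Y I) T"
    and "\<exists>L. topological_direct_sum X K L" "\<exists>C. topological_direct_sum Y I C"
    using regular unfolding regular_operator_def T_def K_def I_def by auto
  then obtain L C where XKL: "topological_direct_sum X K L" and YIC: "topological_direct_sum Y I C" by auto
  note YCI = topological_direct_sum_swap[OF Y YIC]
  define p where "p = direct_sum_snd K L"
  define q where "q = direct_sum_snd C I"
  note p_lin = direct_sum_snd_linear[OF X XKL, folded p_def] and q_lin = direct_sum_snd_linear[OF Y YCI, folded q_def]
  note p_cont = direct_sum_snd_continuous[OF X XKL, folded p_def] and q_cont = direct_sum_snd_continuous[OF Y YCI, folded q_def]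
  note pL = direct_sum_decompose(1)[OF X XKL, folded p_def] and pK = direct_sum_decompose(2)[OF X XKL, folded p_def]
  note qI = direct_sum_decompose(1)[OF Y YCI, folded q_def] and qC = direct_sum_decompose(2)[OF Y YCI, folded q_def]
  note p_L = direct_sum_snd_snd[OF X XKL, folded p_def] and p_K = direct_sum_snd_fst[OF X XKL, folded p_def]
  note q_I = direct_sum_snd_snd[OF Y YCI, folded q_def] and q_C = direct_sum_snd_fst[OF Y YCI, folded q_def]
  note subs = direct_sum_subspaces[OF X XKL] direct_sum_subspaces[OF Y YCI]
  have KX: "K \<subseteq> topspace X" and LX: "L \<subseteq> topspace X" and CY: "C \<subseteq> topspace Y" and IY: "I \<subseteq> topspace Y"
    using direct_sum_subsets[OF X XKL] direct_sum_subsets[OF Y YCI] by auto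
  have TI: "T x \<in> I" if "x \<in> topspace X" for x using that by (simp add: I_def)
  have Tp: "T (p x) = T x" if x: "x \<in> topspace X" for x
    using pK[OF x] linear_map_on_diff[OF T(1) subX x, of "p x"] pL[OF x] LX by (auto simp: K_def)

  obtain S where ST: "\<And>x. x \<in> topspace X \<Longrightarrow> S (T x) = p x" and S_lin: "linear_map_on I S"
    using direct_sum_section[OF X T(1) XKL[unfolded K_def]] unfolding p_def K_def I_def by blast
  have topI: "topspace (subtopology Y I) = I" using IY by auto
  \<comment> \<open>Openness of \<open>T\<close> onto its image is what makes the inverse \<open>S\<close> of \<open>T\<close> on \<open>L\<close> continuous.\<close>
  have S_cont: "continuous_map (subtopology Y I) X S"
    unfolding continuous_map_def topI
  proof (intro conjI allI impI)
    show "S \<in> I \<rightarrow> topspace X" using ST pL LX by (auto simp: I_def)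
    fix Op assume Op: "openin X Op"
    have "openin X {x \<in> topspace X. p x \<in> Op}" by (rule openin_continuous_map_preimage[OF p_cont Op])
    then have "openin (subtopology Y I) (T ` {x \<in> topspace X. p x \<in> Op})" using T_open unfolding open_map_def by blast
    moreover have "T ` {x \<in> topspace X. p x \<in> Op} = {y \<in> I. S y \<in> Op}" using ST by (auto simp: I_def)
    ultimately show "openin (subtopology Y I) {y \<in> I. S y \<in> Op}" by simp
  qed
  define R where "R y = S (q y)" for y
  have R_lin: "linear_map_on (topspace Y) R"
    unfolding R_def by (rule linear_map_on_compose[OF q_lin S_lin]) (use qI in auto)
  have q_contI: "continuous_map Y (subtopology Y I) q"
    using q_cont qI by (auto simp: continuous_map_in_subtopology)
  have R_cont: "continuous_map Y X R"
    using continuous_map_compose[OF q_contI S_cont] by (simp add: R_def[abs_def] o_def)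
  have RT: "R (T x) = p x" if "x \<in> topspace X" for x using that q_I TI ST by (simp add: R_def)
  have RL: "R y \<in> L" "T (R y) = q y" if y: "y \<in> topspace Y" for y
  proof -
    obtain x where x: "x \<in> topspace X" "q y = T x" using qI[OF y] by (auto simp: I_def)
    then show "R y \<in> L" "T (R y) = q y" using ST[OF x(1)] pL[OF x(1)] Tp[OF x(1)] by (auto simp: R_def)
  qed
  have RC: "R y = 0" if "y \<in> C" for y
    using q_C[OF that] linear_map_on_zero[OF S_lin subs(6)] by (simp add: R_def)
  have RX: "R y \<in> topspace X" if "y \<in> topspace Y" for y using RL(1)[OF that] LX by auto

  have gtop: "g x \<in> topspace Y" if "x \<in> W" for x using smooth_map_on_topspace[OF g that] .
  have openW: "openin X W" using smooth_map_on_openin[OF g] .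
  have WX: "W \<subseteq> topspace X" using openin_subset[OF openW] .
  define \<phi> where "\<phi> x = (x - p x) + R (g x)" for x
  have Rg: "smooth_map_on X W X (\<lambda>x. R (g x))"
    by (rule smooth_map_on_compose[OF X Y X g smooth_map_on_linear[OF Y X R_lin R_cont]]) (use gtop in auto)
  have idp: "smooth_map_on X W X (\<lambda>x. x - p x)"
    by (intro smooth_map_on_diff[OF X X] smooth_map_on_id[OF X] smooth_map_on_linear_subset[OF X X p_lin p_cont] openW)
  have \<phi>_smooth: "smooth_map_on X W X \<phi>"
    unfolding \<phi>_def[abs_def] by (rule smooth_map_on_add[OF X X idp Rg])
  have \<phi>0: "\<phi> 0 = 0"
    using linear_map_on_zero[OF p_lin subX] linear_map_on_zero[OF R_lin subY] g0 by (simp add: \<phi>_def)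
  have D\<phi>: "dir_deriv X \<phi> 0 v = v" if v: "v \<in> topspace X" for v
  proof (rule dir_deriv_eq[OF X])
    have lin: "linear_map_on (topspace X) (\<lambda>x. x - p x)"
      using p_lin by (auto simp: linear_map_on_def algebra_simps)
    have cont: "continuous_map X X (\<lambda>x. x - p x)"
      by (rule continuous_map_diff[OF X continuous_map_id[unfolded id_def] p_cont])
    have "has_dir_deriv X (\<lambda>x. x - p x) 0 v (v - p v)"
      using smooth_has_dir_deriv1[OF X smooth_map_on_linear[OF X X lin cont] zX v]
        dir_deriv_linear[OF X X lin cont zX v] by simp
    moreover have "has_dir_deriv X (\<lambda>x. R (g x)) 0 v (p v)"
      using has_dir_deriv_chain[OF Y X smooth_map_on_linear[OF Y X R_lin R_cont] smooth_has_dir_deriv1[OF Y g W v] gtop[OF W]]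
        dir_deriv_linear[OF Y X R_lin R_cont gtop[OF W], of "T v"] RT[OF v] TI[OF v] IY by (auto simp: T_def)
    ultimately have "has_dir_deriv X \<phi> 0 v (v - p v + p v)" unfolding \<phi>_def[abs_def] by (rule has_dir_deriv_add[OF X])
    then show "has_dir_deriv X \<phi> 0 v v" by simp
  qed
  obtain \<Omega>0 U0 \<psi> where z\<Omega>0: "0 \<in> \<Omega>0" and \<Omega>0W: "\<Omega>0 \<subseteq> W" and diff0: "diffeo_on X \<Omega>0 X U0 \<phi> \<psi>"
    by (rule inverse_function_theorem[OF n complete \<phi>_smooth W \<phi>0 D\<phi>])
  have \<psi>_smooth: "smooth_map_on X U0 X \<psi>" and \<phi>U0: "\<And>x. x \<in> \<Omega>0 \<Longrightarrow> \<phi> x \<in> U0"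
    and \<psi>\<Omega>0: "\<And>y. y \<in> U0 \<Longrightarrow> \<psi> y \<in> \<Omega>0" and \<psi>\<phi>: "\<And>x. x \<in> \<Omega>0 \<Longrightarrow> \<psi> (\<phi> x) = x" and \<phi>\<psi>: "\<And>y. y \<in> U0 \<Longrightarrow> \<phi> (\<psi> y) = y"
    using diff0 unfolding diffeo_on_def by auto
  have zU0: "0 \<in> U0" using \<phi>U0[OF z\<Omega>0] \<phi>0 by simp
  have \<psi>0: "\<psi> 0 = 0" using \<psi>\<phi>[OF z\<Omega>0] \<phi>0 by simp
  have openU0: "openin X U0" using smooth_map_on_openin[OF \<psi>_smooth] .
  have U0X: "U0 \<subseteq> topspace X" using openin_subset[OF openU0] .
  \<comment> \<open>In the coordinates \<open>\<phi>\<close> the \<open>I\<close>-component of \<open>g\<close> is linear.\<close>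
  have p\<phi>: "p (\<phi> x) = R (g x)" if "x \<in> W" for x
  proof -
    have x: "x \<in> topspace X" using that WX by auto
    have "p (\<phi> x) = p (x - p x) + p (R (g x))"
      unfolding \<phi>_def using linear_map_on_add[OF p_lin] pK[OF x] KX RX[OF gtop[OF that]] by auto
    then show ?thesis using p_K[OF pK[OF x]] p_L[OF RL(1)[OF gtop[OF that]]] by simp
  qed
  have qg: "q (g x) = T (p (\<phi> x))" if "x \<in> W" for x using p\<phi>[OF that] RL(2)[OF gtop[OF that]] by simp

  define YC where "YC = subtopology Y C"
  have YCn: "normable YC" unfolding YC_def by (rule normable_subtopology[OF Y subs(5) CY])
  define P where "P y = y - q y" for y
  have P_lin: "linear_map_on (topspace Y) P"
    using q_lin by (auto simp: linear_map_on_def algebra_simps P_def)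
  have PC: "P y \<in> C" if "y \<in> topspace Y" for y using qC[OF that] by (simp add: P_def)
  have "continuous_map Y Y P"
    unfolding P_def[abs_def] by (rule continuous_map_diff[OF Y continuous_map_id[unfolded id_def] q_cont])
  then have P_cont: "continuous_map Y YC P"
    using PC unfolding YC_def by (auto simp: continuous_map_in_subtopology)
  define h where "h y = P (g (\<psi> y))" for y
  have g\<psi>: "smooth_map_on X U0 Y (\<lambda>y. g (\<psi> y))"
    by (rule smooth_map_on_compose[OF X X Y \<psi>_smooth g]) (use \<psi>\<Omega>0 \<Omega>0W in auto)
  have h_smooth: "smooth_map_on X U0 YC h"
    unfolding h_def by (rule smooth_map_on_compose[OF X Y YCn g\<psi> smooth_map_on_linear[OF Y YCn P_lin P_cont]])
      (use smooth_map_on_topspace[OF g\<psi>] in auto)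
  have incl_lin: "linear_map_on (topspace YC) (\<lambda>y. y)" by (auto simp: linear_map_on_def)
  have incl_cont: "continuous_map YC Y (\<lambda>y. y)"
    unfolding YC_def using continuous_map_from_subtopology[OF continuous_map_id[of Y], of C] by (simp add: id_def)
  have hY_smooth: "smooth_map_on X U0 Y h"
    by (rule smooth_map_on_compose[OF X YCn Y h_smooth smooth_map_on_linear[OF YCn Y incl_lin incl_cont]])
      (use smooth_map_on_topspace[OF h_smooth] in auto)
  have hC: "h y \<in> C" if "y \<in> U0" for y using smooth_map_on_topspace[OF h_smooth that] CY by (auto simp: YC_def)
  have h0: "h 0 = 0" using \<psi>0 g0 linear_map_on_zero[OF P_lin subY] by (simp add: h_def)
  \<comment> \<open>The \<open>C\<close>-component has derivative \<open>P \<circ> T\<close> up to a change of coordinates, and \<open>P\<close> kills the image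
    of \<open>T\<close>.\<close>
  have Dh: "dir_deriv YC h 0 v = 0" if v: "v \<in> topspace X" for v
  proof -
    define u where "u = dir_deriv X \<psi> 0 v"
    have u: "has_dir_deriv X \<psi> 0 v u" unfolding u_def by (rule smooth_has_dir_deriv1[OF X \<psi>_smooth zU0 v])
    have uX: "u \<in> topspace X" using has_dir_deriv_topspace[OF u] .
    have "has_dir_deriv Y (\<lambda>y. g (\<psi> y)) 0 v (dir_deriv Y g (\<psi> 0) u)"
      by (rule has_dir_deriv_chain[OF X Y g u]) (use \<psi>0 W in auto)
    then have 1: "has_dir_deriv Y (\<lambda>y. g (\<psi> y)) 0 v (T u)" by (simp add: T_def \<psi>0)
    have "has_dir_deriv YC h 0 v (dir_deriv YC P (g (\<psi> 0)) (T u))"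
      unfolding h_def by (rule has_dir_deriv_chain[OF Y YCn smooth_map_on_linear[OF Y YCn P_lin P_cont] 1])
        (use \<psi>0 g0 zY in auto)
    moreover have "dir_deriv YC P (g (\<psi> 0)) (T u) = P (T u)"
      by (rule dir_deriv_linear[OF Y YCn P_lin P_cont]) (use \<psi>0 g0 zY TI[OF uX] IY in auto)
    moreover have "P (T u) = 0" using q_I[OF TI[OF uX]] by (simp add: P_def)
    ultimately show ?thesis using dir_deriv_eq[OF YCn] by metis
  qed

  \<comment> \<open>The singular part evaluates \<open>h\<close> at \<open>p y\<close> as well; since \<open>p\<close> is idempotent, this set is stable
    under \<open>p\<close>.\<close>
  define U where "U = {y \<in> U0. p y \<in> U0}"
  have openU: "openin X U"
    unfolding U_def using continuous_map_preimage_open[OF openU0 continuous_map_from_subtopology[OF p_cont] openU0] .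
  have UU0: "U \<subseteq> U0" by (auto simp: U_def)
  have p0: "p 0 = 0" using linear_map_on_zero[OF p_lin subX] .
  have zU: "0 \<in> U" using zU0 p0 by (simp add: U_def)
  define fsing where "fsing y = h y - h (p y)" for y
  have hp_smooth: "smooth_map_on X U YC (\<lambda>y. h (p y))"
    by (rule smooth_map_on_compose[OF X X YCn smooth_map_on_linear_subset[OF X X p_lin p_cont openU] h_smooth])
      (auto simp: U_def)
  have hU: "smooth_map_on X U YC h" by (rule smooth_map_on_subset_cong[OF X YCn h_smooth openU UU0 refl])
  have fsing_smooth: "smooth_map_on X U YC fsing"
    unfolding fsing_def[abs_def] by (rule smooth_map_on_diff[OF X YCn hU hp_smooth])
  have Dfsing: "dir_deriv YC fsing 0 v = 0" if v: "v \<in> topspace X" for v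
  proof -
    have "has_dir_deriv YC h 0 v 0" using smooth_has_dir_deriv1[OF YCn h_smooth zU0 v] Dh[OF v] by simp
    moreover have pv: "p v \<in> topspace X" using pL[OF v] LX by auto
    have "has_dir_deriv X p 0 v (p v)"
      using smooth_has_dir_deriv1[OF X smooth_map_on_linear[OF X X p_lin p_cont] zX v]
        dir_deriv_linear[OF X X p_lin p_cont zX v] by simp
    from has_dir_deriv_chain[OF X YCn h_smooth this] p0 zU0 Dh[OF pv]
    have "has_dir_deriv YC (\<lambda>y. h (p y)) 0 v 0" by simp
    from has_dir_deriv_scaleR[OF YCn this, of "-1"] have "has_dir_deriv YC (\<lambda>y. - h (p y)) 0 v 0" by simp
    ultimately have "has_dir_deriv YC (\<lambda>y. h y + - h (p y)) 0 v (0 + 0)" by (rule has_dir_deriv_add[OF YCn])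
    then show ?thesis using dir_deriv_eq[OF YCn] by (simp add: fsing_def[abs_def])
  qed

  have anf: "abstract_normal_form X K L Y C I T U fsing"
    unfolding abstract_normal_form_def YC_def[symmetric]
  proof (intro conjI lcs XKL YCI openU zU fsing_smooth)
    show "linear_map_on L T" using T(1) LX by (auto simp: linear_map_on_def subset_iff)
    have "homeomorphic_maps (subtopology X L) (subtopology Y I) T S"
      unfolding homeomorphic_maps_def
    proof (intro conjI ballI)
      show "continuous_map (subtopology X L) (subtopology Y I) T"
        using continuous_map_from_subtopology[OF T(2), of L] TI by (auto simp: continuous_map_in_subtopology)
      show "continuous_map (subtopology Y I) (subtopology X L) S"
        using S_cont ST pL by (auto simp: continuous_map_in_subtopology I_def)
      show "S (T x) = x" if "x \<in> topspace (subtopology X L)" for x using that ST p_L by auto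
      show "T (S y) = y" if "y \<in> topspace (subtopology Y I)" for y using that ST Tp by (auto simp: I_def)
    qed
    then show "homeomorphic_map (subtopology X L) (subtopology Y I) T" by (rule homeomorphic_maps_imp_map)
    show "\<forall>x\<in>U \<inter> L. fsing x = 0" using p_L by (auto simp: fsing_def)
    show "\<forall>v\<in>topspace X. dir_deriv YC fsing 0 v = 0" using Dfsing by blast
  qed

  define V1 where "V1 = {y \<in> topspace Y. R y \<in> U0}"
  have openV1: "openin Y V1" unfolding V1_def by (rule openin_continuous_map_preimage[OF R_cont openU0])
  have V1Y: "V1 \<subseteq> topspace Y" by (auto simp: V1_def)
  have hR: "smooth_map_on Y V1 Y (\<lambda>y. h (R y))"
    by (rule smooth_map_on_compose[OF Y X Y smooth_map_on_linear_subset[OF Y X R_lin R_cont openV1] hY_smooth])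
      (auto simp: V1_def)
  define \<rho> where "\<rho> y = y - h (R y)" for y
  define \<rho>' where "\<rho>' y = y + h (R y)" for y
  have hRC: "h (R y) \<in> C" if "y \<in> V1" for y using hC that by (simp add: V1_def)
  \<comment> \<open>\<open>h\<close> has values in \<open>C\<close>, where \<open>R\<close> vanishes; so \<open>\<rho>\<close> and \<open>\<rho>'\<close> do not change the argument of \<open>h\<close>.\<close>
  have R\<rho>: "R (\<rho> y) = R y" "R (\<rho>' y) = R y" if "y \<in> V1" for y
    using that hRC[OF that] CY V1Y RC[OF hRC[OF that]]
      linear_map_on_diff[OF R_lin subY, of y "h (R y)"] linear_map_on_add[OF R_lin, of y "h (R y)"]
    by (auto simp: \<rho>_def \<rho>'_def)
  have \<rho>Y: "\<rho> y \<in> topspace Y" "\<rho>' y \<in> topspace Y" if "y \<in> V1" for y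
    using that hRC[OF that] CY V1Y subspace_diff[OF subY, of y "h (R y)"] subspace_add[OF subY, of y "h (R y)"]
    by (auto simp: \<rho>_def \<rho>'_def)
  have \<rho>V1: "\<rho> y \<in> V1" "\<rho>' y \<in> V1" if "y \<in> V1" for y
    using that \<rho>Y[OF that] R\<rho>[OF that] by (auto simp: V1_def)
  have diff\<rho>: "diffeo_on Y V1 Y V1 \<rho> \<rho>'"
    unfolding diffeo_on_def
  proof (intro conjI ballI)
    show "smooth_map_on Y V1 Y \<rho>" unfolding \<rho>_def[abs_def]
      by (rule smooth_map_on_diff[OF Y Y smooth_map_on_id[OF Y openV1] hR])
    show "smooth_map_on Y V1 Y \<rho>'" unfolding \<rho>'_def[abs_def]
      by (rule smooth_map_on_add[OF Y Y smooth_map_on_id[OF Y openV1] hR])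
    show "\<rho>' (\<rho> y) = y" if "y \<in> V1" for y
      unfolding \<rho>'_def R\<rho>(1)[OF that] by (simp add: \<rho>_def)
    show "\<rho> (\<rho>' y) = y" if "y \<in> V1" for y
      unfolding \<rho>_def R\<rho>(2)[OF that] by (simp add: \<rho>'_def)
  qed (use \<rho>V1 in auto)
  define V where "V = V1 \<inter> V0"
  have openV: "openin Y V" unfolding V_def by (rule openin_Int[OF openV1 V0])
  define \<Omega> where "\<Omega> = {x \<in> \<Omega>0. \<phi> x \<in> U}"
  have diff\<Omega>: "diffeo_on X \<Omega> X U \<phi> \<psi>"
    unfolding \<Omega>_def
    by (rule diffeo_on_sym[OF diffeo_on_restrict[OF X X diffeo_on_sym[OF diff0] openU UU0]])
  show ?thesis
  proof (rule that[OF anf _ _ diff\<Omega> \<phi>0 _ diffeo_on_restrict[OF Y Y diff\<rho> openV]])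
    show "0 \<in> \<Omega>" using z\<Omega>0 \<phi>0 zU by (simp add: \<Omega>_def)
    show "\<Omega> \<subseteq> W" using \<Omega>0W by (auto simp: \<Omega>_def)
    show "V \<subseteq> V0" "V \<subseteq> V1" by (auto simp: V_def)
    show "\<rho> 0 = 0" using linear_map_on_zero[OF R_lin subY] h0 by (simp add: \<rho>_def)
    show "g ` \<Omega> \<subseteq> V"
    proof safe
      fix x assume x: "x \<in> \<Omega>"
      then have "x \<in> W" "p (\<phi> x) \<in> U0" using \<Omega>0W by (auto simp: \<Omega>_def U_def)
      then show "g x \<in> V" using p\<phi> gtop gW by (auto simp: V_def V1_def)
    qed
    fix x assume x: "x \<in> \<Omega>"
    then have xW: "x \<in> W" and x0: "x \<in> \<Omega>0" using \<Omega>0W by (auto simp: \<Omega>_def)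
    have "h (\<phi> x) = g x - q (g x)" using \<psi>\<phi>[OF x0] by (simp add: h_def P_def)
    then show "\<rho> (g x) = normal_form_map K L T fsing (\<phi> x)"
      unfolding normal_form_map_def p_def[symmetric] \<rho>_def fsing_def
      using p\<phi>[OF xW] qg[OF xW] by simp
  qed
qed

section \<open>Finite-dimensional spaces\<close>

lemma linear_bounded_continuous:
  assumes m: "norm_on X m" and n: "norm_on Y n" and T: "linear_map_on (topspace X) T"
    and TY: "\<And>x. x \<in> topspace X \<Longrightarrow> T x \<in> topspace Y"
    and c: "\<And>x. x \<in> topspace X \<Longrightarrow> n (T x) \<le> c * m x"
  shows "continuous_map X Y T"
  unfolding continuous_map_atin
proof
  note X = norm_on_imp_normable[OF m] note sub = normable_subspace[OF X]
  fix x assume x: "x \<in> topspace X"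
  have id: "limitin X (\<lambda>z. z) x (atin X x)"
    using limitin_continuous_map[of X X "\<lambda>z. z" x x] x by simp
  have "limitin X (\<lambda>z. z - x) (x - x) (atin X x)"
    by (rule limitin_diff[OF X id]) (use x in auto)
  then have "limitin X (\<lambda>z. z - x) 0 (atin X x)" by simp
  then show "limitin Y T (T x) (atin X x)"
  proof (rule limitin_norm_bound[OF n m TY[OF x]])
    show "\<forall>\<^sub>F z in atin X x. T z \<in> topspace Y \<and> n (T z - T x) \<le> c * m (z - x)"
      using limitin_eventually_topspace[OF id]
    proof eventually_elim
      case (elim z)
      then show ?case using c[of "z - x"] TY x subspace_diff[OF sub] linear_map_on_diff[OF T sub elim x] by auto
    qed
  qed
qed

lemma norm_on_sum:
  assumes n: "norm_on X n" and "finite I" and "\<And>i. i \<in> I \<Longrightarrow> x i \<in> topspace X"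
  shows "n (\<Sum>i\<in>I. x i) \<le> (\<Sum>i\<in>I. n (x i))"
  using assms(2,3)
proof (induction I rule: finite_induct)
  case (insert i I)
  have "n (x i + sum x I) \<le> n (x i) + n (sum x I)"
    using insert by (intro norm_on_add[OF n] subspace_sum[OF norm_on_imp_subspace[OF n]]) auto
  also have "n (sum x I) \<le> (\<Sum>i\<in>I. n (x i))" using insert by auto
  finally show ?case using insert by simp
qed (simp add: norm_on_zero[OF n])

text \<open>
  On each face \<open>c b0 = \<plusminus>1\<close> of the unit cube, which is compact by Tychonoff's theorem, the norm is
  continuous and by independence positive, hence bounded below; scaling extends the bound to all
  coordinate vectors.
\<close>

lemma coordinates_bounded:
  assumes n: "norm_on X n" and B: "finite B" "independent B" "B \<subseteq> topspace X"
  shows "\<exists>d>0. \<forall>c. \<forall>b\<in>B. d * \<bar>c b\<bar> \<le> n (\<Sum>b\<in>B. c b *\<^sub>R b)"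
proof (cases "B = {}")
  case False
  note X = norm_on_imp_normable[OF n] note sub = normable_subspace[OF X]
  let ?Q = "product_topology (\<lambda>_. euclideanreal) B"
  define F where "F c = n (\<Sum>b\<in>B. c b *\<^sub>R b)" for c
  have vec: "(\<Sum>b\<in>B. c b *\<^sub>R b) \<in> topspace X" for c
    using B(3) by (intro subspace_sum[OF sub] subspace_scale[OF sub]) auto
  have "continuous_map ?Q X (\<lambda>c. \<Sum>b\<in>B. c b *\<^sub>R b)"
    using B(3) by (intro continuous_map_sum[OF X B(1)] continuous_map_scaleR[OF X] continuous_map_product_projection) auto
  from continuous_map_compose[OF this continuous_map_norm[OF n]]
  have F: "continuous_map ?Q euclideanreal F" by (simp add: o_def F_def[abs_def])
  have "\<exists>d>0. \<forall>c\<in>PiE B (\<lambda>b. if b = b0 then {-1, 1} else {-1..1}). d \<le> F c" if b0: "b0 \<in> B" for b0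
  proof -
    let ?S = "PiE B (\<lambda>b. if b = b0 then {-1, 1} else {-1..1::real})"
    have "compactin ?Q ?S" unfolding compactin_PiE by auto
    then have "compact (F ` ?S)" using image_compactin[OF _ F] by auto
    moreover have "F ` ?S \<noteq> {}" using b0 by (auto simp: PiE_eq_empty_iff)
    ultimately obtain c where c: "c \<in> ?S" "\<And>c'. c' \<in> ?S \<Longrightarrow> F c \<le> F c'"
      using compact_attains_inf[of "F ` ?S"] by (metis (no_types, lifting) imageE imageI)
    have "c b0 \<noteq> 0" using PiE_mem[OF c(1) b0] by auto
    then have "(\<Sum>b\<in>B. c b *\<^sub>R b) \<noteq> 0" using independentD[OF B(2,1), of c b0] b0 by blast
    then have "F c > 0" unfolding F_def
      using norm_on_nonneg[OF n vec, of c] norm_on_zero_iff[OF n vec, of c] by auto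
    then show ?thesis using c(2) by blast
  qed
  then obtain d where d: "\<And>b. b \<in> B \<Longrightarrow> d b > 0"
    "\<And>b0 c. b0 \<in> B \<Longrightarrow> c \<in> PiE B (\<lambda>b. if b = b0 then {-1, 1} else {-1..1}) \<Longrightarrow> d b0 \<le> F c"
    by metis
  define d0 where "d0 = Min (d ` B)"
  have d0: "d0 > 0" unfolding d0_def using B(1) False d(1) by (subst Min_gr_iff) auto
  have "d0 * \<bar>c b\<bar> \<le> F c" if b: "b \<in> B" for c b
  proof -
    define M where "M = Max ((\<lambda>b. \<bar>c b\<bar>) ` B)"
    have M_ge: "\<bar>c b\<bar> \<le> M" if "b \<in> B" for b unfolding M_def using that B(1) by auto
    have "M \<in> (\<lambda>b. \<bar>c b\<bar>) ` B" unfolding M_def using B(1) False by (intro Max_in) auto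
    then obtain b0 where b0: "b0 \<in> B" "M = \<bar>c b0\<bar>" by auto
    show ?thesis
    proof (cases "M = 0")
      case True
      then show ?thesis using M_ge[OF b] norm_on_nonneg[OF n vec, of c] by (simp add: F_def)
    next
      case False
      then have M: "M > 0" using b0 by auto
      define c' where "c' = (\<lambda>b\<in>B. c b / M)"
      have "c' \<in> PiE B (\<lambda>b. if b = b0 then {-1, 1} else {-1..1})"
      proof (intro PiE_I)
        fix b assume b: "b \<in> B"
        have "\<bar>c b / M\<bar> \<le> 1" using M_ge[OF b] M by (simp add: abs_divide)
        then have "c b / M \<in> {-1..1}" unfolding abs_le_iff atLeastAtMost_iff by linarith
        moreover have "\<bar>c b0 / M\<bar> = 1" using b0 M by (simp add: abs_divide)
        then have "c b0 / M \<in> {-1, 1}" unfolding insert_iff empty_iff by linarith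
        ultimately show "c' b \<in> (if b = b0 then {-1, 1} else {-1..1})"
          using b unfolding c'_def by (cases "b = b0") (simp_all only: restrict_apply if_True if_False simp_thms)
      qed (simp add: c'_def)
      from d(2)[OF b0(1) this] have "d b0 \<le> F c'" .
      also have "F c' = n (inverse M *\<^sub>R (\<Sum>b\<in>B. c b *\<^sub>R b))"
        unfolding F_def c'_def by (simp add: scaleR_sum_right divide_inverse mult.commute)
      also have "\<dots> = inverse M * F c" using norm_on_scale[OF n vec] M by (simp add: F_def)
      finally have "d b0 * M \<le> F c" using M by (simp add: field_simps)
      moreover have "d0 \<le> d b0" unfolding d0_def using b0 B(1) by auto
      then have "d0 * \<bar>c b\<bar> \<le> d b0 * M" using M_ge[OF b] d0 by (intro mult_mono) auto
      ultimately show ?thesis by linarith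
    qed
  qed
  then show ?thesis using d0 by (auto simp: F_def)
qed (auto intro: exI[of _ 1])

lemma finite_dimensional_basis:
  assumes "finite_dimensional X"
  obtains B where "finite B" "independent B" "B \<subseteq> topspace X" "topspace X \<subseteq> span B"
proof -
  obtain B0 where B0: "finite B0" "topspace X \<subseteq> span B0" using assms unfolding finite_dimensional_def by auto
  obtain B where B: "B \<subseteq> topspace X" "independent B" "topspace X \<subseteq> span B" by (rule maximal_independent_subset)
  have "finite B" using independent_span_bound[OF B0(1) B(2)] B B0 by auto
  then show ?thesis using that B by auto
qed

lemma finite_dimensional_linear_continuous:
  assumes X: "normable X" and Y: "normable Y" and fd: "finite_dimensional X" and T: "linear_map_on (topspace X) T"
    and TY: "\<And>x. x \<in> topspace X \<Longrightarrow> T x \<in> topspace Y"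
  shows "continuous_map X Y T"
proof -
  obtain m where m: "norm_on X m" using X unfolding normable_def by auto
  obtain n where n: "norm_on Y n" using Y unfolding normable_def by auto
  note sub = normable_subspace[OF X] and subY = normable_subspace[OF Y]
  obtain B where B: "finite B" "independent B" "B \<subseteq> topspace X" "topspace X \<subseteq> span B"
    by (rule finite_dimensional_basis[OF fd])
  obtain d where d: "d > 0" "\<And>c b. b \<in> B \<Longrightarrow> d * \<bar>c b\<bar> \<le> m (\<Sum>b\<in>B. c b *\<^sub>R b)"
    using coordinates_bounded[OF m B(1-3)] by blast
  have BX: "b \<in> topspace X" if "b \<in> B" for b using B(3) that by auto
  show ?thesis
  proof (rule linear_bounded_continuous[OF m n T TY])
    fix x assume x: "x \<in> topspace X"
    then obtain c where c: "x = (\<Sum>b\<in>B. c b *\<^sub>R b)" using B(4) span_finite[OF B(1)] by auto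
    have "T x = (\<Sum>b\<in>B. T (c b *\<^sub>R b))" unfolding c
      by (rule linear_map_on_sum[OF T sub B(1)]) (use BX subspace_scale[OF sub] in auto)
    also have "n \<dots> \<le> (\<Sum>b\<in>B. n (T (c b *\<^sub>R b)))"
      by (rule norm_on_sum[OF n B(1)]) (use TY BX subspace_scale[OF sub] in auto)
    also have "\<dots> = (\<Sum>b\<in>B. \<bar>c b\<bar> * n (T b))"
      by (intro sum.cong) (use BX TY in \<open>auto simp: linear_map_on_scale[OF T] norm_on_scale[OF n]\<close>)
    also have "\<dots> \<le> (\<Sum>b\<in>B. (m x / d) * n (T b))"
    proof (intro sum_mono mult_right_mono)
      fix b assume b: "b \<in> B"
      show "\<bar>c b\<bar> \<le> m x / d" using d(2)[OF b, of c] d(1) c by (simp add: pos_le_divide_eq mult.commute)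
      show "0 \<le> n (T b)" using norm_on_nonneg[OF n TY[OF BX[OF b]]] .
    qed
    also have "\<dots> = (\<Sum>b\<in>B. n (T b)) / d * m x" unfolding sum_distrib_left[symmetric] by simp
    finally show "n (T x) \<le> (\<Sum>b\<in>B. n (T b)) / d * m x" .
  qed
qed

lemma finite_dimensional_subtopology: "finite_dimensional X \<Longrightarrow> finite_dimensional (subtopology X S)"
  unfolding finite_dimensional_def by auto

lemma normable_closedin_zeros:
  assumes X: "normable X" and Y: "normable Y" and f: "continuous_map X Y f"
  shows "closedin X {x \<in> topspace X. f x = 0}"
proof -
  obtain n where n: "norm_on Y n" using Y unfolding normable_def by auto
  have zY: "0 \<in> topspace Y" using subspace_0[OF normable_subspace[OF Y]] .
  have "{y \<in> topspace Y. n y \<le> 0} = {0}"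
    using norm_on_zero_iff[OF n] norm_on_nonneg[OF n] zY by (auto simp: order_antisym_conv)
  then have "closedin Y {0}" using norm_on_closedin_cball[OF n, of 0] by simp
  from closedin_continuous_map_preimage[OF f this] show ?thesis by simp
qed

text \<open>
  Extend a basis of \<open>S\<close> and project along it; the projection is continuous because it is linear.
\<close>

lemma finite_dimensional_complement:
  fixes X :: "'a::real_vector topology"
  assumes X: "normable X" and fd: "finite_dimensional X" and S: "subspace S" "S \<subseteq> topspace X"
  shows "\<exists>L. topological_direct_sum X S L"
proof -
  note sub = normable_subspace[OF X]
  obtain B where B: "B \<subseteq> S" "independent B" "S \<subseteq> span B" by (rule maximal_independent_subset)
  obtain B' where B': "B \<subseteq> B'" "B' \<subseteq> topspace X" "independent B'" "topspace X \<subseteq> span B'"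
    by (rule maximal_independent_subset_extend[of B "topspace X"]) (use B S in auto)
  have SB: "S = span B" using B S(1) span_minimal by blast
  obtain p :: "'a \<Rightarrow> 'a" where p: "linear p" "\<And>b. b \<in> B' \<Longrightarrow> p b = (if b \<in> B then 0 else b)"
    using linear_independent_extend[OF B'(3), of "\<lambda>b. if b \<in> B then 0 else b"] by auto
  define L where "L = span (B' - B)"
  have pS: "p x = 0" if "x \<in> S" for x
    by (rule linear_eq_0_on_span[OF p(1), of B]) (use p(2) B'(1) that SB in auto)
  have pL: "p x = x" if "x \<in> L" for x
    by (rule linear_eq_on_span[OF p(1) linear_id[unfolded id_def], of "B' - B"]) (use p(2) that in \<open>auto simp: L_def\<close>)
  have "p ` span B' = span (p ` B')" using linear_span_image[OF p(1)] by simp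
  also have "\<dots> \<subseteq> L" unfolding L_def
    by (rule span_minimal) (use p(2) in \<open>auto intro: span_base span_zero\<close>)
  finally have p_in: "p x \<in> L" if "x \<in> topspace X" for x using that B'(4) by auto
  have lin: "linear (\<lambda>x. x - p x)" by (intro linear_compose_sub linear_id[unfolded id_def] p(1))
  have "(\<lambda>x. x - p x) ` span B' = span ((\<lambda>x. x - p x) ` B')" using linear_span_image[OF lin] by simp
  also have "\<dots> \<subseteq> S" unfolding SB
    by (rule span_minimal) (use p(2) in \<open>auto intro: span_base span_zero\<close>)
  finally have p_out: "x - p x \<in> S" if "x \<in> topspace X" for x using that B'(4) by auto
  have LX: "L \<subseteq> topspace X" unfolding L_def by (rule span_minimal[OF _ sub]) (use B'(2) in auto)
  have cont: "continuous_map X X p"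
    by (rule finite_dimensional_linear_continuous[OF X X fd])
      (use p(1) p_in LX in \<open>auto simp: linear_map_on_def linear_add linear_scale\<close>)
  have "S = {x \<in> topspace X. p x = 0}" using pS S(2) p_out by force
  then have closedS: "closedin X S" using normable_closedin_zeros[OF X X cont] by simp
  have cont': "continuous_map X X (\<lambda>x. x - p x)"
    by (rule continuous_map_diff[OF X continuous_map_id[unfolded id_def] cont])
  have "L = {x \<in> topspace X. x - p x = 0}" using pL LX p_in by force
  then have closedL: "closedin X L" using normable_closedin_zeros[OF X X cont'] by simp
  have "topological_direct_sum X S L"
    by (rule topological_direct_sumI[OF X S(1) closedS _ closedL cont])
      (use p_in p_out pS pL p(1) in \<open>auto simp: L_def linear_add\<close>)
  then show ?thesis by blast
qed

lemma subspace_linear_image: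
  assumes S: "subspace S" and T: "linear_map_on S T"
  shows "subspace (T ` S)"
  unfolding subspace_def
proof safe
  show "0 \<in> T ` S" using subspace_0[OF S] linear_map_on_zero[OF T S] by force
  fix x y assume "x \<in> S" "y \<in> S"
  then show "T x + T y \<in> T ` S" using linear_map_on_add[OF T, of x y] subspace_add[OF S] by (metis image_eqI)
next
  fix c x assume "x \<in> S"
  then show "c *\<^sub>R T x \<in> T ` S" using linear_map_on_scale[OF T, of x c] subspace_scale[OF S] by (metis image_eqI)
qed

text \<open>
  With a linear section \<open>S\<close> of \<open>T\<close> on its image, the image of an open set is a union of preimages under
  the continuous maps \<open>S + k\<close>, \<open>k\<close> in the kernel.
\<close>

lemma finite_dimensional_regular:
  assumes X: "normable X" and Y: "normable Y" and fd: "finite_dimensional X" "finite_dimensional Y"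
    and T: "linear_map_on (topspace X) T" and TY: "\<And>x. x \<in> topspace X \<Longrightarrow> T x \<in> topspace Y"
  shows "regular_operator X Y T"
proof -
  note sub = normable_subspace[OF X]
  define K where "K = {x \<in> topspace X. T x = 0}"
  define I where "I = T ` topspace X"
  have K: "subspace K" unfolding subspace_def K_def
    using subspace_0[OF sub] subspace_add[OF sub] subspace_scale[OF sub] linear_map_on_zero[OF T sub]
      linear_map_on_add[OF T] linear_map_on_scale[OF T] by auto
  obtain L where XKL: "topological_direct_sum X K L"
    using finite_dimensional_complement[OF X fd(1) K] by (auto simp: K_def)
  have I: "subspace I" "I \<subseteq> topspace Y" using subspace_linear_image[OF sub T] TY by (auto simp: I_def)
  obtain S where S: "\<And>x. x \<in> topspace X \<Longrightarrow> S (T x) = direct_sum_snd K L x" "linear_map_on I S"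
    using direct_sum_section[OF X T XKL[unfolded K_def]] unfolding K_def I_def by blast
  note dec = direct_sum_decompose[OF X XKL] and LX = direct_sum_subsets(2)[OF X XKL]
  have S_cont: "continuous_map (subtopology Y I) X S"
  proof (rule finite_dimensional_linear_continuous[OF normable_subtopology[OF Y I] X finite_dimensional_subtopology[OF fd(2)]])
    show "linear_map_on (topspace (subtopology Y I)) S" using S(2) I(2) by (simp add: Int_absorb1)
    show "S y \<in> topspace X" if "y \<in> topspace (subtopology Y I)" for y
      using that S(1) dec(1) LX by (auto simp: I_def)
  qed
  have "open_map X (subtopology Y I) T" unfolding open_map_def
  proof (intro allI impI)
    fix Op assume Op: "openin X Op"
    then have OpX: "Op \<subseteq> topspace X" by (rule openin_subset)
    have "T ` Op = (\<Union>k\<in>K. {y \<in> topspace (subtopology Y I). S y + k \<in> Op})"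
    proof safe
      fix x assume x: "x \<in> Op"
      then have xX: "x \<in> topspace X" using OpX by auto
      \<comment> \<open>The element of the kernel that recovers \<open>x\<close> is its \<open>K\<close>-component.\<close>
      have "S (T x) + (x - direct_sum_snd K L x) \<in> Op" using S(1)[OF xX] x by simp
      moreover have "T x \<in> topspace (subtopology Y I)" using xX TY by (auto simp: I_def)
      ultimately show "T x \<in> (\<Union>k\<in>K. {y \<in> topspace (subtopology Y I). S y + k \<in> Op})"
        using dec(2)[OF xX] by blast
    next
      fix y k assume k: "k \<in> K" and y: "y \<in> topspace (subtopology Y I)" and Sy: "S y + k \<in> Op"
      obtain x where x: "x \<in> topspace X" "y = T x" using y by (auto simp: I_def)
      have "direct_sum_snd K L x \<in> topspace X" using dec(1)[OF x(1)] LX by auto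
      then have "T (S y) = y"
        using dec(2)[OF x(1)] linear_map_on_diff[OF T sub x(1)] S(1)[OF x(1)] x by (auto simp: K_def)
      moreover have "S y \<in> topspace X" using S(1)[OF x(1)] dec(1)[OF x(1)] LX x by auto
      ultimately have "T (S y + k) = y" using k linear_map_on_add[OF T] by (auto simp: K_def)
      then show "y \<in> T ` Op" using Sy by force
    qed
    moreover have "openin (subtopology Y I) {y \<in> topspace (subtopology Y I). S y + k \<in> Op}" if k: "k \<in> K" for k
    proof (rule openin_continuous_map_preimage[OF _ Op])
      show "continuous_map (subtopology Y I) X (\<lambda>y. S y + k)"
        by (rule continuous_map_add[OF X S_cont]) (use k in \<open>auto simp: K_def\<close>)
    qed
    ultimately show "openin (subtopology Y I) (T ` Op)" by auto
  qed
  moreover have "\<exists>C. topological_direct_sum Y I C" by (rule finite_dimensional_complement[OF Y fd(2) I])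
  ultimately show ?thesis
    unfolding regular_operator_def
    using T finite_dimensional_linear_continuous[OF X Y fd(1) T TY] XKL unfolding K_def I_def by blast
qed

section \<open>Charts\<close>

lemma is_chartD:
  assumes "is_chart M c"
  shows "openin M (cdom c)" "locally_convex_space (cmodel c)" "openin (cmodel c) (cmap c ` cdom c)"
    "homeomorphic_map (subtopology M (cdom c)) (subtopology (cmodel c) (cmap c ` cdom c)) (cmap c)"
  using assms unfolding is_chart_def by auto

lemma is_chart_subset: "is_chart M c \<Longrightarrow> cdom c \<subseteq> topspace M"
  by (rule openin_subset[OF is_chartD(1)])

lemma is_chart_inj:
  assumes c: "is_chart M c" shows "inj_on (cmap c) (cdom c)"
  using homeomorphic_imp_injective_map[OF is_chartD(4)[OF c]] is_chart_subset[OF c] by (simp add: Int_absorb1)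

lemma chart_inverse: "is_chart M c \<Longrightarrow> p \<in> cdom c \<Longrightarrow> inv_into (cdom c) (cmap c) (cmap c p) = p"
  by (rule inv_into_f_f[OF is_chart_inj])

lemma local_rep_cmap: "is_chart M c \<Longrightarrow> p \<in> cdom c \<Longrightarrow> local_rep c f d (cmap c p) = cmap d (f p)"
  by (simp add: local_rep_def chart_inverse)

lemma cmap_topspace: "is_chart M c \<Longrightarrow> p \<in> cdom c \<Longrightarrow> cmap c p \<in> topspace (cmodel c)"
  using openin_subset[OF is_chartD(3), of M c] by auto

lemma cmap_in_image_iff:
  "is_chart M c \<Longrightarrow> p \<in> cdom c \<Longrightarrow> D \<subseteq> cdom c \<Longrightarrow> cmap c p \<in> cmap c ` D \<longleftrightarrow> p \<in> D"
  by (rule inj_on_image_mem_iff[OF is_chart_inj])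

lemma cmap_continuous:
  assumes "is_chart M c" shows "continuous_map (subtopology M (cdom c)) (cmodel c) (cmap c)"
  using homeomorphic_imp_continuous_map[OF is_chartD(4)[OF assms]] unfolding continuous_map_in_subtopology by (rule conjunct1)

definition chart_change :: "('m, 'a) chart \<Rightarrow> 'a set \<Rightarrow> ('a \<Rightarrow> 'a) \<Rightarrow> ('m, 'a) chart" where
  "chart_change c \<Omega> \<phi> = \<lparr>cdom = {p \<in> cdom c. cmap c p \<in> \<Omega>}, cmap = (\<lambda>p. \<phi> (cmap c p)), cmodel = cmodel c\<rparr>"

lemma chart_change_simps [simp]:
  "cdom (chart_change c \<Omega> \<phi>) = {p \<in> cdom c. cmap c p \<in> \<Omega>}"
  "cmap (chart_change c \<Omega> \<phi>) = (\<lambda>p. \<phi> (cmap c p))"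
  "cmodel (chart_change c \<Omega> \<phi>) = cmodel c"
  by (simp_all add: chart_change_def)

context
  fixes M :: "'m topology" and A :: "('m, 'a::real_vector) chart set" and c :: "('m, 'a) chart" and \<Omega> \<Omega>' \<phi> \<psi>
  assumes c: "is_chart M c" and X: "normable (cmodel c)"
    and A: "\<And>d. d \<in> A \<Longrightarrow> is_chart M d" "\<And>d. d \<in> A \<Longrightarrow> normable (cmodel d)"
    and compat: "\<And>d. d \<in> A \<Longrightarrow> compatible_charts c d"
    and \<Omega>: "\<Omega> \<subseteq> cmap c ` cdom c" and diffeo: "diffeo_on (cmodel c) \<Omega> (cmodel c) \<Omega>' \<phi> \<psi>"
begin

lemma chart_change_smooth: "smooth_map_on (cmodel c) \<Omega> (cmodel c) \<phi>" "smooth_map_on (cmodel c) \<Omega>' (cmodel c) \<psi>"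
  using diffeo unfolding diffeo_on_def by auto

lemma chart_change_inverse: "x \<in> \<Omega> \<Longrightarrow> \<phi> x \<in> \<Omega>'" "x \<in> \<Omega> \<Longrightarrow> \<psi> (\<phi> x) = x" "y \<in> \<Omega>' \<Longrightarrow> \<psi> y \<in> \<Omega>" "y \<in> \<Omega>' \<Longrightarrow> \<phi> (\<psi> y) = y"
  using diffeo unfolding diffeo_on_def by auto

lemma chart_change_image: "(\<lambda>p. \<phi> (cmap c p)) ` {p \<in> cdom c. cmap c p \<in> \<Omega>} = \<Omega>'"
proof safe
  fix y assume y: "y \<in> \<Omega>'"
  then obtain p where "p \<in> cdom c" "\<psi> y = cmap c p" using chart_change_inverse(3) \<Omega> by blast
  then show "y \<in> (\<lambda>p. \<phi> (cmap c p)) ` {p \<in> cdom c. cmap c p \<in> \<Omega>}"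
    using chart_change_inverse(3,4)[OF y] by (intro image_eqI[of _ _ p]) auto
qed (rule chart_change_inverse(1))

lemma is_chart_chart_change: "is_chart M (chart_change c \<Omega> \<phi>)"
  unfolding is_chart_def chart_change_simps chart_change_image
proof (intro conjI)
  let ?D = "{p \<in> cdom c. cmap c p \<in> \<Omega>}"
  have open\<Omega>: "openin (cmodel c) \<Omega>" and open\<Omega>': "openin (cmodel c) \<Omega>'"
    using chart_change_smooth smooth_map_on_openin by auto
  have Dc: "openin M (cdom c)" using c unfolding is_chart_def by auto
  show "openin M ?D" by (rule continuous_map_preimage_open[OF Dc cmap_continuous[OF c] open\<Omega>])
  show "locally_convex_space (cmodel c)" using c unfolding is_chart_def by auto
  show "openin (cmodel c) \<Omega>'" by (rule open\<Omega>')
  have h: "homeomorphic_map (subtopology M (cdom c)) (subtopology (cmodel c) (cmap c ` cdom c)) (cmap c)"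
    using c unfolding is_chart_def by auto
  have "homeomorphic_map (subtopology (subtopology M (cdom c)) ?D) (subtopology (subtopology (cmodel c) (cmap c ` cdom c)) \<Omega>) (cmap c)"
    by (rule homeomorphic_map_subtopologies[OF h])
      (use \<Omega> is_chart_subset[OF c] openin_subset[OF open\<Omega>] in auto)
  moreover have "subtopology (subtopology M (cdom c)) ?D = subtopology M ?D"
    by (simp add: subtopology_subtopology Int_absorb1 subset_iff)
  moreover have "subtopology (subtopology (cmodel c) (cmap c ` cdom c)) \<Omega> = subtopology (cmodel c) \<Omega>"
    using \<Omega> by (simp add: subtopology_subtopology Int_absorb1)
  ultimately have h1: "homeomorphic_map (subtopology M ?D) (subtopology (cmodel c) \<Omega>) (cmap c)" by simp
  have "homeomorphic_maps (subtopology (cmodel c) \<Omega>) (subtopology (cmodel c) \<Omega>') \<phi> \<psi>"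
    unfolding homeomorphic_maps_def
    using smooth_map_on_continuous_map[OF chart_change_smooth(1)] smooth_map_on_continuous_map[OF chart_change_smooth(2)]
      chart_change_inverse by (auto simp: continuous_map_in_subtopology)
  then have h2: "homeomorphic_map (subtopology (cmodel c) \<Omega>) (subtopology (cmodel c) \<Omega>') \<phi>"
    by (rule homeomorphic_maps_imp_map)
  from homeomorphic_map_compose[OF h1 h2]
  show "homeomorphic_map (subtopology M ?D) (subtopology (cmodel c) \<Omega>') (\<lambda>p. \<phi> (cmap c p))"
    by (simp add: o_def)
qed

text \<open>
  The new transition maps are the old ones composed with \<open>\<psi>\<close> and \<open>\<phi>\<close>, on domains which are preimages
  of open sets under continuous maps.
\<close>

lemma compatible_charts_chart_change:
  assumes d: "d \<in> A"
  shows "compatible_charts (chart_change c \<Omega> \<phi>) d"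
  unfolding compatible_charts_def chart_change_simps
proof (intro conjI)
  let ?X = "cmodel c" and ?Y = "cmodel d" and ?D = "{p \<in> cdom c. cmap c p \<in> \<Omega>}"
  note Y = A(2)[OF d] and dM = A(1)[OF d]
  have cd: "smooth_map_on ?X (cmap c ` (cdom c \<inter> cdom d)) ?Y (local_rep c id d)"
    and dc: "smooth_map_on ?Y (cmap d ` (cdom c \<inter> cdom d)) ?X (local_rep d id c)"
    using compat[OF d] unfolding compatible_charts_def by auto
  have open\<Omega>: "openin ?X \<Omega>" and open\<Omega>': "openin ?X \<Omega>'"
    using chart_change_smooth smooth_map_on_openin by auto
  define E where "E = {y \<in> \<Omega>'. \<psi> y \<in> cmap c ` (cdom c \<inter> cdom d)}"
  have openE: "openin ?X E" unfolding E_def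
    by (rule continuous_map_preimage_open[OF open\<Omega>' smooth_map_on_continuous_map[OF chart_change_smooth(2)] smooth_map_on_openin[OF cd]])
  have E: "(\<lambda>p. \<phi> (cmap c p)) ` (?D \<inter> cdom d) = E"
  proof safe
    fix p assume "p \<in> cdom c" "cmap c p \<in> \<Omega>" "p \<in> cdom d"
    then show "\<phi> (cmap c p) \<in> E" using chart_change_inverse(1,2) by (auto simp: E_def)
  next
    fix y assume "y \<in> E"
    then obtain p where p: "y \<in> \<Omega>'" "\<psi> y = cmap c p" "p \<in> cdom c" "p \<in> cdom d" by (auto simp: E_def)
    then show "y \<in> (\<lambda>p. \<phi> (cmap c p)) ` (?D \<inter> cdom d)"
      using chart_change_inverse(3,4)[OF p(1)] by (intro image_eqI[of _ _ p]) auto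
  qed
  have "smooth_map_on ?X E ?Y (\<lambda>y. local_rep c id d (\<psi> y))"
    by (rule smooth_map_on_compose[OF X X Y smooth_map_on_subset_cong[OF X X chart_change_smooth(2) openE _ refl] cd])
      (auto simp: E_def)
  then show "smooth_map_on ?X ((\<lambda>p. \<phi> (cmap c p)) ` (?D \<inter> cdom d)) ?Y (local_rep (chart_change c \<Omega> \<phi>) id d)"
    unfolding E
  proof (rule smooth_map_on_cong[OF X Y])
    fix y assume "y \<in> E"
    then obtain p where p: "p \<in> cdom c" "cmap c p \<in> \<Omega>" "y = \<phi> (cmap c p)" using E by blast
    then show "local_rep (chart_change c \<Omega> \<phi>) id d y = local_rep c id d (\<psi> y)"
      using local_rep_cmap[OF is_chart_chart_change, of p id d] local_rep_cmap[OF c p(1), of id d] chart_change_inverse(2)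
      by simp
  qed
  define F where "F = {z \<in> cmap d ` (cdom c \<inter> cdom d). local_rep d id c z \<in> \<Omega>}"
  have openF: "openin ?Y F" unfolding F_def
    by (rule continuous_map_preimage_open[OF smooth_map_on_openin[OF dc] smooth_map_on_continuous_map[OF dc] open\<Omega>])
  have F: "cmap d ` (?D \<inter> cdom d) = F"
    using local_rep_cmap[OF dM, where f = id and d = c] by (auto simp: F_def)
  have "smooth_map_on ?Y F ?X (\<lambda>z. \<phi> (local_rep d id c z))"
    by (rule smooth_map_on_compose[OF Y X X smooth_map_on_subset_cong[OF Y X dc openF _ refl] chart_change_smooth(1)])
      (auto simp: F_def)
  then show "smooth_map_on ?Y (cmap d ` (?D \<inter> cdom d)) ?X (local_rep d id (chart_change c \<Omega> \<phi>))"
    unfolding F by (rule smooth_map_on_cong[OF Y X]) (simp add: local_rep_def)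
qed

end

lemma diffeo_on_translation:
  assumes X: "normable X" and U: "openin X U" and a: "a \<in> topspace X"
  shows "diffeo_on X U X {y \<in> topspace X. y + a \<in> U} (\<lambda>x. x - a) (\<lambda>y. y + a)"
proof -
  note sub = normable_subspace[OF X] have UX: "U \<subseteq> topspace X" using openin_subset[OF U] .
  have "continuous_map X X (\<lambda>y. y + a)"
    by (rule continuous_map_add[OF X continuous_map_id[unfolded id_def]]) (use a in auto)
  then have V: "openin X {y \<in> topspace X. y + a \<in> U}" (is "openin X ?V") by (rule openin_continuous_map_preimage[OF _ U])
  have "smooth_map_on X U X (\<lambda>x. x - a)"
    by (rule smooth_map_on_diff[OF X X smooth_map_on_id[OF X U] smooth_map_on_const[OF X X U a]])
  moreover have "smooth_map_on X ?V X (\<lambda>y. y + a)"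
    by (rule smooth_map_on_add[OF X X smooth_map_on_id[OF X V] smooth_map_on_const[OF X X V a]])
  ultimately show ?thesis
    unfolding diffeo_on_def using UX a subspace_diff[OF sub] by auto
qed

lemma banach_manifold_charts:
  assumes "banach_manifold M A" "c \<in> A"
  shows "is_chart M c" "banach_space (cmodel c)" "normable (cmodel c)" "\<And>d. d \<in> A \<Longrightarrow> compatible_charts c d"
  using assms banach_space_imp_normable[of "cmodel c"] unfolding banach_manifold_def smooth_manifold_def by auto

text \<open>
  A translation is a diffeomorphism of the model space, so the centred chart belongs to the maximal
  atlas.
\<close>

lemma centered_chart:
  assumes M: "banach_manifold M A" and c: "c \<in> A" and m: "m \<in> cdom c"
  defines "c' \<equiv> chart_change c (cmap c ` cdom c) (\<lambda>x. x - cmap c m)"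
  shows "is_chart M c'" "\<And>d. d \<in> A \<Longrightarrow> compatible_charts c' d" "cmodel c' = cmodel c" "cdom c' = cdom c"
    "\<And>p. cmap c' p = cmap c p - cmap c m"
proof -
  note ch = banach_manifold_charts[OF M] note cc = ch[OF c]
  have op: "openin (cmodel c) (cmap c ` cdom c)" using cc(1) unfolding is_chart_def by auto
  note d = diffeo_on_translation[OF cc(3) op cmap_topspace[OF cc(1) m]]
  show "is_chart M c'" unfolding c'_def by (rule is_chart_chart_change[OF cc(1,3) ch(1,3) cc(4) _ d]) auto
  show "compatible_charts c' d" if "d \<in> A" for d
    unfolding c'_def by (rule compatible_charts_chart_change[OF cc(1,3) ch(1,3) cc(4) _ d that]) auto
qed (auto simp: c'_def)

text \<open>
  The two diffeomorphisms of the local normal form are used to modify charts centred at \<open>m\<close> and \<open>f m\<close>.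
\<close>

lemma normal_form_in_charts:
  assumes f: "smooth_manifold_map M A N B f" and M: "banach_manifold M A" and N: "banach_manifold N B"
    and c: "c \<in> A" "m \<in> cdom c" and d: "d \<in> B" "f m \<in> cdom d"
    and regular: "regular_operator (cmodel c) (cmodel d) (dir_deriv (cmodel d) (local_rep c f d) (cmap c m))"
  shows "can_be_brought_into_normal_form_at M A N B f m"
proof -
  let ?X = "cmodel c" and ?Y = "cmodel d"
  note chM = banach_manifold_charts[OF M] and chN = banach_manifold_charts[OF N]
  note X = chM(3)[OF c(1)] and Y = chN(3)[OF d(1)] and cM = chM(1)[OF c(1)] and dN = chN(1)[OF d(1)]
  define x0 where "x0 = cmap c m"
  define y0 where "y0 = cmap d (f m)"
  have x0: "x0 \<in> topspace ?X" and y0: "y0 \<in> topspace ?Y"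
    using cmap_topspace[OF cM c(2)] cmap_topspace[OF dN d(2)] by (auto simp: x0_def y0_def)
  note subX = normable_subspace[OF X] and subY = normable_subspace[OF Y]
  define c0 where "c0 = chart_change c (cmap c ` cdom c) (\<lambda>x. x - cmap c m)"
  define d0 where "d0 = chart_change d (cmap d ` cdom d) (\<lambda>y. y - cmap d (f m))"
  note c0 = centered_chart[OF M c, folded c0_def x0_def] and d0 = centered_chart[OF N d, folded d0_def y0_def]

  define G where "G = cmap c ` {p \<in> cdom c. f p \<in> cdom d}"
  have lr: "smooth_map_on ?X G ?Y (local_rep c f d)"
    using f c d unfolding smooth_manifold_map_def G_def by auto
  define W where "W = {x \<in> topspace ?X. x + x0 \<in> G}"
  define g where "g x = local_rep c f d (x + x0) - y0" for x
  have tr: "diffeo_on ?X G ?X W (\<lambda>x. x - x0) (\<lambda>y. y + x0)"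
    unfolding W_def by (rule diffeo_on_translation[OF X smooth_map_on_openin[OF lr] x0])
  then have tr': "smooth_map_on ?X W ?X (\<lambda>y. y + x0)" "(\<lambda>y. y + x0) ` W \<subseteq> G" by (auto simp: diffeo_on_def)
  have g_smooth: "smooth_map_on ?X W ?Y g"
    unfolding g_def[abs_def]
    by (rule smooth_map_on_diff[OF X Y smooth_map_on_compose[OF X X Y tr'(1) lr tr'(2)]
          smooth_map_on_const[OF X Y smooth_map_on_openin[OF tr'(1)] y0]])
  have W0: "0 \<in> W" using c d x0 subspace_0[OF subX] by (auto simp: W_def G_def x0_def)
  have g_eq: "g (cmap c0 p) = cmap d0 (f p)" if "p \<in> cdom c" for p
    using local_rep_cmap[OF cM that] by (simp add: g_def c0(5) d0(5))
  have g0: "g 0 = 0" using local_rep_cmap[OF cM c(2), of f d] by (simp add: g_def x0_def y0_def)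
  have inW: "p \<in> cdom c \<and> f p \<in> cdom d" if "p \<in> cdom c" "cmap c0 p \<in> W" for p
    using that cmap_in_image_iff[OF cM, of p "{p \<in> cdom c. f p \<in> cdom d}"] by (auto simp: W_def G_def c0(5))
  have W_image: "W \<subseteq> cmap c0 ` cdom c0"
  proof
    fix x assume "x \<in> W"
    then obtain p where "p \<in> cdom c" "x + x0 = cmap c p" by (auto simp: W_def G_def)
    then have "p \<in> cdom c" "x = cmap c0 p" by (auto simp: c0(5) algebra_simps)
    then show "x \<in> cmap c0 ` cdom c0" unfolding c0(4) by auto
  qed
  define V0 where "V0 = cmap d0 ` cdom d0"
  have V0: "openin ?Y V0" using d0(1,3) unfolding is_chart_def V0_def by auto
  have gV0: "g ` W \<subseteq> V0"
  proof safe
    fix x assume x: "x \<in> W"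
    then obtain p where p: "p \<in> cdom c" "x = cmap c0 p" using W_image c0(4) by auto
    then show "g x \<in> V0" using inW[of p] x g_eq[OF p(1)] d0(4) by (auto simp: V0_def)
  qed
  have "has_dir_deriv ?Y g 0 v = has_dir_deriv ?Y (local_rep c f d) x0 v" for v
    unfolding has_dir_deriv_def g_def by (simp add: add.commute fun_eq_iff)
  then have "dir_deriv ?Y g 0 v = dir_deriv ?Y (local_rep c f d) x0 v" for v
    unfolding dir_deriv_def by simp
  then have "dir_deriv ?Y g 0 = dir_deriv ?Y (local_rep c f d) x0" by (rule ext)
  then have reg: "regular_operator ?X ?Y (dir_deriv ?Y g 0)" using regular by (simp add: x0_def)
  have lcs: "locally_convex_space ?X" "locally_convex_space ?Y" using cM dN unfolding is_chart_def by auto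
  obtain Ker Coim Coker Img fhat U fsing \<Omega> \<phi> \<phi>' V V' \<rho> \<rho>'
    where nf: "abstract_normal_form ?X Ker Coim ?Y Coker Img fhat U fsing"
      and \<Omega>: "0 \<in> \<Omega>" "\<Omega> \<subseteq> W" and \<phi>: "diffeo_on ?X \<Omega> ?X U \<phi> \<phi>'" "\<phi> 0 = 0"
      and V: "V \<subseteq> V0" and \<rho>: "diffeo_on ?Y V ?Y V' \<rho> \<rho>'" "\<rho> 0 = 0" and g\<Omega>: "g ` \<Omega> \<subseteq> V"
      and eq: "\<And>x. x \<in> \<Omega> \<Longrightarrow> \<rho> (g x) = normal_form_map Ker Coim fhat fsing (\<phi> x)"
    by (rule local_normal_form[OF lcs chM(2)[OF c(1)] Y g_smooth W0 g0 gV0 V0 reg]) (rule that)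
  define c1 where "c1 = chart_change c0 \<Omega> \<phi>"
  define d1 where "d1 = chart_change d0 V \<rho>"
  have \<Omega>c: "\<Omega> \<subseteq> cmap c0 ` cdom c0" using \<Omega> W_image by auto
  have Vd: "V \<subseteq> cmap d0 ` cdom d0" using V by (simp add: V0_def)
  note X0 = X[folded c0(3)] and Y0 = Y[folded d0(3)] and \<phi>0 = \<phi>(1)[folded c0(3)] and \<rho>0 = \<rho>(1)[folded d0(3)]
  have c1: "is_chart M c1" "\<And>e. e \<in> A \<Longrightarrow> compatible_charts c1 e"
    unfolding c1_def
    by (rule is_chart_chart_change[OF c0(1) X0 chM(1,3) c0(2) \<Omega>c \<phi>0], assumption+)
      (rule compatible_charts_chart_change[OF c0(1) X0 chM(1,3) c0(2) \<Omega>c \<phi>0], assumption+)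
  have d1: "is_chart N d1" "\<And>e. e \<in> B \<Longrightarrow> compatible_charts d1 e"
    unfolding d1_def
    by (rule is_chart_chart_change[OF d0(1) Y0 chN(1,3) d0(2) Vd \<rho>0], assumption+)
      (rule compatible_charts_chart_change[OF d0(1) Y0 chN(1,3) d0(2) Vd \<rho>0], assumption+)
  have image: "cmap c1 ` cdom c1 = U"
    unfolding c1_def chart_change_simps
    by (rule chart_change_image[OF c0(1) X0 chM(1,3) c0(2) \<Omega>c \<phi>0], assumption+)
  have cm0: "cmap c0 m = 0" "cmap d0 (f m) = 0" by (simp_all add: c0(5) d0(5) x0_def y0_def)
  have mc1: "m \<in> cdom c1" using c(2) \<Omega>(1) cm0 by (simp add: c1_def c0(4))
  have dom: "f p \<in> cdom d1 \<and> cmap d1 (f p) = normal_form_map Ker Coim fhat fsing (cmap c1 p)" if "p \<in> cdom c1" for p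
  proof -
    have p: "p \<in> cdom c" "cmap c0 p \<in> \<Omega>" using that by (auto simp: c1_def c0(4))
    have "cmap d0 (f p) \<in> V" using subsetD[OF g\<Omega> imageI[OF p(2)]] g_eq[OF p(1)] by simp
    moreover have "f p \<in> cdom d" using inW[OF p(1)] p(2) \<Omega>(2) by auto
    ultimately show ?thesis using eq[OF p(2)] g_eq[OF p(1)] by (simp add: d1_def c1_def d0(4))
  qed
  have "chart_at M A m c1"
    unfolding chart_at_def using c1 mc1 cm0 \<phi>(2) by (simp add: c1_def)
  moreover have "chart_at N B (f m) d1"
    unfolding chart_at_def using d1 dom[OF mc1] cm0 \<rho>(2) by (simp add: d1_def)
  moreover have "cmodel c1 = ?X" "cmodel d1 = ?Y" by (simp_all add: c1_def d1_def c0(3) d0(3))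
  moreover have "f ` cdom c1 \<subseteq> cdom d1" using dom by blast
  moreover have "\<forall>p\<in>cdom c1. cmap d1 (f p) = normal_form_map Ker Coim fhat fsing (cmap c1 p)" using dom by blast
  ultimately show ?thesis
    unfolding can_be_brought_into_normal_form_at_def using nf image by blast
qed

section \<open>Tangent spaces\<close>

lemma charts_around_nonempty:
  assumes "banach_manifold M A" "m \<in> topspace M"
  shows "\<exists>c. c \<in> charts_around A m"
  using assms unfolding banach_manifold_def smooth_manifold_def charts_around_def by auto

lemma tangent_vectorsD:
  assumes "v \<in> tangent_vectors A m"
  shows "c \<notin> charts_around A m \<Longrightarrow> v c = 0" "c \<in> charts_around A m \<Longrightarrow> v c \<in> topspace (cmodel c)"
    "c \<in> charts_around A m \<Longrightarrow> d \<in> charts_around A m \<Longrightarrow>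
       v d = dir_deriv (cmodel d) (local_rep c id d) (cmap c m) (v c)"
  using assms unfolding tangent_vectors_def by blast+

lemma topspace_tangent_space:
  assumes "c \<in> charts_around A m"
  shows "topspace (tangent_space A m) = tangent_vectors A m"
proof -
  let ?G = "{{v \<in> tangent_vectors A m. v c \<in> W} |c W. c \<in> charts_around A m \<and> openin (cmodel c) W}"
  have "\<Union>?G \<subseteq> tangent_vectors A m"
  proof (rule Union_least)
    fix S assume "S \<in> ?G"
    then obtain c W where "S = {v \<in> tangent_vectors A m. v c \<in> W}" unfolding mem_Collect_eq by (elim exE conjE)
    then show "S \<subseteq> tangent_vectors A m" by simp
  qed
  moreover have "{v \<in> tangent_vectors A m. v c \<in> topspace (cmodel c)} \<in> ?G"
    unfolding mem_Collect_eq using assms openin_topspace by (intro exI conjI) (rule refl)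
  then have "{v \<in> tangent_vectors A m. v c \<in> topspace (cmodel c)} \<subseteq> \<Union>?G" by (rule Union_upper)
  moreover have "tangent_vectors A m \<subseteq> {v \<in> tangent_vectors A m. v c \<in> topspace (cmodel c)}"
    by (intro subsetI CollectI conjI tangent_vectorsD(2)[OF _ assms])
  ultimately show ?thesis
    unfolding tangent_space_def topology_generated_by_topspace by simp
qed

text \<open>
  The tangent vector with component \<open>w\<close> in the chart \<open>c\<close>; its other components are forced by the
  transformation rule.
\<close>

definition tangent_vector_of :: "('m, 'a::real_vector) chart set \<Rightarrow> 'm \<Rightarrow> ('m, 'a) chart \<Rightarrow> 'a \<Rightarrow> ('m, 'a) chart \<Rightarrow> 'a" where
  "tangent_vector_of A m c w =
     (\<lambda>d. if d \<in> charts_around A m then dir_deriv (cmodel d) (local_rep c id d) (cmap c m) w else 0)"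

context
  fixes M :: "'m topology" and A :: "('m, 'a::real_vector) chart set" and m :: 'm
  assumes M: "banach_manifold M A"
begin

lemma charts_aroundD:
  assumes "c \<in> charts_around A m"
  shows "c \<in> A" "m \<in> cdom c" "is_chart M c" "normable (cmodel c)"
  using assms banach_manifold_charts[OF M] by (auto simp: charts_around_def)

lemma transition_smooth:
  assumes c: "c \<in> charts_around A m" and d: "d \<in> charts_around A m"
  shows "smooth_map_on (cmodel c) (cmap c ` (cdom c \<inter> cdom d)) (cmodel d) (local_rep c id d)"
    "cmap c m \<in> cmap c ` (cdom c \<inter> cdom d)"
  using banach_manifold_charts(4)[OF M charts_aroundD(1)[OF c] charts_aroundD(1)[OF d]]
    charts_aroundD(2)[OF c] charts_aroundD(2)[OF d] by (auto simp: compatible_charts_def)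

lemma transition_deriv_topspace:
  assumes "c \<in> charts_around A m" "d \<in> charts_around A m" "w \<in> topspace (cmodel c)"
  shows "dir_deriv (cmodel d) (local_rep c id d) (cmap c m) w \<in> topspace (cmodel d)"
  using has_dir_deriv_topspace[OF smooth_has_dir_deriv1[OF charts_aroundD(4)[OF assms(2)] transition_smooth[OF assms(1,2)] assms(3)]] .

text \<open>
  The chain rule for chart changes: the family of components obtained from one chart is consistent
  between any two other charts.
\<close>

lemma transition_deriv_compose:
  assumes c: "c \<in> charts_around A m" and d: "d \<in> charts_around A m" and e: "e \<in> charts_around A m"
    and w: "w \<in> topspace (cmodel c)"
  shows "dir_deriv (cmodel e) (local_rep d id e) (cmap d m) (dir_deriv (cmodel d) (local_rep c id d) (cmap c m) w)
    = dir_deriv (cmodel e) (local_rep c id e) (cmap c m) w"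
proof -
  let ?X = "cmodel c" and ?Y = "cmodel d" and ?Z = "cmodel e"
  note C = charts_aroundD[OF c] and D = charts_aroundD[OF d] and E = charts_aroundD[OF e]
  define U where "U = {x \<in> cmap c ` (cdom c \<inter> cdom d). local_rep c id d x \<in> cmap d ` (cdom d \<inter> cdom e)}"
  note cd = transition_smooth[OF c d] and de = transition_smooth[OF d e]
  have m: "local_rep c id d (cmap c m) = cmap d m" using local_rep_cmap[OF C(3,2), of id d] by simp
  have U: "openin ?X U" unfolding U_def
    by (rule continuous_map_preimage_open[OF smooth_map_on_openin[OF cd(1)] smooth_map_on_continuous_map[OF cd(1)]
          smooth_map_on_openin[OF de(1)]])
  have mU: "cmap c m \<in> U" using cd(2) de(2) m by (simp add: U_def)
  have "has_dir_deriv ?Z (\<lambda>x. local_rep d id e (local_rep c id d x)) (cmap c m) w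
      (dir_deriv ?Z (local_rep d id e) (local_rep c id d (cmap c m)) (dir_deriv ?Y (local_rep c id d) (cmap c m) w))"
    by (rule has_dir_deriv_chain[OF D(4) E(4) de(1) smooth_has_dir_deriv1[OF D(4) cd w]]) (use m de(2) in simp)
  then have "has_dir_deriv ?Z (local_rep c id e) (cmap c m) w
      (dir_deriv ?Z (local_rep d id e) (local_rep c id d (cmap c m)) (dir_deriv ?Y (local_rep c id d) (cmap c m) w))"
  proof (rule has_dir_deriv_cong[OF C(4) U mU w, rotated])
    fix x assume "x \<in> U"
    then obtain p where p: "p \<in> cdom c" "p \<in> cdom d" "x = cmap c p" by (auto simp: U_def)
    then show "local_rep d id e (local_rep c id d x) = local_rep c id e x"
      by (simp add: local_rep_cmap[OF C(3) p(1)] local_rep_cmap[OF D(3) p(2)])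
  qed
  from dir_deriv_eq[OF E(4) this] show ?thesis by (simp add: m)
qed

lemma transition_deriv_self:
  assumes c: "c \<in> charts_around A m" and w: "w \<in> topspace (cmodel c)"
  shows "dir_deriv (cmodel c) (local_rep c id c) (cmap c m) w = w"
proof (rule dir_deriv_eq[OF charts_aroundD(4)[OF c]])
  note C = charts_aroundD[OF c]
  have U: "openin (cmodel c) (cmap c ` cdom c)" using C(3) unfolding is_chart_def by auto
  have "has_dir_deriv (cmodel c) (\<lambda>x. x) (cmap c m) w w"
    unfolding has_dir_deriv_def by (rule limitin_eventually[OF w]) (auto simp: eventually_at_filter)
  then show "has_dir_deriv (cmodel c) (local_rep c id c) (cmap c m) w w"
    by (rule has_dir_deriv_cong[OF C(4) U imageI[OF C(2)] w, rotated])
      (auto simp: local_rep_cmap[OF C(3)])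
qed

lemma tangent_vector_of_in:
  assumes c: "c \<in> charts_around A m" and w: "w \<in> topspace (cmodel c)"
  shows "tangent_vector_of A m c w \<in> tangent_vectors A m"
proof -
  let ?v = "tangent_vector_of A m c w"
  have v: "?v d = dir_deriv (cmodel d) (local_rep c id d) (cmap c m) w" if "d \<in> charts_around A m" for d
    using that by (simp add: tangent_vector_of_def)
  show ?thesis
    unfolding tangent_vectors_def mem_Collect_eq
  proof (intro conjI ballI allI impI)
    show "?v d = 0" if "d \<notin> charts_around A m" for d using that by (simp add: tangent_vector_of_def)
    show "?v d \<in> topspace (cmodel d)" if "d \<in> charts_around A m" for d
      unfolding v[OF that] by (rule transition_deriv_topspace[OF c that w])
    show "?v e = dir_deriv (cmodel e) (local_rep d id e) (cmap d m) (?v d)"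
      if "d \<in> charts_around A m" "e \<in> charts_around A m" for d e
      unfolding v[OF that(1)] v[OF that(2)] by (rule transition_deriv_compose[OF c that w, symmetric])
  qed
qed

lemma tangent_vector_of_eval:
  assumes c: "c \<in> charts_around A m" and v: "v \<in> tangent_vectors A m"
  shows "tangent_vector_of A m c (v c) = v"
proof
  fix d show "tangent_vector_of A m c (v c) d = v d"
    using tangent_vectorsD(1)[OF v, of d] tangent_vectorsD(3)[OF v c, of d]
    by (cases "d \<in> charts_around A m") (simp_all only: tangent_vector_of_def if_True if_False simp_thms)
qed

text \<open>
  Evaluation is continuous by definition of the topology; its inverse is, because every component
  depends continuously on \<open>w\<close> through the derivative of a chart change.
\<close>

lemma tangent_space_homeomorphic:
  assumes c: "c \<in> charts_around A m"
  shows "homeomorphic_maps (tangent_space A m) (cmodel c) (\<lambda>v. v c) (tangent_vector_of A m c)"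
  unfolding homeomorphic_maps_def topspace_tangent_space[OF c]
proof (intro conjI ballI)
  have comp: "v c \<in> topspace (cmodel c)" if "v \<in> tangent_vectors A m" for v
    by (rule tangent_vectorsD(2)[OF that c])
  show "continuous_map (tangent_space A m) (cmodel c) (\<lambda>v. v c)"
    unfolding continuous_map_def topspace_tangent_space[OF c]
  proof (intro conjI allI impI)
    fix W assume W: "openin (cmodel c) W"
    show "openin (tangent_space A m) {v \<in> tangent_vectors A m. v c \<in> W}"
      unfolding tangent_space_def
    proof (rule topology_generated_by_Basis, unfold mem_Collect_eq, intro exI conjI)
      show "{v \<in> tangent_vectors A m. v c \<in> W} = {v \<in> tangent_vectors A m. v c \<in> W}" by (rule refl)
    qed (rule c, rule W)
  qed (rule Pi_I, rule comp)
  show "continuous_map (cmodel c) (tangent_space A m) (tangent_vector_of A m c)"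
    unfolding tangent_space_def
  proof (rule continuous_on_generated_topo)
    fix G assume "G \<in> {{v \<in> tangent_vectors A m. v d \<in> W} |d W. d \<in> charts_around A m \<and> openin (cmodel d) W}"
    then obtain d W where dWG: "G = {v \<in> tangent_vectors A m. v d \<in> W} \<and> d \<in> charts_around A m \<and> openin (cmodel d) W"
      unfolding mem_Collect_eq by (elim exE)
    then have d: "d \<in> charts_around A m" and W: "openin (cmodel d) W"
      and G: "G = {v \<in> tangent_vectors A m. v d \<in> W}" by simp_all
    have "openin (cmodel c) {w \<in> topspace (cmodel c). dir_deriv (cmodel d) (local_rep c id d) (cmap c m) w \<in> W}"
      by (rule openin_continuous_map_preimage[OF smooth_dir_deriv_continuous[OF transition_smooth[OF c d]] W])
    moreover have "tangent_vector_of A m c -` G \<inter> topspace (cmodel c)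
      = {w \<in> topspace (cmodel c). dir_deriv (cmodel d) (local_rep c id d) (cmap c m) w \<in> W}"
    proof -
      have eval: "tangent_vector_of A m c w d = dir_deriv (cmodel d) (local_rep c id d) (cmap c m) w" for w
        using d by (simp only: tangent_vector_of_def if_True)
      have "tangent_vector_of A m c w \<in> G \<longleftrightarrow> dir_deriv (cmodel d) (local_rep c id d) (cmap c m) w \<in> W"
        if "w \<in> topspace (cmodel c)" for w
        unfolding G mem_Collect_eq eval using tangent_vector_of_in[OF c that] by simp
      then show ?thesis by (intro set_eqI) (simp add: conj_commute cong: conj_cong)
    qed
    ultimately show "openin (cmodel c) (tangent_vector_of A m c -` G \<inter> topspace (cmodel c))" by simp
  next
    have "tangent_vector_of A m c ` topspace (cmodel c) \<subseteq> topspace (tangent_space A m)"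
      unfolding topspace_tangent_space[OF c] by (rule image_subsetI) (rule tangent_vector_of_in[OF c])
    then show "tangent_vector_of A m c ` topspace (cmodel c)
      \<subseteq> \<Union> {{v \<in> tangent_vectors A m. v d \<in> W} |d W. d \<in> charts_around A m \<and> openin (cmodel d) W}"
      unfolding tangent_space_def topology_generated_by_topspace .
  qed
  show "tangent_vector_of A m c (v c) = v" if "v \<in> tangent_vectors A m" for v
    by (rule tangent_vector_of_eval[OF c that])
  show "tangent_vector_of A m c w c = w" if "w \<in> topspace (cmodel c)" for w
    using transition_deriv_self[OF c that] c by (simp only: tangent_vector_of_def if_True)
qed

end

text \<open>
  The addition map of the image decomposition is conjugate to the given one.
\<close>

lemma topological_direct_sum_transport:
  assumes e: "homeomorphic_maps S X e e'" and lin: "linear_map_on (topspace S) e"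
    and sum: "topological_direct_sum S K L"
  shows "topological_direct_sum X (e ` K) (e ` L)"
proof -
  have K: "subspace K" "closedin S K" and L: "subspace L" "closedin S L"
    and h: "homeomorphic_map (prod_topology (subtopology S K) (subtopology S L)) S (\<lambda>(k, l). k + l)"
    using sum unfolding topological_direct_sum_def by auto
  have KS: "K \<subseteq> topspace S" and LS: "L \<subseteq> topspace S" using K L closedin_subset by auto
  have hom: "homeomorphic_map S X e" and hom': "homeomorphic_maps X S e' e"
    using e homeomorphic_maps_imp_map homeomorphic_maps_sym by blast+
  have e'e: "e' (e v) = v" if "v \<in> topspace S" for v using e that by (auto simp: homeomorphic_maps_def)
  have eX: "e v \<in> topspace X" if "v \<in> topspace S" for v
    using homeomorphic_imp_surjective_map[OF hom] that by auto
  have sub: "subspace (e ` H)" if "subspace H" "H \<subseteq> topspace S" for H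
    by (rule subspace_linear_image[OF that(1)]) (use lin that(2) in \<open>auto simp: linear_map_on_def subset_iff\<close>)
  have closed: "closedin X (e ` H)" if "closedin S H" for H
    using homeomorphic_imp_closed_map[OF hom] that unfolding closed_map_def by auto
  have restr: "homeomorphic_map (subtopology X (e ` H)) (subtopology S H) e'" if "H \<subseteq> topspace S" for H
  proof (rule homeomorphic_map_subtopologies[OF homeomorphic_maps_imp_map[OF hom']])
    show "e' ` (topspace X \<inter> e ` H) = topspace S \<inter> H" using that e'e eX by force
  qed
  have "homeomorphic_map (prod_topology (subtopology X (e ` K)) (subtopology X (e ` L)))
      (prod_topology (subtopology S K) (subtopology S L)) (\<lambda>(k, l). (e' k, e' l))"
  proof -
    obtain a b where "homeomorphic_maps (subtopology X (e ` K)) (subtopology S K) e' a"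
      "homeomorphic_maps (subtopology X (e ` L)) (subtopology S L) e' b"
      using restr[OF KS] restr[OF LS] homeomorphic_map_maps by blast
    then have "homeomorphic_maps (prod_topology (subtopology X (e ` K)) (subtopology X (e ` L)))
      (prod_topology (subtopology S K) (subtopology S L)) (\<lambda>(k, l). (e' k, e' l)) (\<lambda>(k, l). (a k, b l))"
      using homeomorphic_maps_prod by blast
    then show ?thesis by (rule homeomorphic_maps_imp_map)
  qed
  from homeomorphic_map_compose[OF homeomorphic_map_compose[OF this h] hom]
  have "homeomorphic_map (prod_topology (subtopology X (e ` K)) (subtopology X (e ` L))) X (\<lambda>(k, l). k + l)"
  proof (rule homeomorphic_map_eq)
    fix z assume "z \<in> topspace (prod_topology (subtopology X (e ` K)) (subtopology X (e ` L)))"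
    then obtain k l where z: "z = (e k, e l)" "k \<in> K" "l \<in> L" by auto
    then show "(e \<circ> ((\<lambda>(k, l). k + l) \<circ> (\<lambda>(k, l). (e' k, e' l)))) z = (case z of (k, l) \<Rightarrow> k + l)"
      using KS LS e'e linear_map_on_add[OF lin, of k l] by (auto simp: subset_iff)
  qed
  then show ?thesis unfolding topological_direct_sum_def
    using sub[OF K(1) KS] sub[OF L(1) LS] closed[OF K(2)] closed[OF L(2)] by auto
qed

lemma regular_operator_transport:
  assumes e: "homeomorphic_maps S X e e'" "linear_map_on (topspace S) e"
    and d: "homeomorphic_maps R Y d d'" "linear_map_on (topspace R) d" and zero: "0 \<in> topspace R" "d 0 = 0"
    and T: "linear_map_on (topspace X) T" and comm: "\<And>v. v \<in> topspace S \<Longrightarrow> T (e v) = d (F v)"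
    and regular: "regular_operator S R F"
  shows "regular_operator X Y T"
proof -
  have F: "continuous_map S R F" "open_map S (subtopology R (F ` topspace S)) F"
    using regular unfolding regular_operator_def by auto
  have e': "continuous_map X S e'" and e'e: "\<And>v. v \<in> topspace S \<Longrightarrow> e' (e v) = v" and ee': "\<And>x. x \<in> topspace X \<Longrightarrow> e (e' x) = x"
    and dc: "continuous_map R Y d" and d'd: "\<And>v. v \<in> topspace R \<Longrightarrow> d' (d v) = v" and ec: "continuous_map S X e"
    using e(1) d(1) by (auto simp: homeomorphic_maps_def)
  have e'S: "e' x \<in> topspace S" if "x \<in> topspace X" for x using continuous_map_image_subset_topspace[OF e'] that by auto
  have FR: "F v \<in> topspace R" if "v \<in> topspace S" for v using continuous_map_image_subset_topspace[OF F(1)] that by auto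
  have eS: "e ` topspace S = topspace X"
    using homeomorphic_imp_surjective_map[OF homeomorphic_maps_imp_map[OF e(1)]] .
  have dinj: "v = w" if "v \<in> topspace R" "w \<in> topspace R" "d v = d w" for v w using d'd that by metis
  have TF: "T x = d (F (e' x))" if "x \<in> topspace X" for x using comm[OF e'S[OF that]] ee'[OF that] by simp
  have TX: "T ` topspace X = d ` (F ` topspace S)" using comm eS by (auto simp: image_image simp flip: eS)
  have "continuous_map X Y T"
    by (rule continuous_map_eq[OF continuous_map_compose[OF continuous_map_compose[OF e' F(1)] dc]]) (simp add: TF)
  moreover have "open_map X (subtopology Y (T ` topspace X)) T"
    unfolding open_map_def
  proof (intro allI impI)
    fix G assume G: "openin X G"
    then have GX: "G \<subseteq> topspace X" by (rule openin_subset)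
    have "openin S (e' ` G)"
      using homeomorphic_imp_open_map[OF homeomorphic_maps_imp_map[OF e(1)[unfolded homeomorphic_maps_sym[of S]]]] G
      unfolding open_map_def by auto
    then have "openin (subtopology R (F ` topspace S)) (F ` e' ` G)" using F(2) unfolding open_map_def by auto
    then obtain Z where Z: "openin R Z" "F ` e' ` G = Z \<inter> F ` topspace S" unfolding openin_subtopology by auto
    have dZ: "openin Y (d ` Z)"
      using homeomorphic_imp_open_map[OF homeomorphic_maps_imp_map[OF d(1)]] Z(1) unfolding open_map_def by auto
    have "T ` G = d ` (F ` e' ` G)" using TF GX by (force simp: image_image)
    also have "\<dots> = d ` Z \<inter> d ` (F ` topspace S)"
      unfolding Z(2) using dinj openin_subset[OF Z(1)] FR by fast
    finally show "openin (subtopology Y (T ` topspace X)) (T ` G)"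
      unfolding openin_subtopology TX using dZ by auto
  qed
  moreover have "\<exists>L. topological_direct_sum X {x \<in> topspace X. T x = 0} L"
  proof -
    obtain L where "topological_direct_sum S {v \<in> topspace S. F v = 0} L"
      using regular unfolding regular_operator_def by auto
    from topological_direct_sum_transport[OF e this]
    have "topological_direct_sum X (e ` {v \<in> topspace S. F v = 0}) (e ` L)" .
    moreover have "e ` {v \<in> topspace S. F v = 0} = {x \<in> topspace X. T x = 0}"
    proof safe
      fix v assume v: "v \<in> topspace S" "F v = 0"
      show "e v \<in> topspace X" using eS v by auto
      show "T (e v) = 0" using comm v zero by simp
    next
      fix x assume x: "x \<in> topspace X" "T x = 0"
      then have "F (e' x) = 0" using dinj[OF FR[OF e'S[OF x(1)]] zero(1)] TF zero by simp
      then show "x \<in> e ` {v \<in> topspace S. F v = 0}" using e'S[OF x(1)] ee'[OF x(1)] by (intro image_eqI[of _ _ "e' x"]) auto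
    qed
    ultimately show ?thesis by auto
  qed
  moreover have "\<exists>L. topological_direct_sum Y (T ` topspace X) L"
  proof -
    obtain L where "topological_direct_sum R (F ` topspace S) L"
      using regular unfolding regular_operator_def by auto
    from topological_direct_sum_transport[OF d this] show ?thesis unfolding TX by blast
  qed
  ultimately show ?thesis unfolding regular_operator_def using T by auto
qed

lemma local_rep_smooth:
  assumes "smooth_manifold_map M A N B f" "c \<in> charts_around A m" "d \<in> charts_around B (f m)"
  shows "smooth_map_on (cmodel c) (cmap c ` {p \<in> cdom c. f p \<in> cdom d}) (cmodel d) (local_rep c f d)"
    "cmap c m \<in> cmap c ` {p \<in> cdom c. f p \<in> cdom d}"
  using assms unfolding smooth_manifold_map_def charts_around_def by auto

text \<open>
  The tangent map is computed in a chart selected by a choice operator; this very chart is the one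
  returned here, so that evaluation intertwines the tangent map with the derivative of the local
  representative.
\<close>

lemma regular_tangent_map_in_charts:
  assumes f: "smooth_manifold_map M A N B f" and M: "banach_manifold M A" and N: "banach_manifold N B"
    and m: "m \<in> topspace M" and d: "d \<in> charts_around B (f m)"
    and regular: "regular_operator (tangent_space A m) (tangent_space B (f m)) (tangent_map A B f m)"
  obtains c where "c \<in> charts_around A m"
    "regular_operator (cmodel c) (cmodel d) (dir_deriv (cmodel d) (local_rep c f d) (cmap c m))"
proof -
  define c where "c = (SOME c. c \<in> charts_around A m)"
  have c: "c \<in> charts_around A m"
    unfolding c_def using charts_around_nonempty[OF M m] by (rule someI_ex)
  note C = charts_aroundD[OF M c] and D = charts_aroundD[OF N d]
  note sm = local_rep_smooth[OF f c d]
  have "regular_operator (cmodel c) (cmodel d) (dir_deriv (cmodel d) (local_rep c f d) (cmap c m))"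
  proof (rule regular_operator_transport[OF tangent_space_homeomorphic[OF M c] _ tangent_space_homeomorphic[OF N d] _ _ _ _ _ regular])
    show "linear_map_on (topspace (tangent_space A m)) (\<lambda>v. v c)" "linear_map_on (topspace (tangent_space B (f m))) (\<lambda>v. v d)"
      by (auto simp: linear_map_on_def scaleR_fun_def)
    show "0 \<in> topspace (tangent_space B (f m))"
    proof -
      have zY: "0 \<in> topspace (cmodel d)" using subspace_0[OF normable_subspace[OF D(4)]] .
      have "tangent_vector_of B (f m) d 0 = 0"
      proof
        fix e show "tangent_vector_of B (f m) d 0 e = 0 e"
        proof (cases "e \<in> charts_around B (f m)")
          case True
          note tr = transition_smooth[OF N d True]
          have "dir_deriv (cmodel e) (local_rep d id e) (cmap d (f m)) 0 = 0"
            by (rule linear_map_on_zero[OF smooth_dir_deriv_linear[OF D(4) charts_aroundD(4)[OF N True] tr] normable_subspace[OF D(4)]])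
          then show ?thesis by (simp add: tangent_vector_of_def)
        qed (simp add: tangent_vector_of_def)
      qed
      then show ?thesis using tangent_vector_of_in[OF N d zY] topspace_tangent_space[OF d] by simp
    qed
    show "linear_map_on (topspace (cmodel c)) (dir_deriv (cmodel d) (local_rep c f d) (cmap c m))"
      by (rule smooth_dir_deriv_linear[OF C(4) D(4) sm])
    show "dir_deriv (cmodel d) (local_rep c f d) (cmap c m) (v c) = tangent_map A B f m v d" for v
      using d by (simp add: tangent_map_def c_def[symmetric])
  qed simp
  then show ?thesis using that c by blast
qed

section \<open>Normal forms on manifolds\<close>

theorem theorem2p2p6:
  fixes M :: "'m topology" and A :: "('m, 'a::real_vector) chart set"
    and N :: "'n topology" and B :: "('n, 'b::real_vector) chart set"
    and f :: "'m \<Rightarrow> 'n"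
  assumes "smooth_manifold_map M A N B f"
  shows
    "(banach_manifold M A \<and> banach_manifold N B \<longrightarrow>
        (\<forall>m\<in>topspace M.
           regular_operator (tangent_space A m) (tangent_space B (f m)) (tangent_map A B f m) \<longrightarrow>
           can_be_brought_into_normal_form_at M A N B f m)) \<and>
     (finite_dimensional_manifold M A \<and> finite_dimensional_manifold N B \<longrightarrow>
        (\<forall>m\<in>topspace M. can_be_brought_into_normal_form_at M A N B f m))"
proof (intro conjI impI ballI; elim conjE)
  have fm: "f m \<in> topspace N" if "m \<in> topspace M" for m
    using assms that continuous_map_image_subset_topspace unfolding smooth_manifold_map_def by blast
  {
    fix m assume M: "banach_manifold M A" and N: "banach_manifold N B" and m: "m \<in> topspace M"
      and regular: "regular_operator (tangent_space A m) (tangent_space B (f m)) (tangent_map A B f m)"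
    obtain d where d: "d \<in> charts_around B (f m)" using charts_around_nonempty[OF N fm[OF m]] by blast
    obtain c where c: "c \<in> charts_around A m"
      and reg: "regular_operator (cmodel c) (cmodel d) (dir_deriv (cmodel d) (local_rep c f d) (cmap c m))"
      by (rule regular_tangent_map_in_charts[OF assms M N m d regular])
    show "can_be_brought_into_normal_form_at M A N B f m"
      by (rule normal_form_in_charts[OF assms M N charts_aroundD(1,2)[OF M c] charts_aroundD(1,2)[OF N d] reg])
  next
    fix m assume fdM: "finite_dimensional_manifold M A" and fdN: "finite_dimensional_manifold N B" and m: "m \<in> topspace M"
    have M: "banach_manifold M A" and N: "banach_manifold N B"
      using fdM fdN unfolding finite_dimensional_manifold_def by auto
    obtain d where d: "d \<in> charts_around B (f m)" using charts_around_nonempty[OF N fm[OF m]] by blast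
    obtain c where c: "c \<in> charts_around A m" using charts_around_nonempty[OF M m] by blast
    note C = charts_aroundD[OF M c] and D = charts_aroundD[OF N d]
    note sm = local_rep_smooth[OF assms c d]
    have "regular_operator (cmodel c) (cmodel d) (dir_deriv (cmodel d) (local_rep c f d) (cmap c m))"
    proof (rule finite_dimensional_regular[OF C(4) D(4)])
      show "finite_dimensional (cmodel c)" "finite_dimensional (cmodel d)"
        using fdM fdN C(1) D(1) unfolding finite_dimensional_manifold_def by auto
      show "linear_map_on (topspace (cmodel c)) (dir_deriv (cmodel d) (local_rep c f d) (cmap c m))"
        by (rule smooth_dir_deriv_linear[OF C(4) D(4) sm])
      show "dir_deriv (cmodel d) (local_rep c f d) (cmap c m) x \<in> topspace (cmodel d)"
        if "x \<in> topspace (cmodel c)" for x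
        by (rule has_dir_deriv_topspace[OF smooth_has_dir_deriv1[OF D(4) sm that]])
    qed
    then show "can_be_brought_into_normal_form_at M A N B f m"
      by (rule normal_form_in_charts[OF assms M N C(1,2) D(1,2)])
  }
qed

end
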